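(* Let $\mathcal{A}$ be an abelian category. Then the monomorphism category $\mathrm{Mon}(\mathcal{A})$ is an exact category (in the sense of Quillen) whose conflations are the sequences $\alpha' \rightarrow \alpha \rightarrow \alpha''$ in $\mathrm{Mon}(\mathcal{A})$ such that the induced sequences of sources $s(\alpha')\to s(\alpha)\to s(\alpha'')$ and of targets $t(\alpha')\to t(\alpha)\to t(\alpha'')$ are short exact in $\mathcal{A}$. Assume further that $\mathcal{A}$ is Frobenius. Then the exact category $\mathrm{Mon}(\mathcal{A})$ is Frobenius, and its projective objects are precisely the direct summands of objects of the form $i_1(P)\oplus i_2(P)$, where $P$ is a projective object in $\mathcal{A}$.
   Context: $\mathrm{Mor}(\mathcal{A})$ denotes the category of morphisms in $\mathcal{A}$: objects are morphisms $\alpha\colon A\to B$ in $\mathcal{A}$, with source $s(\alpha)=A$ and target $t(\alpha)=B$; a morphism from $\alpha\colon A\to B$ to $\alpha'\colon A'\to B'$ is a pair $(f,g)$ with $f\colon A\to A'$, $g\colon B\to B'$ and $\alpha'\circ f=g\circ\alpha$. $\mathrm{Mon}(\mathcal{A})$ is the full subcategory of $\mathrm{Mor}(\mathcal{A})$ consisting of monomorphisms in $\mathcal{A}$. The functors $i_1,i_2\colon\mathcal{A}\to\mathrm{Mon}(\mathcal{A})$ are given by $i_1(A)=(0\to A)$, $i_1(f)=(0,f)$, and $i_2(A)=(A\xrightarrow{\mathrm{Id}_A}A)$, $i_2(f)=(f,f)$. An exact category in the sense of Quillen is an additive category with a distinguished class of kernel-cokernel sequences, called conflations, satisfying Quillen's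 axioms. Projective and injective objects in an exact category are meant relative to conflations. An exact (or abelian) category is Frobenius if it has enough projective objects and enough injective objects and the classes of projective objects and injective objects coincide. *)

theory Defs
  imports "HOL-Algebra.Group"
begin

section \<open>Categories\<close>

record ('o, 'm) category_data =
  Ob :: "'o set"
  Ar :: "'m set"
  Dom :: "'m \<Rightarrow> 'o"
  Cod :: "'m \<Rightarrow> 'o"
  Idn :: "'o \<Rightarrow> 'm"
  Comp :: "'m \<Rightarrow> 'm \<Rightarrow> 'm" (infixl "\<cdot>\<index>" 70)

definition Hom :: "('o, 'm, 'z) category_data_scheme \<Rightarrow> 'o \<Rightarrow> 'o \<Rightarrow> 'm set" where
  "Hom C X Y = {f \<in> Ar C. Dom C f = X \<and> Cod C f = Y}"

locale category =
  fixes C :: "('o, 'm, 'z) category_data_scheme" (structure)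
  assumes Dom_in_Ob: "f \<in> Ar C \<Longrightarrow> Dom C f \<in> Ob C"
    and Cod_in_Ob: "f \<in> Ar C \<Longrightarrow> Cod C f \<in> Ob C"
    and Idn_in_Hom: "X \<in> Ob C \<Longrightarrow> Idn C X \<in> Hom C X X"
    and Comp_in_Hom: "\<lbrakk>f \<in> Hom C X Y; g \<in> Hom C Y W\<rbrakk> \<Longrightarrow> g \<cdot> f \<in> Hom C X W"
    and Comp_Idn_right: "f \<in> Hom C X Y \<Longrightarrow> f \<cdot> Idn C X = f"
    and Comp_Idn_left: "f \<in> Hom C X Y \<Longrightarrow> Idn C Y \<cdot> f = f"
    and Comp_assoc: "\<lbrakk>f \<in> Hom C X Y; g \<in> Hom C Y W; h \<in> Hom C W V\<rbrakk>
      \<Longrightarrow> (h \<cdot> g) \<cdot> f = h \<cdot> (g \<cdot> f)"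

definition is_mono :: "('o, 'm, 'z) category_data_scheme \<Rightarrow> 'm \<Rightarrow> bool" where
  "is_mono C f \<longleftrightarrow> f \<in> Ar C \<and>
    (\<forall>W\<in>Ob C. \<forall>u\<in>Hom C W (Dom C f). \<forall>v\<in>Hom C W (Dom C f).
       f \<cdot>\<^bsub>C\<^esub> u = f \<cdot>\<^bsub>C\<^esub> v \<longrightarrow> u = v)"

definition is_epi :: "('o, 'm, 'z) category_data_scheme \<Rightarrow> 'm \<Rightarrow> bool" where
  "is_epi C f \<longleftrightarrow> f \<in> Ar C \<and>
    (\<forall>W\<in>Ob C. \<forall>u\<in>Hom C (Cod C f) W. \<forall>v\<in>Hom C (Cod C f) W.
       u \<cdot>\<^bsub>C\<^esub> f = v \<cdot>\<^bsub>C\<^esub> f \<longrightarrow> u = v)"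

definition is_iso :: "('o, 'm, 'z) category_data_scheme \<Rightarrow> 'm \<Rightarrow> bool" where
  "is_iso C f \<longleftrightarrow> f \<in> Ar C \<and>
    (\<exists>g\<in>Hom C (Cod C f) (Dom C f).
       g \<cdot>\<^bsub>C\<^esub> f = Idn C (Dom C f) \<and> f \<cdot>\<^bsub>C\<^esub> g = Idn C (Cod C f))"

definition is_zero_object :: "('o, 'm, 'z) category_data_scheme \<Rightarrow> 'o \<Rightarrow> bool" where
  "is_zero_object C Z \<longleftrightarrow> Z \<in> Ob C \<and>
    (\<forall>X\<in>Ob C. (\<exists>!f. f \<in> Hom C Z X) \<and> (\<exists>!f. f \<in> Hom C X Z))"

text \<open>\<open>f' : P \<rightarrow> X\<close> and \<open>g' : P \<rightarrow> Y\<close> form a pullback of \<open>f : X \<rightarrow> W\<close> and \<open>g : Y \<rightarrow> W\<close>.\<close>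

definition is_pullback ::
  "('o, 'm, 'z) category_data_scheme \<Rightarrow> 'm \<Rightarrow> 'm \<Rightarrow> 'm \<Rightarrow> 'm \<Rightarrow> bool" where
  "is_pullback C f g f' g' \<longleftrightarrow>
    f \<in> Ar C \<and> g \<in> Ar C \<and> f' \<in> Ar C \<and> g' \<in> Ar C \<and>
    Cod C f = Cod C g \<and> Cod C f' = Dom C f \<and> Cod C g' = Dom C g \<and> Dom C f' = Dom C g' \<and>
    f \<cdot>\<^bsub>C\<^esub> f' = g \<cdot>\<^bsub>C\<^esub> g' \<and>
    (\<forall>W\<in>Ob C. \<forall>u\<in>Hom C W (Dom C f). \<forall>v\<in>Hom C W (Dom C g). f \<cdot>\<^bsub>C\<^esub> u = g \<cdot>\<^bsub>C\<^esub> v \<longrightarrow>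
       (\<exists>!w. w \<in> Hom C W (Dom C f') \<and> f' \<cdot>\<^bsub>C\<^esub> w = u \<and> g' \<cdot>\<^bsub>C\<^esub> w = v))"

text \<open>\<open>f' : X \<rightarrow> P\<close> and \<open>g' : Y \<rightarrow> P\<close> form a pushout of \<open>f : W \<rightarrow> X\<close> and \<open>g : W \<rightarrow> Y\<close>.\<close>

definition is_pushout ::
  "('o, 'm, 'z) category_data_scheme \<Rightarrow> 'm \<Rightarrow> 'm \<Rightarrow> 'm \<Rightarrow> 'm \<Rightarrow> bool" where
  "is_pushout C f g f' g' \<longleftrightarrow>
    f \<in> Ar C \<and> g \<in> Ar C \<and> f' \<in> Ar C \<and> g' \<in> Ar C \<and>
    Dom C f = Dom C g \<and> Dom C f' = Cod C f \<and> Dom C g' = Cod C g \<and> Cod C f' = Cod C g' \<and>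
    f' \<cdot>\<^bsub>C\<^esub> f = g' \<cdot>\<^bsub>C\<^esub> g \<and>
    (\<forall>W\<in>Ob C. \<forall>u\<in>Hom C (Cod C f) W. \<forall>v\<in>Hom C (Cod C g) W. u \<cdot>\<^bsub>C\<^esub> f = v \<cdot>\<^bsub>C\<^esub> g \<longrightarrow>
       (\<exists>!w. w \<in> Hom C (Cod C f') W \<and> w \<cdot>\<^bsub>C\<^esub> f' = u \<and> w \<cdot>\<^bsub>C\<^esub> g' = v))"

definition full_subcategory ::
  "('o, 'm, 'z) category_data_scheme \<Rightarrow> 'o set \<Rightarrow> ('o, 'm, 'z) category_data_scheme" where
  "full_subcategory C S =
    C\<lparr>Ob := Ob C \<inter> S, Ar := {f \<in> Ar C. Dom C f \<in> S \<and> Cod C f \<in> S}\<rparr>"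


section \<open>Additive and abelian categories\<close>

record ('o, 'm) preadditive_data = "('o, 'm) category_data" +
  Add :: "'m \<Rightarrow> 'm \<Rightarrow> 'm"
  Zero :: "'o \<Rightarrow> 'o \<Rightarrow> 'm"

definition Hom_group :: "('o, 'm, 'z) preadditive_data_scheme \<Rightarrow> 'o \<Rightarrow> 'o \<Rightarrow> 'm monoid" where
  "Hom_group C X Y = \<lparr>carrier = Hom C X Y, mult = Add C, one = Zero C X Y\<rparr>"

locale preadditive_category = category C
  for C :: "('o, 'm, 'z) preadditive_data_scheme" (structure) +
  assumes Hom_comm_group: "\<lbrakk>X \<in> Ob C; Y \<in> Ob C\<rbrakk> \<Longrightarrow> comm_group (Hom_group C X Y)"
    and Comp_Add_right: "\<lbrakk>f \<in> Hom C X Y; f' \<in> Hom C X Y; g \<in> Hom C Y W\<rbrakk>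
      \<Longrightarrow> g \<cdot> Add C f f' = Add C (g \<cdot> f) (g \<cdot> f')"
    and Comp_Add_left: "\<lbrakk>f \<in> Hom C X Y; g \<in> Hom C Y W; g' \<in> Hom C Y W\<rbrakk>
      \<Longrightarrow> Add C g g' \<cdot> f = Add C (g \<cdot> f) (g' \<cdot> f)"

text \<open>\<open>S = X \<oplus> Y\<close> with injections \<open>i\<close>, \<open>j\<close> and projections \<open>p\<close>, \<open>q\<close>.\<close>

definition is_biproduct ::
  "('o, 'm, 'z) preadditive_data_scheme \<Rightarrow> 'o \<Rightarrow> 'o \<Rightarrow> 'o \<Rightarrow> 'm \<Rightarrow> 'm \<Rightarrow> 'm \<Rightarrow> 'm \<Rightarrow> bool" where
  "is_biproduct C X Y S i j p q \<longleftrightarrow>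
    X \<in> Ob C \<and> Y \<in> Ob C \<and> S \<in> Ob C \<and>
    i \<in> Hom C X S \<and> j \<in> Hom C Y S \<and> p \<in> Hom C S X \<and> q \<in> Hom C S Y \<and>
    p \<cdot>\<^bsub>C\<^esub> i = Idn C X \<and> q \<cdot>\<^bsub>C\<^esub> j = Idn C Y \<and>
    p \<cdot>\<^bsub>C\<^esub> j = Zero C Y X \<and> q \<cdot>\<^bsub>C\<^esub> i = Zero C X Y \<and>
    Add C (i \<cdot>\<^bsub>C\<^esub> p) (j \<cdot>\<^bsub>C\<^esub> q) = Idn C S"

definition is_direct_sum ::
  "('o, 'm, 'z) preadditive_data_scheme \<Rightarrow> 'o \<Rightarrow> 'o \<Rightarrow> 'o \<Rightarrow> bool" where
  "is_direct_sum C X Y S \<longleftrightarrow> (\<exists>i j p q. is_biproduct C X Y S i j p q)"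

definition is_direct_summand ::
  "('o, 'm, 'z) preadditive_data_scheme \<Rightarrow> 'o \<Rightarrow> 'o \<Rightarrow> bool" where
  "is_direct_summand C X S \<longleftrightarrow> (\<exists>Y. is_direct_sum C X Y S)"

locale additive_category = preadditive_category C
  for C :: "('o, 'm, 'z) preadditive_data_scheme" (structure) +
  assumes ex_zero_object: "\<exists>Z. is_zero_object C Z"
    and ex_direct_sum: "\<lbrakk>X \<in> Ob C; Y \<in> Ob C\<rbrakk> \<Longrightarrow> \<exists>S. is_direct_sum C X Y S"

definition is_kernel :: "('o, 'm, 'z) preadditive_data_scheme \<Rightarrow> 'm \<Rightarrow> 'm \<Rightarrow> bool" where
  "is_kernel C f k \<longleftrightarrow> f \<in> Ar C \<and> k \<in> Ar C \<and> Cod C k = Dom C f \<and>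
    f \<cdot>\<^bsub>C\<^esub> k = Zero C (Dom C k) (Cod C f) \<and>
    (\<forall>W\<in>Ob C. \<forall>h\<in>Hom C W (Dom C f). f \<cdot>\<^bsub>C\<^esub> h = Zero C W (Cod C f) \<longrightarrow>
       (\<exists>!u. u \<in> Hom C W (Dom C k) \<and> k \<cdot>\<^bsub>C\<^esub> u = h))"

definition is_cokernel :: "('o, 'm, 'z) preadditive_data_scheme \<Rightarrow> 'm \<Rightarrow> 'm \<Rightarrow> bool" where
  "is_cokernel C f c \<longleftrightarrow> f \<in> Ar C \<and> c \<in> Ar C \<and> Dom C c = Cod C f \<and>
    c \<cdot>\<^bsub>C\<^esub> f = Zero C (Dom C f) (Cod C c) \<and>
    (\<forall>W\<in>Ob C. \<forall>h\<in>Hom C (Cod C f) W. h \<cdot>\<^bsub>C\<^esub> f = Zero C (Dom C f) W \<longrightarrow>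
       (\<exists>!u. u \<in> Hom C (Cod C c) W \<and> u \<cdot>\<^bsub>C\<^esub> c = h))"

locale abelian_category = additive_category C
  for C :: "('o, 'm, 'z) preadditive_data_scheme" (structure) +
  assumes ex_kernel: "f \<in> Ar C \<Longrightarrow> \<exists>k. is_kernel C f k"
    and ex_cokernel: "f \<in> Ar C \<Longrightarrow> \<exists>c. is_cokernel C f c"
    and mono_is_kernel: "is_mono C m \<Longrightarrow> \<exists>f. is_kernel C f m"
    and epi_is_cokernel: "is_epi C e \<Longrightarrow> \<exists>f. is_cokernel C f e"

text \<open>A sequence \<open>X \<rightarrow> Y \<rightarrow> W\<close> is encoded as the pair of its two arrows.\<close>

definition kernel_cokernel_pairs ::
  "('o, 'm, 'z) preadditive_data_scheme \<Rightarrow> ('m \<times> 'm) set" where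
  "kernel_cokernel_pairs C = {(i, p). is_kernel C p i \<and> is_cokernel C i p}"

text \<open>In an abelian category, a sequence \<open>0 \<rightarrow> X \<rightarrow> Y \<rightarrow> W \<rightarrow> 0\<close> is called short exact when its
  first map is a kernel of the second and its second map a cokernel of the first. These
  are the conflations relative to which projective and injective objects of an abelian
  category are meant.\<close>

abbreviation short_exact_sequences ::
  "('o, 'm, 'z) preadditive_data_scheme \<Rightarrow> ('m \<times> 'm) set" where
  "short_exact_sequences C \<equiv> kernel_cokernel_pairs C"


section \<open>Exact and Frobenius categories\<close>

definition is_inflation :: "('m \<times> 'm) set \<Rightarrow> 'm \<Rightarrow> bool" where
  "is_inflation E i \<longleftrightarrow> (\<exists>p. (i, p) \<in> E)"

definition is_deflation :: "('m \<times> 'm) set \<Rightarrow> 'm \<Rightarrow> bool" where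
  "is_deflation E p \<longleftrightarrow> (\<exists>i. (i, p) \<in> E)"

text \<open>The axioms are Quillen's original ones, including the axiom on maps possessing
  a kernel (cokernel), which Keller showed to follow from the others.\<close>

locale exact_category = additive_category C
  for C :: "('o, 'm, 'z) preadditive_data_scheme" (structure) +
  fixes E :: "('m \<times> 'm) set"
  assumes conflation_kernel_cokernel: "E \<subseteq> kernel_cokernel_pairs C"
    and conflation_iso_closed:
      "\<lbrakk>(i, p) \<in> E; i' \<in> Ar C; p' \<in> Ar C; Cod C i' = Dom C p';
        is_iso C a; a \<in> Hom C (Dom C i) (Dom C i');
        is_iso C b; b \<in> Hom C (Cod C i) (Cod C i');
        is_iso C c; c \<in> Hom C (Cod C p) (Cod C p');
        b \<cdot> i = i' \<cdot> a; c \<cdot> p = p' \<cdot> b\<rbrakk> \<Longrightarrow> (i', p') \<in> E"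
    and split_conflation: "is_biproduct C X Y S i j p q \<Longrightarrow> (i, q) \<in> E"
    and deflation_comp:
      "\<lbrakk>is_deflation E p; is_deflation E q; Cod C p = Dom C q\<rbrakk> \<Longrightarrow> is_deflation E (q \<cdot> p)"
    and inflation_comp:
      "\<lbrakk>is_inflation E i; is_inflation E j; Cod C i = Dom C j\<rbrakk> \<Longrightarrow> is_inflation E (j \<cdot> i)"
    and deflation_base_change:
      "\<lbrakk>is_deflation E p; f \<in> Ar C; Cod C f = Cod C p\<rbrakk>
        \<Longrightarrow> \<exists>f' p'. is_pullback C p f f' p' \<and> is_deflation E p'"
    and inflation_cobase_change:
      "\<lbrakk>is_inflation E i; f \<in> Ar C; Dom C f = Dom C i\<rbrakk>
        \<Longrightarrow> \<exists>f' i'. is_pushout C i f f' i' \<and> is_inflation E i'"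
    and deflation_cancel:
      "\<lbrakk>f \<in> Ar C; \<exists>k. is_kernel C f k; g \<in> Ar C; Cod C g = Dom C f; is_deflation E (f \<cdot> g)\<rbrakk>
        \<Longrightarrow> is_deflation E f"
    and inflation_cancel:
      "\<lbrakk>f \<in> Ar C; \<exists>c. is_cokernel C f c; g \<in> Ar C; Dom C g = Cod C f; is_inflation E (g \<cdot> f)\<rbrakk>
        \<Longrightarrow> is_inflation E f"

definition is_projective ::
  "('o, 'm, 'z) preadditive_data_scheme \<Rightarrow> ('m \<times> 'm) set \<Rightarrow> 'o \<Rightarrow> bool" where
  "is_projective C E P \<longleftrightarrow> P \<in> Ob C \<and>
    (\<forall>p. is_deflation E p \<longrightarrow>
      (\<forall>f\<in>Hom C P (Cod C p). \<exists>g\<in>Hom C P (Dom C p). p \<cdot>\<^bsub>C\<^esub> g = f))"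

definition is_injective ::
  "('o, 'm, 'z) preadditive_data_scheme \<Rightarrow> ('m \<times> 'm) set \<Rightarrow> 'o \<Rightarrow> bool" where
  "is_injective C E I \<longleftrightarrow> I \<in> Ob C \<and>
    (\<forall>i. is_inflation E i \<longrightarrow>
      (\<forall>f\<in>Hom C (Dom C i) I. \<exists>g\<in>Hom C (Cod C i) I. g \<cdot>\<^bsub>C\<^esub> i = f))"

locale frobenius_category = exact_category C E
  for C :: "('o, 'm, 'z) preadditive_data_scheme" (structure) and E :: "('m \<times> 'm) set" +
  assumes enough_projectives:
      "X \<in> Ob C \<Longrightarrow> \<exists>p. is_deflation E p \<and> Cod C p = X \<and> is_projective C E (Dom C p)"
    and enough_injectives:
      "X \<in> Ob C \<Longrightarrow> \<exists>i. is_inflation E i \<and> Dom C i = X \<and> is_injective C E (Cod C i)"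
    and projective_iff_injective:
      "X \<in> Ob C \<Longrightarrow> is_projective C E X \<longleftrightarrow> is_injective C E X"


section \<open>Morphism and monomorphism categories\<close>

text \<open>A morphism \<open>(f, g) : \<alpha> \<rightarrow> \<alpha>'\<close> in the morphism category. The endpoints \<open>\<alpha>\<close> and \<open>\<alpha>'\<close>
  are recorded because the pair \<open>(f, g)\<close> alone does not determine them.\<close>

datatype 'm square = Square (sq_dom: 'm) (sq_cod: 'm) (src: 'm) (tgt: 'm)

definition Mor ::
  "('o, 'm, 'z) preadditive_data_scheme \<Rightarrow> ('m, 'm square) preadditive_data" where
  "Mor A =
    \<lparr>Ob = Ar A,
     Ar = {Square \<alpha> \<alpha>' f g | \<alpha> \<alpha>' f g.
       \<alpha> \<in> Ar A \<and> \<alpha>' \<in> Ar A \<and>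
       f \<in> Hom A (Dom A \<alpha>) (Dom A \<alpha>') \<and> g \<in> Hom A (Cod A \<alpha>) (Cod A \<alpha>') \<and>
       \<alpha>' \<cdot>\<^bsub>A\<^esub> f = g \<cdot>\<^bsub>A\<^esub> \<alpha>},
     Dom = sq_dom,
     Cod = sq_cod,
     Idn = (\<lambda>\<alpha>. Square \<alpha> \<alpha> (Idn A (Dom A \<alpha>)) (Idn A (Cod A \<alpha>))),
     Comp = (\<lambda>\<psi> \<phi>. Square (sq_dom \<phi>) (sq_cod \<psi>) (src \<psi> \<cdot>\<^bsub>A\<^esub> src \<phi>) (tgt \<psi> \<cdot>\<^bsub>A\<^esub> tgt \<phi>)),
     Add = (\<lambda>\<phi> \<psi>. Square (sq_dom \<phi>) (sq_cod \<phi>) (Add A (src \<phi>) (src \<psi>)) (Add A (tgt \<phi>) (tgt \<psi>))),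
     Zero = (\<lambda>\<alpha> \<beta>. Square \<alpha> \<beta> (Zero A (Dom A \<alpha>) (Dom A \<beta>)) (Zero A (Cod A \<alpha>) (Cod A \<beta>)))\<rparr>"

definition Mon ::
  "('o, 'm, 'z) preadditive_data_scheme \<Rightarrow> ('m, 'm square) preadditive_data" where
  "Mon A = full_subcategory (Mor A) {\<alpha>. is_mono A \<alpha>}"

definition Mon_conflations ::
  "('o, 'm, 'z) preadditive_data_scheme \<Rightarrow> ('m square \<times> 'm square) set" where
  "Mon_conflations A =
    {(\<phi>, \<psi>). \<phi> \<in> Ar (Mon A) \<and> \<psi> \<in> Ar (Mon A) \<and> Cod (Mon A) \<phi> = Dom (Mon A) \<psi> \<and>
       (src \<phi>, src \<psi>) \<in> short_exact_sequences A \<and> (tgt \<phi>, tgt \<psi>) \<in> short_exact_sequences A}"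

text \<open>The functors \<open>i\<^sub>1\<close> and \<open>i\<^sub>2\<close> on objects; \<open>Z\<close> is the zero object used to form \<open>i\<^sub>1\<close>.\<close>

definition i1 :: "('o, 'm, 'z) preadditive_data_scheme \<Rightarrow> 'o \<Rightarrow> 'o \<Rightarrow> 'm" where
  "i1 A Z X = Zero A Z X"

definition i2 :: "('o, 'm, 'z) preadditive_data_scheme \<Rightarrow> 'o \<Rightarrow> 'm" where
  "i2 A X = Idn A X"

end

theory Submission
  imports Defs
begin

text \<open>Kernels, cokernels, pullbacks along deflations and pushouts along inflations in \<open>Mon A\<close> are
  computed componentwise. A morphism of monomorphisms is a deflation iff both components are
  epimorphisms, and it is an inflation iff its target component is a monomorphism and the square
  is a pullback; the latter is what makes the induced map between the cokernels a monomorphism.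

  Maps out of \<open>i\<^sub>1 P\<close> and \<open>i\<^sub>2 P\<close> are maps from \<open>P\<close> to the target and to the source,
  while maps \<open>\<beta> \<rightarrow> i\<^sub>1 P\<close> and \<open>\<beta> \<rightarrow> i\<^sub>2 P\<close> are maps to \<open>P\<close> from the cokernel and from the target of \<open>\<beta>\<close>.
  So if \<open>P\<close> is projective and injective, then so is \<open>i\<^sub>1 P \<oplus> i\<^sub>2 P\<close>. For \<open>\<alpha> : X \<rightarrow> Y\<close>, a deflation
  \<open>P \<rightarrow> X \<oplus> Y\<close> gives a deflation \<open>i\<^sub>1 P \<oplus> i\<^sub>2 P \<rightarrow> \<alpha>\<close>, and an inflation \<open>X \<oplus> Coker \<alpha> \<rightarrow> I\<close> gives an
  inflation \<open>\<alpha> \<rightarrow> i\<^sub>1 I \<oplus> i\<^sub>2 I\<close>. Hence both the projectives and the injectives are exactly the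
  direct summands of such objects.\<close>

section \<open>Preadditive and abelian categories\<close>

context category
begin

text \<open>\<open>Mon A\<close> is in general not abelian: the arrow
  \<open>i1 A Z X \<rightarrow> i2 A X\<close> with components zero and the identity is a
  monomorphism in each component, but the arrow between the cokernels is
  \<open>X \<rightarrow> 0\<close>. So the two halves of the exact structure are not dual. Kernels
  stay inside \<open>Mon A\<close> because a restriction of a monomorphism is a monomorphism,
  whereas every construction with cokernels must prove that an induced arrow is a monomorphism. The
  pullback condition is the form of this requirement that can be composed and cancelled by pasting
  squares. One and the same object has to occur under \<open>i1\<close> and under \<open>i2\<close>;
  this is why a direct sum is covered or embedded, its two parts serving the two summands. The
  projectives and injectives meet in the sums built from \<open>P\<close>, which are both at once
  since \<open>P\<close> is: a projective object splits off the sum that covers it, an injective one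
  is a retract of the sum that contains it.\<close>

lemma Hom_typing: "f \<in> Hom C X Y \<Longrightarrow> f \<in> Ar C \<and> Dom C f = X \<and> Cod C f = Y"
  by (simp add: Hom_def)

lemma Dom_Ob [simp]: "f \<in> Ar C \<Longrightarrow> Dom C f \<in> Ob C"
  and Cod_Ob [simp]: "f \<in> Ar C \<Longrightarrow> Cod C f \<in> Ob C"
  by (simp_all add: Dom_in_Ob Cod_in_Ob)

lemma Idn_typing [simp]:
  assumes "X \<in> Ob C"
  shows "Idn C X \<in> Ar C" "Dom C (Idn C X) = X" "Cod C (Idn C X) = X"
  using Idn_in_Hom[OF assms] by (simp_all add: Hom_def)

text \<open>Arrows are typed by equations for \<open>Dom\<close> and \<open>Cod\<close> rather than
  by membership in \<open>Hom\<close>; the simplifier can then discharge the side conditions of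
  composition on its own.\<close>

lemma Comp_typing [simp]:
  assumes "f \<in> Ar C" "g \<in> Ar C" "Cod C f = Dom C g"
  shows "g \<cdot> f \<in> Ar C" "Dom C (g \<cdot> f) = Dom C f" "Cod C (g \<cdot> f) = Cod C g"
  using Comp_in_Hom[of f "Dom C f" "Cod C f" g "Cod C g"] assms by (simp_all add: Hom_def)

text \<open>\<open>X\<close> is a free variable with an equation as premise, so that the rules also
  fire where the endpoint of \<open>f\<close> and the index of the identity agree only after
  rewriting. \<open>Add_Zero\<close> and \<open>Comp_Zero\<close> have the same form.\<close>

lemma Comp_Idn [simp]:
  "f \<in> Ar C \<Longrightarrow> Dom C f = X \<Longrightarrow> f \<cdot> Idn C X = f"
  "f \<in> Ar C \<Longrightarrow> Cod C f = X \<Longrightarrow> Idn C X \<cdot> f = f"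
  by (auto intro: Comp_Idn_right Comp_Idn_left simp: Hom_def)

lemma Comp_assoc_Ar [simp]:
  assumes "f \<in> Ar C" "g \<in> Ar C" "h \<in> Ar C" "Cod C f = Dom C g" "Cod C g = Dom C h"
  shows "(h \<cdot> g) \<cdot> f = h \<cdot> (g \<cdot> f)"
  by (rule Comp_assoc[of f "Dom C f" "Cod C f" g "Cod C g" h "Cod C h"])
    (simp_all add: Hom_def assms)

text \<open>Composites are normalized to the right, which hides \<open>g \<cdot> f\<close> inside
  \<open>g \<cdot> (f \<cdot> h)\<close>. This rule makes a known equation for
  \<open>g \<cdot> f\<close> usable there.\<close>

lemma Comp_eq_assoc:
  assumes "g \<cdot> f = z" "f \<in> Ar C" "g \<in> Ar C" "h \<in> Ar C" "Cod C h = Dom C f" "Cod C f = Dom C g"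
  shows "g \<cdot> (f \<cdot> h) = z \<cdot> h"
  using assms by auto

lemma mono_Ar: "is_mono C m \<Longrightarrow> m \<in> Ar C"
  and epi_Ar: "is_epi C m \<Longrightarrow> m \<in> Ar C"
  by (simp_all add: is_mono_def is_epi_def)

lemma monoD:
  assumes "is_mono C m" "m \<cdot> u = m \<cdot> v" "u \<in> Ar C" "v \<in> Ar C" "Dom C u = Dom C v"
    "Cod C u = Dom C m" "Cod C v = Dom C m"
  shows "u = v"
  using assms Dom_Ob[of v] unfolding is_mono_def Hom_def by blast

lemma epiD:
  assumes "is_epi C e" "u \<cdot> e = v \<cdot> e" "u \<in> Ar C" "v \<in> Ar C" "Cod C u = Cod C v"
    "Dom C u = Cod C e" "Dom C v = Cod C e"
  shows "u = v"
  using assms Cod_Ob[of v] unfolding is_epi_def Hom_def by blast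

lemma mono_comp:
  assumes "is_mono C f" "is_mono C g" "Cod C f = Dom C g"
  shows "is_mono C (g \<cdot> f)"
  unfolding is_mono_def Hom_def
proof safe
  note [simp] = assms(3) mono_Ar[OF assms(1)] mono_Ar[OF assms(2)]
  show "g \<cdot> f \<in> Ar C" by simp
  fix u v assume [simp]: "u \<in> Ar C" "v \<in> Ar C" "Cod C u = Dom C (g \<cdot> f)"
    "Cod C v = Dom C (g \<cdot> f)" "Dom C v = Dom C u" and eq: "g \<cdot> f \<cdot> u = g \<cdot> f \<cdot> v"
  have "g \<cdot> (f \<cdot> u) = g \<cdot> (f \<cdot> v)" using eq by simp
  then have "f \<cdot> u = f \<cdot> v" by (rule monoD[OF assms(2)]) simp_all
  then show "u = v" by (rule monoD[OF assms(1)]) simp_all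
qed

lemma epi_comp:
  assumes "is_epi C f" "is_epi C g" "Cod C f = Dom C g"
  shows "is_epi C (g \<cdot> f)"
  unfolding is_epi_def Hom_def
proof safe
  note [simp] = assms(3)[symmetric] epi_Ar[OF assms(1)] epi_Ar[OF assms(2)]
  show "g \<cdot> f \<in> Ar C" by simp
  fix u v assume [simp]: "u \<in> Ar C" "v \<in> Ar C" "Dom C u = Cod C (g \<cdot> f)"
    "Dom C v = Cod C (g \<cdot> f)" "Cod C v = Cod C u" and eq: "u \<cdot> (g \<cdot> f) = v \<cdot> (g \<cdot> f)"
  have "(u \<cdot> g) \<cdot> f = (v \<cdot> g) \<cdot> f" using eq by simp
  then have "u \<cdot> g = v \<cdot> g" by (rule epiD[OF assms(1)]) simp_all
  then show "u = v" by (rule epiD[OF assms(2)]) simp_all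
qed

lemma mono_cancel:
  assumes "is_mono C (g \<cdot> f)" "f \<in> Ar C" "g \<in> Ar C" "Cod C f = Dom C g"
  shows "is_mono C f"
  unfolding is_mono_def Hom_def
proof safe
  note [simp] = assms(2-4)
  show "f \<in> Ar C" by simp
  fix u v assume [simp]: "u \<in> Ar C" "v \<in> Ar C" "Cod C u = Dom C f"
    "Cod C v = Dom C f" "Dom C v = Dom C u" and eq: "f \<cdot> u = f \<cdot> v"
  have "g \<cdot> f \<cdot> u = g \<cdot> f \<cdot> v" using eq by simp
  then show "u = v" by (rule monoD[OF assms(1)]) simp_all
qed

lemma epi_cancel:
  assumes "is_epi C (g \<cdot> f)" "f \<in> Ar C" "g \<in> Ar C" "Cod C f = Dom C g"
  shows "is_epi C g"
  unfolding is_epi_def Hom_def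
proof safe
  note [simp] = assms(2,3) assms(4)
  show "g \<in> Ar C" by simp
  fix u v assume [simp]: "u \<in> Ar C" "v \<in> Ar C" "Dom C u = Cod C g"
    "Dom C v = Cod C g" "Cod C v = Cod C u" and eq: "u \<cdot> g = v \<cdot> g"
  have "u \<cdot> (g \<cdot> f) = v \<cdot> (g \<cdot> f)" using eq by (simp flip: Comp_assoc_Ar)
  then show "u = v" by (rule epiD[OF assms(1)]) simp_all
qed

lemma split_mono:
  assumes "g \<cdot> f = Idn C X" "f \<in> Ar C" "g \<in> Ar C" "Cod C f = Dom C g" "X \<in> Ob C"
  shows "is_mono C f"
proof (rule mono_cancel[OF _ assms(2-4)])
  show "is_mono C (g \<cdot> f)"
    unfolding assms(1) is_mono_def Hom_def using assms(5) by auto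
qed

lemma split_epi:
  assumes "g \<cdot> f = Idn C X" "f \<in> Ar C" "g \<in> Ar C" "Cod C f = Dom C g" "X \<in> Ob C"
  shows "is_epi C g"
proof (rule epi_cancel[OF _ assms(2-4)])
  show "is_epi C (g \<cdot> f)"
    unfolding assms(1) is_epi_def Hom_def using assms(5) by auto
qed

lemma pullback_factor:
  assumes "is_pullback C f g f' g'" "u \<in> Ar C" "v \<in> Ar C" "Dom C u = Dom C v"
    "Cod C u = Dom C f" "Cod C v = Dom C g" "f \<cdot> u = g \<cdot> v"
  obtains w where "w \<in> Ar C" "Dom C w = Dom C u" "Cod C w = Dom C f'" "f' \<cdot> w = u" "g' \<cdot> w = v"
proof -
  have "u \<in> Hom C (Dom C u) (Dom C f)" "v \<in> Hom C (Dom C u) (Dom C g)"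
    using assms by (simp_all add: Hom_def)
  with assms Dom_Ob[of u] obtain w where "w \<in> Hom C (Dom C u) (Dom C f') \<and> f' \<cdot> w = u \<and> g' \<cdot> w = v"
    unfolding is_pullback_def by (meson ex1_implies_ex)
  with that show thesis by (auto simp: Hom_def)
qed

lemma pullback_typing:
  assumes "is_pullback C f g f' g'"
  shows "f \<in> Ar C" "g \<in> Ar C" "f' \<in> Ar C" "g' \<in> Ar C"
    "Cod C f = Cod C g" "Cod C f' = Dom C f" "Cod C g' = Dom C g" "Dom C f' = Dom C g'"
    "f \<cdot> f' = g \<cdot> g'"
  using assms unfolding is_pullback_def by auto

lemma pullback_joint_mono:
  assumes "is_pullback C f g f' g'" "u \<in> Ar C" "v \<in> Ar C" "Dom C u = Dom C v"
    "Cod C u = Dom C f'" "Cod C v = Dom C f'" "f' \<cdot> u = f' \<cdot> v" "g' \<cdot> u = g' \<cdot> v"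
  shows "u = v"
proof -
  note [simp] = pullback_typing(1-4)[OF assms(1)] pullback_typing(6-8)[OF assms(1)] assms(2-6)
  have "f' \<cdot> v \<in> Hom C (Dom C v) (Dom C f)" "g' \<cdot> v \<in> Hom C (Dom C v) (Dom C g)"
    "f \<cdot> (f' \<cdot> v) = g \<cdot> (g' \<cdot> v)"
    using Comp_eq_assoc[OF pullback_typing(9)[OF assms(1)]] by (simp_all add: Hom_def)
  then have "\<exists>!w. w \<in> Hom C (Dom C v) (Dom C f') \<and> f' \<cdot> w = f' \<cdot> v \<and> g' \<cdot> w = g' \<cdot> v"
    using assms(1) Dom_Ob[OF assms(3)] unfolding is_pullback_def by blast
  moreover have "u \<in> Hom C (Dom C v) (Dom C f')" "v \<in> Hom C (Dom C v) (Dom C f')"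
    by (simp_all add: Hom_def)
  ultimately show ?thesis using assms(7,8) by blast
qed

text \<open>Separates the existence of a factorization from its uniqueness; the latter is joint
  cancellability of \<open>f'\<close> and \<open>g'\<close>, which tends to have an argument of its
  own.\<close>

lemma is_pullbackI:
  assumes "f \<in> Ar C" "g \<in> Ar C" "f' \<in> Ar C" "g' \<in> Ar C"
    "Cod C f = Cod C g" "Cod C f' = Dom C f" "Cod C g' = Dom C g" "Dom C f' = Dom C g'"
    "f \<cdot> f' = g \<cdot> g'"
    and ex: "\<And>u v. \<lbrakk>u \<in> Ar C; v \<in> Ar C; Dom C v = Dom C u;
      Cod C u = Dom C f; Cod C v = Dom C g; f \<cdot> u = g \<cdot> v\<rbrakk>
      \<Longrightarrow> \<exists>w\<in>Hom C (Dom C u) (Dom C f'). f' \<cdot> w = u \<and> g' \<cdot> w = v"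
    and un: "\<And>u v. \<lbrakk>u \<in> Ar C; v \<in> Ar C; Dom C v = Dom C u;
      Cod C u = Dom C f'; Cod C v = Dom C f'; f' \<cdot> u = f' \<cdot> v; g' \<cdot> u = g' \<cdot> v\<rbrakk> \<Longrightarrow> u = v"
  shows "is_pullback C f g f' g'"
  unfolding is_pullback_def
proof (intro conjI ballI impI assms(1-9))
  fix W u v assume uv: "u \<in> Hom C W (Dom C f)" "v \<in> Hom C W (Dom C g)" "f \<cdot> u = g \<cdot> v"
  then have "\<exists>w\<in>Hom C (Dom C u) (Dom C f'). f' \<cdot> w = u \<and> g' \<cdot> w = v"
    by (intro ex) (simp_all add: Hom_def)
  then obtain w where w: "w \<in> Hom C W (Dom C f')" "f' \<cdot> w = u" "g' \<cdot> w = v"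
    using Hom_typing[OF uv(1)] by blast
  show "\<exists>!w. w \<in> Hom C W (Dom C f') \<and> f' \<cdot> w = u \<and> g' \<cdot> w = v"
  proof (rule ex1I[of _ w])
    fix w' assume w': "w' \<in> Hom C W (Dom C f') \<and> f' \<cdot> w' = u \<and> g' \<cdot> w' = v"
    show "w' = w" by (rule un) (use w w' in \<open>simp_all add: Hom_def\<close>)
  qed (use w in simp)
qed

lemma pushout_factor:
  assumes "is_pushout C f g f' g'" "u \<in> Ar C" "v \<in> Ar C" "Cod C u = Cod C v"
    "Dom C u = Cod C f" "Dom C v = Cod C g" "u \<cdot> f = v \<cdot> g"
  obtains w where "w \<in> Ar C" "Cod C w = Cod C u" "Dom C w = Cod C f'" "w \<cdot> f' = u" "w \<cdot> g' = v"
proof -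
  have "u \<in> Hom C (Cod C f) (Cod C u)" "v \<in> Hom C (Cod C g) (Cod C u)"
    using assms by (simp_all add: Hom_def)
  with assms Cod_Ob[of u] obtain w where "w \<in> Hom C (Cod C f') (Cod C u) \<and> w \<cdot> f' = u \<and> w \<cdot> g' = v"
    unfolding is_pushout_def by (meson ex1_implies_ex)
  with that show thesis by (auto simp: Hom_def)
qed

lemma pushout_typing:
  assumes "is_pushout C f g f' g'"
  shows "f \<in> Ar C" "g \<in> Ar C" "f' \<in> Ar C" "g' \<in> Ar C"
    "Dom C f = Dom C g" "Dom C f' = Cod C f" "Dom C g' = Cod C g" "Cod C f' = Cod C g'"
    "f' \<cdot> f = g' \<cdot> g"
  using assms unfolding is_pushout_def by auto

lemma pushout_joint_epi:
  assumes "is_pushout C f g f' g'" "u \<in> Ar C" "v \<in> Ar C" "Cod C u = Cod C v"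
    "Dom C u = Cod C f'" "Dom C v = Cod C f'" "u \<cdot> f' = v \<cdot> f'" "u \<cdot> g' = v \<cdot> g'"
  shows "u = v"
proof -
  note [simp] = pushout_typing(1-4)[OF assms(1)] pushout_typing(6-8)[OF assms(1)] assms(2-6)
  have "v \<cdot> f' \<in> Hom C (Cod C f) (Cod C v)" "v \<cdot> g' \<in> Hom C (Cod C g) (Cod C v)"
    "(v \<cdot> f') \<cdot> f = (v \<cdot> g') \<cdot> g"
    using pushout_typing(9)[OF assms(1)] by (simp_all add: Hom_def)
  then have "\<exists>!w. w \<in> Hom C (Cod C f') (Cod C v) \<and> w \<cdot> f' = v \<cdot> f' \<and> w \<cdot> g' = v \<cdot> g'"
    using assms(1) Cod_Ob[OF assms(3)] unfolding is_pushout_def by blast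
  moreover have "u \<in> Hom C (Cod C f') (Cod C v)" "v \<in> Hom C (Cod C f') (Cod C v)"
    by (simp_all add: Hom_def)
  ultimately show ?thesis using assms(7,8) by blast
qed

lemma is_pushoutI:
  assumes "f \<in> Ar C" "g \<in> Ar C" "f' \<in> Ar C" "g' \<in> Ar C"
    "Dom C f = Dom C g" "Dom C f' = Cod C f" "Dom C g' = Cod C g" "Cod C f' = Cod C g'"
    "f' \<cdot> f = g' \<cdot> g"
    and ex: "\<And>u v. \<lbrakk>u \<in> Ar C; v \<in> Ar C; Cod C v = Cod C u;
      Dom C u = Cod C f; Dom C v = Cod C g; u \<cdot> f = v \<cdot> g\<rbrakk>
      \<Longrightarrow> \<exists>w\<in>Hom C (Cod C f') (Cod C u). w \<cdot> f' = u \<and> w \<cdot> g' = v"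
    and un: "\<And>u v. \<lbrakk>u \<in> Ar C; v \<in> Ar C; Cod C v = Cod C u;
      Dom C u = Cod C f'; Dom C v = Cod C f'; u \<cdot> f' = v \<cdot> f'; u \<cdot> g' = v \<cdot> g'\<rbrakk> \<Longrightarrow> u = v"
  shows "is_pushout C f g f' g'"
  unfolding is_pushout_def
proof (intro conjI ballI impI assms(1-9))
  fix W u v assume uv: "u \<in> Hom C (Cod C f) W" "v \<in> Hom C (Cod C g) W" "u \<cdot> f = v \<cdot> g"
  then have "\<exists>w\<in>Hom C (Cod C f') (Cod C u). w \<cdot> f' = u \<and> w \<cdot> g' = v"
    by (intro ex) (simp_all add: Hom_def)
  then obtain w where w: "w \<in> Hom C (Cod C f') W" "w \<cdot> f' = u" "w \<cdot> g' = v"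
    using Hom_typing[OF uv(1)] by blast
  show "\<exists>!w. w \<in> Hom C (Cod C f') W \<and> w \<cdot> f' = u \<and> w \<cdot> g' = v"
  proof (rule ex1I[of _ w])
    fix w' assume w': "w' \<in> Hom C (Cod C f') W \<and> w' \<cdot> f' = u \<and> w' \<cdot> g' = v"
    show "w' = w" by (rule un) (use w w' in \<open>simp_all add: Hom_def\<close>)
  qed (use w in simp)
qed

lemma zero_object_eq:
  assumes "is_zero_object C Z" "f \<in> Ar C" "g \<in> Ar C" "Dom C g = Dom C f" "Cod C g = Cod C f"
    "Dom C f = Z \<or> Cod C f = Z"
  shows "f = g"
proof (cases "Dom C f = Z")
  case True
  then have "\<exists>!h. h \<in> Hom C Z (Cod C f)" using assms unfolding is_zero_object_def by auto
  with True assms show ?thesis by (auto simp: Hom_def)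
next
  case False
  then have "\<exists>!h. h \<in> Hom C (Dom C f) Z" using assms unfolding is_zero_object_def by auto
  with False assms show ?thesis by (auto simp: Hom_def)
qed

end

section \<open>Zero arrows, kernels, cokernels and biproducts\<close>

context preadditive_category
begin

text \<open>The hom-group is recovered from the endpoints of \<open>f\<close>, which makes negation
  an operation on arrows alone, as \<open>Add\<close> is.\<close>

definition neg :: "'m \<Rightarrow> 'm" where
  "neg f = inv\<^bsub>Hom_group C (Dom C f) (Cod C f)\<^esub> f"

lemma Zero_typing [simp]:
  assumes "X \<in> Ob C" "Y \<in> Ob C"
  shows "Zero C X Y \<in> Ar C" "Dom C (Zero C X Y) = X" "Cod C (Zero C X Y) = Y"
proof -
  interpret comm_group "Hom_group C X Y" using assms by (rule Hom_comm_group)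
  show "Zero C X Y \<in> Ar C" "Dom C (Zero C X Y) = X" "Cod C (Zero C X Y) = Y"
    using one_closed by (simp_all add: Hom_group_def Hom_def)
qed

lemma Add_typing [simp]:
  assumes "f \<in> Ar C" "g \<in> Ar C" "Dom C g = Dom C f" "Cod C g = Cod C f"
  shows "Add C f g \<in> Ar C" "Dom C (Add C f g) = Dom C f" "Cod C (Add C f g) = Cod C f"
proof -
  interpret comm_group "Hom_group C (Dom C f) (Cod C f)" using assms by (simp add: Hom_comm_group)
  show "Add C f g \<in> Ar C" "Dom C (Add C f g) = Dom C f" "Cod C (Add C f g) = Cod C f"
    using m_closed[of f g] assms by (simp_all add: Hom_group_def Hom_def)
qed

lemma neg_typing [simp]:
  assumes "f \<in> Ar C"
  shows "neg f \<in> Ar C" "Dom C (neg f) = Dom C f" "Cod C (neg f) = Cod C f"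
proof -
  interpret comm_group "Hom_group C (Dom C f) (Cod C f)" using assms by (simp add: Hom_comm_group)
  show "neg f \<in> Ar C" "Dom C (neg f) = Dom C f" "Cod C (neg f) = Cod C f"
    using inv_closed[of f] assms unfolding neg_def by (simp_all add: Hom_group_def Hom_def)
qed

lemma Add_commute:
  assumes "f \<in> Ar C" "g \<in> Ar C" "Dom C g = Dom C f" "Cod C g = Cod C f"
  shows "Add C f g = Add C g f"
proof -
  interpret comm_group "Hom_group C (Dom C f) (Cod C f)" using assms by (simp add: Hom_comm_group)
  show ?thesis using m_comm[of f g] assms by (simp add: Hom_group_def Hom_def)
qed

lemma Add_neg:
  assumes "f \<in> Ar C"
  shows "Add C f (neg f) = Zero C (Dom C f) (Cod C f)"
proof -
  interpret comm_group "Hom_group C (Dom C f) (Cod C f)" using assms by (simp add: Hom_comm_group)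
  show ?thesis using r_inv[of f] assms unfolding neg_def by (simp add: Hom_group_def Hom_def)
qed

lemma Add_assoc:
  assumes "f \<in> Ar C" "g \<in> Ar C" "h \<in> Ar C" "Dom C g = Dom C f" "Cod C g = Cod C f"
    "Dom C h = Dom C f" "Cod C h = Cod C f"
  shows "Add C (Add C f g) h = Add C f (Add C g h)"
proof -
  interpret comm_group "Hom_group C (Dom C f) (Cod C f)" using assms by (simp add: Hom_comm_group)
  show ?thesis using m_assoc[of f g h] assms by (simp add: Hom_group_def Hom_def)
qed

lemma Add_Zero [simp]:
  assumes "f \<in> Ar C" "Dom C f = X" "Cod C f = Y"
  shows "Add C (Zero C X Y) f = f" "Add C f (Zero C X Y) = f"
proof -
  interpret comm_group "Hom_group C X Y" using assms Dom_Ob Cod_Ob by (intro Hom_comm_group) auto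
  show "Add C (Zero C X Y) f = f" "Add C f (Zero C X Y) = f"
    using l_one[of f] r_one[of f] assms by (simp_all add: Hom_group_def Hom_def)
qed

lemma Add_cancel:
  assumes "Add C f h = Add C g h"
    "f \<in> Ar C" "g \<in> Ar C" "h \<in> Ar C" "Dom C g = Dom C f" "Cod C g = Cod C f"
    "Dom C h = Dom C f" "Cod C h = Cod C f"
  shows "f = g"
proof -
  interpret comm_group "Hom_group C (Dom C f) (Cod C f)" using assms by (simp add: Hom_comm_group)
  show ?thesis using right_cancel[of h f g] assms by (simp add: Hom_group_def Hom_def)
qed

lemma Comp_Add [simp]:
  "\<lbrakk>f \<in> Ar C; f' \<in> Ar C; g \<in> Ar C; Dom C f' = Dom C f; Cod C f' = Cod C f; Cod C f = Dom C g\<rbrakk>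
    \<Longrightarrow> g \<cdot> Add C f f' = Add C (g \<cdot> f) (g \<cdot> f')"
  "\<lbrakk>f \<in> Ar C; f' \<in> Ar C; h \<in> Ar C; Dom C f' = Dom C f; Cod C f' = Cod C f; Cod C h = Dom C f\<rbrakk>
    \<Longrightarrow> Add C f f' \<cdot> h = Add C (f \<cdot> h) (f' \<cdot> h)"
  by (rule Comp_Add_right Comp_Add_left; simp add: Hom_def)+

text \<open>The zero arrow equals its own double, hence so does any composite with it; cancelling
  one copy leaves zero.\<close>

lemma Comp_Zero [simp]:
  assumes f: "f \<in> Ar C" "W \<in> Ob C"
  shows "Dom C f = X \<Longrightarrow> f \<cdot> Zero C W X = Zero C W (Cod C f)"
    and "Cod C f = X \<Longrightarrow> Zero C X W \<cdot> f = Zero C (Dom C f) W"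
proof -
  assume X: "Dom C f = X"
  have [simp]: "X \<in> Ob C" using Dom_Ob[OF f(1)] X by simp
  have "Add C (Zero C W (Cod C f)) (f \<cdot> Zero C W X) = f \<cdot> Add C (Zero C W X) (Zero C W X)"
    using f X by simp
  also have "\<dots> = Add C (f \<cdot> Zero C W X) (f \<cdot> Zero C W X)"
    by (rule Comp_Add) (use f X in simp_all)
  finally show "f \<cdot> Zero C W X = Zero C W (Cod C f)"
    by (rule Add_cancel[OF sym]) (use f X in simp_all)
next
  assume X: "Cod C f = X"
  have [simp]: "X \<in> Ob C" using Cod_Ob[OF f(1)] X by simp
  have "Add C (Zero C (Dom C f) W) (Zero C X W \<cdot> f) = Add C (Zero C X W) (Zero C X W) \<cdot> f"
    using f X by simp
  also have "\<dots> = Add C (Zero C X W \<cdot> f) (Zero C X W \<cdot> f)"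
    by (rule Comp_Add) (use f X in simp_all)
  finally show "Zero C X W \<cdot> f = Zero C (Dom C f) W"
    by (rule Add_cancel[OF sym]) (use f X in simp_all)
qed

lemma Comp_neg [simp]:
  assumes [simp]: "f \<in> Ar C" "g \<in> Ar C" "Cod C f = Dom C g"
  shows "g \<cdot> neg f = neg (g \<cdot> f)" "neg g \<cdot> f = neg (g \<cdot> f)"
proof -
  have e: "Add C (neg h) h = Zero C (Dom C h) (Cod C h)" if [simp]: "h \<in> Ar C" for h
    using Add_commute[of h "neg h"] Add_neg[of h] by simp
  have [simp]: "Dom C g \<in> Ob C" using Dom_Ob by simp
  have "Add C (g \<cdot> neg f) (g \<cdot> f) = g \<cdot> Add C (neg f) f" by simp
  also have "\<dots> = Add C (neg (g \<cdot> f)) (g \<cdot> f)" by (simp add: e)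
  finally show "g \<cdot> neg f = neg (g \<cdot> f)" by (rule Add_cancel) simp_all
  have "Add C (neg g \<cdot> f) (g \<cdot> f) = Add C (neg g) g \<cdot> f" by simp
  also have "\<dots> = Add C (neg (g \<cdot> f)) (g \<cdot> f)" by (simp add: e)
  finally show "neg g \<cdot> f = neg (g \<cdot> f)" by (rule Add_cancel) simp_all
qed

lemma neg_Zero [simp]:
  assumes "X \<in> Ob C" "Y \<in> Ob C"
  shows "neg (Zero C X Y) = Zero C X Y"
proof -
  have "Add C (Zero C X Y) (neg (Zero C X Y)) = Zero C X Y"
    using Add_neg[of "Zero C X Y"] assms by simp
  then show ?thesis using assms by simp
qed

lemma eq_if_diff_zero:
  assumes "Add C f (neg g) = Zero C (Dom C f) (Cod C f)"
    "f \<in> Ar C" "g \<in> Ar C" "Dom C g = Dom C f" "Cod C g = Cod C f"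
  shows "f = g"
  by (rule Add_cancel[of _ "neg g"]) (use assms Add_neg[of g] in simp_all)

text \<open>If \<open>m\<close> identifies two arrows it kills their difference, so cancellability
  need only be tested against zero.\<close>

lemma monoI:
  assumes m: "m \<in> Ar C" and z: "\<And>u. \<lbrakk>u \<in> Ar C; Cod C u = Dom C m; m \<cdot> u = Zero C (Dom C u) (Cod C m)\<rbrakk>
    \<Longrightarrow> u = Zero C (Dom C u) (Dom C m)"
  shows "is_mono C m"
  unfolding is_mono_def Hom_def
proof safe
  fix u v assume [simp]: "u \<in> Ar C" "v \<in> Ar C" "Cod C u = Dom C m"
    "Cod C v = Dom C m" "Dom C v = Dom C u" and eq: "m \<cdot> u = m \<cdot> v"
  note [simp] = m
  have "Add C u (neg v) = Zero C (Dom C u) (Dom C m)"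
    using z[of "Add C u (neg v)"] eq Add_neg[of "m \<cdot> v"] by simp
  then show "u = v" by - (rule eq_if_diff_zero, simp_all)
qed (rule m)

lemma epiI:
  assumes m: "m \<in> Ar C" and z: "\<And>u. \<lbrakk>u \<in> Ar C; Dom C u = Cod C m; u \<cdot> m = Zero C (Dom C m) (Cod C u)\<rbrakk>
    \<Longrightarrow> u = Zero C (Cod C m) (Cod C u)"
  shows "is_epi C m"
  unfolding is_epi_def Hom_def
proof safe
  fix u v assume [simp]: "u \<in> Ar C" "v \<in> Ar C" "Dom C u = Cod C m"
    "Dom C v = Cod C m" "Cod C v = Cod C u" and eq: "u \<cdot> m = v \<cdot> m"
  note [simp] = m
  have "Add C u (neg v) = Zero C (Cod C m) (Cod C u)"
    using z[of "Add C u (neg v)"] eq Add_neg[of "v \<cdot> m"] by simp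
  then show "u = v" by - (rule eq_if_diff_zero, simp_all)
qed (rule m)

lemma mono_zeroD:
  assumes "is_mono C m" "m \<cdot> u = Zero C W Y" "u \<in> Ar C" "Cod C u = Dom C m" "Dom C u = W" "Cod C m = Y"
  shows "u = Zero C W (Dom C m)"
  by (rule monoD[OF assms(1)]) (use assms mono_Ar[OF assms(1)] in auto)

lemma epi_zeroD:
  assumes "is_epi C m" "u \<cdot> m = Zero C Y W" "u \<in> Ar C" "Dom C u = Cod C m" "Cod C u = W" "Dom C m = Y"
  shows "u = Zero C (Cod C m) W"
  by (rule epiD[OF assms(1)]) (use assms epi_Ar[OF assms(1)] in auto)

lemma kernel_typing:
  assumes "is_kernel C f k"
  shows "f \<in> Ar C" "k \<in> Ar C" "Cod C k = Dom C f" "f \<cdot> k = Zero C (Dom C k) (Cod C f)"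
  using assms unfolding is_kernel_def by auto

lemma cokernel_typing:
  assumes "is_cokernel C f k"
  shows "f \<in> Ar C" "k \<in> Ar C" "Dom C k = Cod C f" "k \<cdot> f = Zero C (Dom C f) (Cod C k)"
  using assms unfolding is_cokernel_def by auto

lemma kernel_factor:
  assumes "is_kernel C f k" "h \<in> Ar C" "Cod C h = Dom C f" "f \<cdot> h = Zero C (Dom C h) (Cod C f)"
  obtains u where "u \<in> Ar C" "Dom C u = Dom C h" "Cod C u = Dom C k" "k \<cdot> u = h"
proof -
  have "h \<in> Hom C (Dom C h) (Dom C f)" using assms by (simp add: Hom_def)
  with assms Dom_Ob[of h] obtain u where "u \<in> Hom C (Dom C h) (Dom C k)" "k \<cdot> u = h"
    unfolding is_kernel_def by (meson ex1_implies_ex)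
  with that show thesis by (auto simp: Hom_def)
qed

lemma cokernel_factor:
  assumes "is_cokernel C f k" "h \<in> Ar C" "Dom C h = Cod C f" "h \<cdot> f = Zero C (Dom C f) (Cod C h)"
  obtains u where "u \<in> Ar C" "Cod C u = Cod C h" "Dom C u = Cod C k" "u \<cdot> k = h"
proof -
  have "h \<in> Hom C (Cod C f) (Cod C h)" using assms by (simp add: Hom_def)
  with assms Cod_Ob[of h] obtain u where "u \<in> Hom C (Cod C k) (Cod C h)" "u \<cdot> k = h"
    unfolding is_cokernel_def by (meson ex1_implies_ex)
  with that show thesis by (auto simp: Hom_def)
qed

text \<open>An arrow killed by \<open>k\<close> and the zero arrow both factor the zero arrow
  through \<open>k\<close>, and such a factorization is unique.\<close>

lemma kernel_mono:
  assumes "is_kernel C f k"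
  shows "is_mono C k"
proof (rule monoI)
  note [simp] = kernel_typing[OF assms]
  show "k \<in> Ar C" by simp
  fix u assume [simp]: "u \<in> Ar C" "Cod C u = Dom C k" and "k \<cdot> u = Zero C (Dom C u) (Cod C k)"
  then have *: "k \<cdot> u = Zero C (Dom C u) (Dom C f)" by simp
  have "\<exists>!v. v \<in> Hom C (Dom C u) (Dom C k) \<and> k \<cdot> v = Zero C (Dom C u) (Dom C f)"
    using assms by (simp add: is_kernel_def Hom_def)
  moreover have "u \<in> Hom C (Dom C u) (Dom C k) \<and> k \<cdot> u = Zero C (Dom C u) (Dom C f)"
    using * by (simp add: Hom_def)
  moreover have "Zero C (Dom C u) (Dom C k) \<in> Hom C (Dom C u) (Dom C k) \<and>
      k \<cdot> Zero C (Dom C u) (Dom C k) = Zero C (Dom C u) (Dom C f)"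
    by (simp add: Hom_def)
  ultimately show "u = Zero C (Dom C u) (Dom C k)" by blast
qed

lemma cokernel_epi:
  assumes "is_cokernel C f k"
  shows "is_epi C k"
proof (rule epiI)
  note [simp] = cokernel_typing[OF assms]
  show "k \<in> Ar C" by simp
  fix u assume [simp]: "u \<in> Ar C" "Dom C u = Cod C k" and "u \<cdot> k = Zero C (Dom C k) (Cod C u)"
  then have *: "u \<cdot> k = Zero C (Cod C f) (Cod C u)" by simp
  have "\<exists>!v. v \<in> Hom C (Cod C k) (Cod C u) \<and> v \<cdot> k = Zero C (Cod C f) (Cod C u)"
    using assms by (simp add: is_cokernel_def Hom_def)
  moreover have "u \<in> Hom C (Cod C k) (Cod C u) \<and> u \<cdot> k = Zero C (Cod C f) (Cod C u)"
    using * by (simp add: Hom_def)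
  moreover have "Zero C (Cod C k) (Cod C u) \<in> Hom C (Cod C k) (Cod C u) \<and>
      Zero C (Cod C k) (Cod C u) \<cdot> k = Zero C (Cod C f) (Cod C u)"
    by (simp add: Hom_def)
  ultimately show "u = Zero C (Cod C k) (Cod C u)" by blast
qed

text \<open>Uniqueness of the factorization is supplied by the monomorphism \<open>k\<close>, so
  existence is all that is left to check.\<close>

lemma is_kernelI:
  assumes "f \<in> Ar C" "is_mono C k" "Cod C k = Dom C f" "f \<cdot> k = Zero C (Dom C k) (Cod C f)"
    and ex: "\<And>h. \<lbrakk>h \<in> Ar C; Cod C h = Dom C f; f \<cdot> h = Zero C (Dom C h) (Cod C f)\<rbrakk>
      \<Longrightarrow> \<exists>u\<in>Hom C (Dom C h) (Dom C k). k \<cdot> u = h"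
  shows "is_kernel C f k"
  unfolding is_kernel_def
proof (intro conjI ballI impI assms(1,3,4) mono_Ar[OF assms(2)])
  fix W h assume "W \<in> Ob C" "h \<in> Hom C W (Dom C f)" "f \<cdot> h = Zero C W (Cod C f)"
  then have "\<exists>u\<in>Hom C W (Dom C k). k \<cdot> u = h"
    using ex[of h] by (simp add: Hom_def)
  then obtain u where u: "u \<in> Hom C W (Dom C k)" "k \<cdot> u = h" by blast
  show "\<exists>!u. u \<in> Hom C W (Dom C k) \<and> k \<cdot> u = h"
  proof (rule ex1I[of _ u])
    fix v assume v: "v \<in> Hom C W (Dom C k) \<and> k \<cdot> v = h"
    show "v = u" by (rule monoD[OF assms(2)]) (use u v in \<open>simp_all add: Hom_def\<close>)
  qed (use u in simp)
qed

lemma is_cokernelI: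
  assumes "f \<in> Ar C" "is_epi C k" "Dom C k = Cod C f" "k \<cdot> f = Zero C (Dom C f) (Cod C k)"
    and ex: "\<And>h. \<lbrakk>h \<in> Ar C; Dom C h = Cod C f; h \<cdot> f = Zero C (Dom C f) (Cod C h)\<rbrakk>
      \<Longrightarrow> \<exists>u\<in>Hom C (Cod C k) (Cod C h). u \<cdot> k = h"
  shows "is_cokernel C f k"
  unfolding is_cokernel_def
proof (intro conjI ballI impI assms(1,3,4) epi_Ar[OF assms(2)])
  fix W h assume "W \<in> Ob C" "h \<in> Hom C (Cod C f) W" "h \<cdot> f = Zero C (Dom C f) W"
  then have "\<exists>u\<in>Hom C (Cod C k) W. u \<cdot> k = h"
    using ex[of h] by (simp add: Hom_def)
  then obtain u where u: "u \<in> Hom C (Cod C k) W" "u \<cdot> k = h" by blast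
  show "\<exists>!u. u \<in> Hom C (Cod C k) W \<and> u \<cdot> k = h"
  proof (rule ex1I[of _ u])
    fix v assume v: "v \<in> Hom C (Cod C k) W \<and> v \<cdot> k = h"
    show "v = u" by (rule epiD[OF assms(2)]) (use u v in \<open>simp_all add: Hom_def\<close>)
  qed (use u in simp)
qed

lemma biproduct_typing:
  assumes "is_biproduct C X Y S i j p q"
  shows "X \<in> Ob C" "Y \<in> Ob C" "S \<in> Ob C" "i \<in> Ar C" "Dom C i = X" "Cod C i = S"
    "j \<in> Ar C" "Dom C j = Y" "Cod C j = S" "p \<in> Ar C" "Dom C p = S" "Cod C p = X"
    "q \<in> Ar C" "Dom C q = S" "Cod C q = Y" "p \<cdot> i = Idn C X" "q \<cdot> j = Idn C Y"
    "p \<cdot> j = Zero C Y X" "q \<cdot> i = Zero C X Y" "Add C (i \<cdot> p) (j \<cdot> q) = Idn C S"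
  using assms unfolding is_biproduct_def Hom_def by auto

lemma biproduct_joint_mono:
  assumes S: "is_biproduct C X Y S i j p q"
    and [simp]: "u \<in> Ar C" "v \<in> Ar C" "Dom C u = Dom C v" "Cod C u = S" "Cod C v = S"
    and eq: "p \<cdot> u = p \<cdot> v" "q \<cdot> u = q \<cdot> v"
  shows "u = v"
proof -
  note [simp] = biproduct_typing(1-19)[OF S]
  \<comment> \<open>Since \<open>i \<cdot> p\<close> and \<open>j \<cdot> q\<close> add up to the
    identity of \<open>S\<close>, an arrow into \<open>S\<close> is rebuilt from its two
    coordinates.\<close>
  have "h = Add C (i \<cdot> (p \<cdot> h)) (j \<cdot> (q \<cdot> h))" if [simp]: "h \<in> Ar C" "Cod C h = S" for h
  proof -
    have "h = Add C (i \<cdot> p) (j \<cdot> q) \<cdot> h" by (subst biproduct_typing(20)[OF S]) simp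
    then show ?thesis by simp
  qed
  from this[of u] this[of v] show ?thesis by (simp add: eq)
qed

lemma biproduct_joint_epi:
  assumes S: "is_biproduct C X Y S i j p q"
    and [simp]: "u \<in> Ar C" "v \<in> Ar C" "Cod C u = Cod C v" "Dom C u = S" "Dom C v = S"
    and eq: "u \<cdot> i = v \<cdot> i" "u \<cdot> j = v \<cdot> j"
  shows "u = v"
proof -
  note [simp] = biproduct_typing(1-19)[OF S]
  have "h = Add C (h \<cdot> i \<cdot> p) (h \<cdot> j \<cdot> q)" if [simp]: "h \<in> Ar C" "Dom C h = S" for h
  proof -
    have "h = h \<cdot> Add C (i \<cdot> p) (j \<cdot> q)" by (subst biproduct_typing(20)[OF S]) simp
    then show ?thesis by simp
  qed
  from this[of u] this[of v] show ?thesis by (simp only: eq assms)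
qed

lemma biproduct_pair:
  assumes S: "is_biproduct C X Y S i j p q"
    and [simp]: "f \<in> Ar C" "g \<in> Ar C" "Dom C g = Dom C f" "Cod C f = X" "Cod C g = Y"
  obtains h where "h \<in> Ar C" "Dom C h = Dom C f" "Cod C h = S" "p \<cdot> h = f" "q \<cdot> h = g"
proof -
  note [simp] = biproduct_typing(1-19)[OF S]
  show thesis
    by (rule that[of "Add C (i \<cdot> f) (j \<cdot> g)"])
      (simp_all add: Comp_eq_assoc[OF biproduct_typing(16)[OF S]] Comp_eq_assoc[OF biproduct_typing(17)[OF S]]
        Comp_eq_assoc[OF biproduct_typing(18)[OF S]] Comp_eq_assoc[OF biproduct_typing(19)[OF S]])
qed

lemma biproduct_copair:
  assumes S: "is_biproduct C X Y S i j p q"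
    and [simp]: "f \<in> Ar C" "g \<in> Ar C" "Cod C g = Cod C f" "Dom C f = X" "Dom C g = Y"
  obtains h where "h \<in> Ar C" "Cod C h = Cod C f" "Dom C h = S" "h \<cdot> i = f" "h \<cdot> j = g"
proof -
  note [simp] = biproduct_typing(1-19)[OF S]
  show thesis
    by (rule that[of "Add C (f \<cdot> p) (g \<cdot> q)"]) simp_all
qed

text \<open>An arrow \<open>h\<close> killed by \<open>q\<close> has the same coordinates as
  \<open>i \<cdot> (p \<cdot> h)\<close>, so it factors through \<open>i\<close>. Dually, an arrow
  that kills \<open>i\<close> factors through \<open>q\<close> by way of \<open>j\<close>.\<close>

lemma biproduct_ses:
  assumes S: "is_biproduct C X Y S i j p q"
  shows "is_kernel C q i" "is_cokernel C i q"
proof -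
  note [simp] = biproduct_typing(1-19)[OF S]
  show "is_kernel C q i"
  proof (rule is_kernelI)
    show "is_mono C i" by (rule split_mono[of p i X]) simp_all
    fix h assume [simp]: "h \<in> Ar C" "Cod C h = Dom C q" and z: "q \<cdot> h = Zero C (Dom C h) (Cod C q)"
    have "i \<cdot> (p \<cdot> h) = h"
      by (rule biproduct_joint_mono[OF S])
        (simp_all add: z Comp_eq_assoc[OF biproduct_typing(16)[OF S]] Comp_eq_assoc[OF biproduct_typing(19)[OF S]])
    then show "\<exists>u\<in>Hom C (Dom C h) (Dom C i). i \<cdot> u = h"
      by (rule bexI[of _ "p \<cdot> h"]) (simp_all add: Hom_def)
  qed simp_all
  show "is_cokernel C i q"
  proof (rule is_cokernelI)
    show "is_epi C q" by (rule split_epi[of q j Y]) simp_all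
    fix h assume [simp]: "h \<in> Ar C" "Dom C h = Cod C i" and z: "h \<cdot> i = Zero C (Dom C i) (Cod C h)"
    have "(h \<cdot> j) \<cdot> q = h"
      by (rule biproduct_joint_epi[OF S]) (simp_all add: z)
    then show "\<exists>u\<in>Hom C (Cod C q) (Cod C h). u \<cdot> q = h"
      by (rule bexI[of _ "h \<cdot> j"]) (simp_all add: Hom_def)
  qed simp_all
qed

text \<open>This is how direct summands arise later: a deflation onto a projective object has a
  section, and then the kernel of the deflation is a complement of that object.\<close>

lemma kernel_of_split_epi_biproduct:
  assumes k: "is_kernel C p k" and [simp]: "s \<in> Ar C" "Dom C s = Cod C p" "Cod C s = Dom C p"
    and ps: "p \<cdot> s = Idn C (Cod C p)"
  shows "is_direct_sum C (Cod C p) (Dom C k) (Dom C p)"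
proof -
  note [simp] = kernel_typing[OF k] ps
  note ps' = Comp_eq_assoc[OF ps]
  define e where "e = Add C (Idn C (Dom C p)) (neg (s \<cdot> p))" \<comment> \<open>the idempotent projecting onto the kernel\<close>
  have [simp]: "e \<in> Ar C" "Dom C e = Dom C p" "Cod C e = Dom C p" by (simp_all add: e_def)
  have "p \<cdot> e = Zero C (Dom C e) (Cod C p)"
    using Add_neg[of p] by (simp add: e_def ps')
  then obtain r where r [simp]: "r \<in> Ar C" "Dom C r = Dom C p" "Cod C r = Dom C k" "k \<cdot> r = e"
    using kernel_factor[OF k, of e] by auto
  note m = kernel_mono[OF k]
  \<comment> \<open>Both equations for \<open>r\<close> are tested after the monomorphism
    \<open>k\<close>: \<open>e \<cdot> k\<close> is \<open>k\<close> because
    \<open>p \<cdot> k\<close> is zero, and \<open>e \<cdot> s\<close> is zero because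
    \<open>p \<cdot> s\<close> is the identity.\<close>
  have rk: "r \<cdot> k = Idn C (Dom C k)"
    by (rule monoD[OF m]) (simp_all add: Comp_eq_assoc[OF r(4)], simp add: e_def)
  have rs: "r \<cdot> s = Zero C (Cod C p) (Dom C k)"
    by (rule mono_zeroD[OF m])
      (simp_all add: Comp_eq_assoc[OF r(4)], simp add: e_def Add_neg[of s])
  have "Add C (s \<cdot> p) e = Add C e (s \<cdot> p)" by (rule Add_commute) simp_all
  also have "\<dots> = Add C (Idn C (Dom C p)) (Add C (neg (s \<cdot> p)) (s \<cdot> p))"
    unfolding e_def by (rule Add_assoc) simp_all
  also have "Add C (neg (s \<cdot> p)) (s \<cdot> p) = Zero C (Dom C p) (Dom C p)"
    using Add_commute[of "neg (s \<cdot> p)" "s \<cdot> p"] Add_neg[of "s \<cdot> p"] by simp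
  finally have "is_biproduct C (Cod C p) (Dom C k) (Dom C p) s k p r"
    by (simp add: is_biproduct_def Hom_def rk rs)
  then show ?thesis unfolding is_direct_sum_def by blast
qed

end

section \<open>Short exact sequences, pushouts and pullbacks in an abelian category\<close>

context abelian_category
begin

text \<open>The monomorphism \<open>m\<close> is the kernel of some \<open>f\<close>, and
  \<open>f\<close> factors through the cokernel \<open>c\<close>. So whatever \<open>c\<close> kills
  is killed by \<open>f\<close> and hence factors through \<open>m\<close>.\<close>

lemma kernel_of_cokernel:
  assumes m: "is_mono C m" and c: "is_cokernel C m c"
  shows "is_kernel C c m"
proof (rule is_kernelI[OF _ m])
  note [simp] = cokernel_typing[OF c]
  show "c \<in> Ar C" "Cod C m = Dom C c" "c \<cdot> m = Zero C (Dom C m) (Cod C c)" by simp_all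
  obtain f where f: "is_kernel C f m" using mono_is_kernel[OF m] by blast
  note [simp] = kernel_typing(1,4)[OF f] kernel_typing(3)[OF f, symmetric]
  obtain g where g [simp]: "g \<in> Ar C" "Cod C g = Cod C f" "Dom C g = Cod C c" "g \<cdot> c = f"
    using cokernel_factor[OF c, of f] by auto
  fix h assume [simp]: "h \<in> Ar C" "Cod C h = Dom C c" and z: "c \<cdot> h = Zero C (Dom C h) (Cod C c)"
  have "f \<cdot> h = g \<cdot> (c \<cdot> h)" by (subst g(4)[symmetric], rule Comp_assoc_Ar) simp_all
  then obtain u where "u \<in> Ar C" "Dom C u = Dom C h" "Cod C u = Dom C m" "m \<cdot> u = h"
    using kernel_factor[OF f, of h] z by auto
  then show "\<exists>u\<in>Hom C (Dom C h) (Dom C m). m \<cdot> u = h" by (auto simp: Hom_def)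
qed

lemma cokernel_of_kernel:
  assumes e: "is_epi C e" and k: "is_kernel C e k"
  shows "is_cokernel C k e"
proof (rule is_cokernelI[OF _ e])
  note [simp] = kernel_typing[OF k]
  show "k \<in> Ar C" "Dom C e = Cod C k" "e \<cdot> k = Zero C (Dom C k) (Cod C e)" by simp_all
  obtain f where f: "is_cokernel C f e" using epi_is_cokernel[OF e] by blast
  note [simp] = cokernel_typing(1,4)[OF f] cokernel_typing(3)[OF f]
  obtain g where g [simp]: "g \<in> Ar C" "Dom C g = Dom C f" "Cod C g = Dom C k" "k \<cdot> g = f"
    using kernel_factor[OF k, of f] by auto
  fix h assume [simp]: "h \<in> Ar C" "Dom C h = Cod C k" and z: "h \<cdot> k = Zero C (Dom C k) (Cod C h)"
  have "h \<cdot> f = (h \<cdot> k) \<cdot> g" using g(4) by simp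
  then obtain u where "u \<in> Ar C" "Cod C u = Cod C h" "Dom C u = Cod C e" "u \<cdot> e = h"
    using cokernel_factor[OF f, of h] z by auto
  then show "\<exists>u\<in>Hom C (Cod C e) (Cod C h). u \<cdot> e = h" by (auto simp: Hom_def)
qed

text \<open>In an abelian category half of the condition on a kernel-cokernel pair is automatic. The
  first form suits sequences built from their deflation, the second those built from their
  inflation.\<close>

lemma ses_iff:
  "(i, p) \<in> kernel_cokernel_pairs C \<longleftrightarrow> is_kernel C p i \<and> is_epi C p"
  "(i, p) \<in> kernel_cokernel_pairs C \<longleftrightarrow> is_mono C i \<and> is_cokernel C i p"
  unfolding kernel_cokernel_pairs_def
  by (auto intro: kernel_of_cokernel cokernel_of_kernel kernel_mono cokernel_epi)

lemma deflation_iff_epi: "is_deflation (kernel_cokernel_pairs C) p \<longleftrightarrow> is_epi C p"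
  unfolding is_deflation_def ses_iff(1) using ex_kernel epi_Ar by blast

lemma inflation_iff_mono: "is_inflation (kernel_cokernel_pairs C) i \<longleftrightarrow> is_mono C i"
  unfolding is_inflation_def ses_iff(2) using ex_cokernel mono_Ar by blast

lemma pushout_of_mono:
  assumes i: "is_mono C i" and [simp]: "f \<in> Ar C" "Dom C f = Dom C i"
  obtains f' i' where "is_pushout C i f f' i'" "is_mono C i'"
proof -
  note [simp] = mono_Ar[OF i]
  obtain S a b p q where S: "is_biproduct C (Cod C i) (Cod C f) S a b p q"
    using ex_direct_sum[of "Cod C i" "Cod C f"] unfolding is_direct_sum_def by auto
  note [simp] = biproduct_typing(1-19)[OF S]
  \<comment> \<open>the pushout is the cokernel of the monomorphism \<open>(i, -f)\<close>\<close>
  obtain u where u [simp]: "u \<in> Ar C" "Dom C u = Dom C i" "Cod C u = S" "p \<cdot> u = i" "q \<cdot> u = neg f"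
    using biproduct_pair[OF S, of i "neg f"] by auto
  have u_eq: "u = Add C (a \<cdot> i) (b \<cdot> neg f)"
    by (rule biproduct_joint_mono[OF S])
      (simp_all del: Comp_neg add: Comp_eq_assoc[OF biproduct_typing(16)[OF S]] Comp_eq_assoc[OF biproduct_typing(17)[OF S]]
        Comp_eq_assoc[OF biproduct_typing(18)[OF S]] Comp_eq_assoc[OF biproduct_typing(19)[OF S]])
  have "is_mono C (p \<cdot> u)" using i by simp
  then have um: "is_mono C u" by (rule mono_cancel) simp_all
  obtain c where c: "is_cokernel C u c" using ex_cokernel[of u] by auto
  note [simp] = cokernel_typing[OF c]
  note k = kernel_of_cokernel[OF um c]
  have comp_u: "h \<cdot> u = Add C (h \<cdot> a \<cdot> i) (neg (h \<cdot> b \<cdot> f))" if "h \<in> Ar C" "Dom C h = S" for h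
    using that by (subst u_eq) simp
  have sq: "(c \<cdot> a) \<cdot> i = (c \<cdot> b) \<cdot> f"
    using comp_u[of c] by - (rule eq_if_diff_zero, simp_all)
  have "is_pushout C i f (c \<cdot> a) (c \<cdot> b)"
  proof (rule is_pushoutI)
    fix x y assume [simp]: "x \<in> Ar C" "y \<in> Ar C" "Cod C y = Cod C x" "Dom C x = Cod C i" "Dom C y = Cod C f"
      and eq: "x \<cdot> i = y \<cdot> f"
    obtain h where h [simp]: "h \<in> Ar C" "Cod C h = Cod C x" "Dom C h = S" "h \<cdot> a = x" "h \<cdot> b = y"
      using biproduct_copair[OF S, of x y] by auto
    have "h \<cdot> u = Zero C (Dom C i) (Cod C x)"
      using comp_u[of h] Add_neg[of "y \<cdot> f"] by (simp del: Comp_assoc_Ar add: eq)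
    then obtain w where w [simp]: "w \<in> Ar C" "Cod C w = Cod C h" "Dom C w = Cod C c" "w \<cdot> c = h"
      using cokernel_factor[OF c, of h] by auto
    have "w \<cdot> (c \<cdot> a) = x" "w \<cdot> (c \<cdot> b) = y"
      using Comp_eq_assoc[OF w(4)] by simp_all
    then show "\<exists>w\<in>Hom C (Cod C (c \<cdot> a)) (Cod C x). w \<cdot> (c \<cdot> a) = x \<and> w \<cdot> (c \<cdot> b) = y"
      by (intro bexI[of _ w]) (simp_all add: Hom_def)
  next
    fix x y assume [simp]: "x \<in> Ar C" "y \<in> Ar C" "Cod C y = Cod C x"
      "Dom C x = Cod C (c \<cdot> a)" "Dom C y = Cod C (c \<cdot> a)"
      and eq: "x \<cdot> (c \<cdot> a) = y \<cdot> (c \<cdot> a)" "x \<cdot> (c \<cdot> b) = y \<cdot> (c \<cdot> b)"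
    have "x \<cdot> c = y \<cdot> c"
      by (rule biproduct_joint_epi[OF S]) (use eq in simp_all)
    then show "x = y" by (rule epiD[OF cokernel_epi[OF c]]) simp_all
  qed (use sq in simp_all)
  \<comment> \<open>If \<open>c \<cdot> b\<close> kills \<open>x\<close>, then
    \<open>b \<cdot> x\<close> factors through the kernel \<open>u\<close> of \<open>c\<close>, say
    as \<open>u \<cdot> y\<close>. The first coordinate gives
    \<open>i \<cdot> y = p \<cdot> (b \<cdot> x) = 0\<close>, so \<open>y\<close> vanishes, and with
    it \<open>b \<cdot> x\<close> and \<open>x\<close>.\<close>
  moreover have "is_mono C (c \<cdot> b)"
  proof (rule monoI)
    fix x assume [simp]: "x \<in> Ar C" "Cod C x = Dom C (c \<cdot> b)"
      and z: "(c \<cdot> b) \<cdot> x = Zero C (Dom C x) (Cod C (c \<cdot> b))"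
    have "c \<cdot> (b \<cdot> x) = Zero C (Dom C x) (Cod C c)" using z by simp
    then obtain y where y [simp]: "y \<in> Ar C" "Dom C y = Dom C x" "Cod C y = Dom C u" "u \<cdot> y = b \<cdot> x"
      using kernel_factor[OF k, of "b \<cdot> x"] by auto
    have "i \<cdot> y = p \<cdot> (b \<cdot> x)" using Comp_eq_assoc[OF u(4), of y] by simp
    then have "i \<cdot> y = Zero C (Dom C x) (Cod C i)"
      by (simp add: Comp_eq_assoc[OF biproduct_typing(18)[OF S]])
    then have "y = Zero C (Dom C x) (Dom C i)" by (rule mono_zeroD[OF i]) simp_all
    then have "b \<cdot> x = Zero C (Dom C x) S" using y(4) by simp
    then have "q \<cdot> (b \<cdot> x) = Zero C (Dom C x) (Cod C f)" by simp
    then show "x = Zero C (Dom C x) (Dom C (c \<cdot> b))"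
      by (simp add: Comp_eq_assoc[OF biproduct_typing(17)[OF S]])
  qed simp
  ultimately show thesis by (rule that)
qed

text \<open>The pullback is the kernel \<open>k\<close> of the arrow \<open>u = (e, -f)\<close> on
  the direct sum. As \<open>e\<close> is an epimorphism, so is \<open>u\<close>, which is therefore
  the cokernel of \<open>k\<close>; arrows that kill \<open>k\<close> can thus be descended along
  \<open>u\<close>.\<close>

lemma pullback_of_epi:
  assumes e: "is_epi C e" and [simp]: "f \<in> Ar C" "Cod C f = Cod C e"
  obtains f' e' where "is_pullback C e f f' e'" "is_epi C e'"
proof -
  note [simp] = epi_Ar[OF e]
  obtain S a b p q where S: "is_biproduct C (Dom C e) (Dom C f) S a b p q"
    using ex_direct_sum[of "Dom C e" "Dom C f"] unfolding is_direct_sum_def by auto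
  note [simp] = biproduct_typing(1-19)[OF S]
  note S' = Comp_eq_assoc[OF biproduct_typing(16)[OF S]] Comp_eq_assoc[OF biproduct_typing(17)[OF S]]
        Comp_eq_assoc[OF biproduct_typing(18)[OF S]] Comp_eq_assoc[OF biproduct_typing(19)[OF S]]
  obtain u where u [simp]: "u \<in> Ar C" "Cod C u = Cod C e" "Dom C u = S" "u \<cdot> a = e" "u \<cdot> b = neg f"
    using biproduct_copair[OF S, of e "neg f"] by auto
  have u_eq: "u = Add C (e \<cdot> p) (neg f \<cdot> q)"
    by (rule biproduct_joint_epi[OF S]) (simp_all del: Comp_neg)
  have "is_epi C (u \<cdot> a)" using e by simp
  then have um: "is_epi C u" by (rule epi_cancel) simp_all
  obtain k where k: "is_kernel C u k" using ex_kernel[of u] by auto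
  note [simp] = kernel_typing[OF k]
  note c = cokernel_of_kernel[OF um k]
  have comp_u: "u \<cdot> h = Add C (e \<cdot> (p \<cdot> h)) (neg (f \<cdot> (q \<cdot> h)))" if "h \<in> Ar C" "Cod C h = S" for h
    using that by (subst u_eq) simp
  have sq: "e \<cdot> (p \<cdot> k) = f \<cdot> (q \<cdot> k)"
    using comp_u[of k] by - (rule eq_if_diff_zero, simp_all)
  have "is_pullback C e f (p \<cdot> k) (q \<cdot> k)"
  proof (rule is_pullbackI)
    fix x y assume [simp]: "x \<in> Ar C" "y \<in> Ar C" "Dom C y = Dom C x" "Cod C x = Dom C e" "Cod C y = Dom C f"
      and eq: "e \<cdot> x = f \<cdot> y"
    obtain h where h [simp]: "h \<in> Ar C" "Dom C h = Dom C x" "Cod C h = S" "p \<cdot> h = x" "q \<cdot> h = y"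
      using biproduct_pair[OF S, of x y] by auto
    have "u \<cdot> h = Zero C (Dom C x) (Cod C e)"
      using comp_u[of h] Add_neg[of "f \<cdot> y"] by (simp add: eq)
    then obtain w where w [simp]: "w \<in> Ar C" "Dom C w = Dom C h" "Cod C w = Dom C k" "k \<cdot> w = h"
      using kernel_factor[OF k, of h] by auto
    show "\<exists>w\<in>Hom C (Dom C x) (Dom C (p \<cdot> k)). (p \<cdot> k) \<cdot> w = x \<and> (q \<cdot> k) \<cdot> w = y"
      by (rule bexI[of _ w]) (simp_all add: Hom_def)
  next
    fix x y assume [simp]: "x \<in> Ar C" "y \<in> Ar C" "Dom C y = Dom C x"
      "Cod C x = Dom C (p \<cdot> k)" "Cod C y = Dom C (p \<cdot> k)"
      and eq: "(p \<cdot> k) \<cdot> x = (p \<cdot> k) \<cdot> y" "(q \<cdot> k) \<cdot> x = (q \<cdot> k) \<cdot> y"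
    have "k \<cdot> x = k \<cdot> y"
      by (rule biproduct_joint_mono[OF S]) (use eq in simp_all)
    then show "x = y" by (rule monoD[OF kernel_mono[OF k]]) simp_all
  qed (use sq in simp_all)
  \<comment> \<open>If \<open>x\<close> kills \<open>q \<cdot> k\<close>, then
    \<open>x \<cdot> q\<close> descends to some \<open>y\<close> with
    \<open>y \<cdot> u = x \<cdot> q\<close>. Restricting along \<open>a\<close>, where
    \<open>q\<close> vanishes, gives \<open>y \<cdot> e = 0\<close>, so \<open>y\<close> is zero and
    so is \<open>x\<close>.\<close>
  moreover have "is_epi C (q \<cdot> k)"
  proof (rule epiI)
    fix x assume [simp]: "x \<in> Ar C" "Dom C x = Cod C (q \<cdot> k)"
      and z: "x \<cdot> (q \<cdot> k) = Zero C (Dom C (q \<cdot> k)) (Cod C x)"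
    have "(x \<cdot> q) \<cdot> k = Zero C (Dom C k) (Cod C x)" using z by simp
    then obtain y where y [simp]: "y \<in> Ar C" "Cod C y = Cod C x" "Dom C y = Cod C u" "y \<cdot> u = x \<cdot> q"
      using cokernel_factor[OF c, of "x \<cdot> q"] by auto
    have "y \<cdot> e = (x \<cdot> q) \<cdot> a" using Comp_eq_assoc[OF y(4), of a] by simp
    then have "y \<cdot> e = Zero C (Dom C e) (Cod C x)" by simp
    then have "y = Zero C (Cod C e) (Cod C x)" by (rule epi_zeroD[OF e]) simp_all
    then have "x \<cdot> q = Zero C S (Cod C x)" using y(4) by simp
    then show "x = Zero C (Cod C (q \<cdot> k)) (Cod C x)"
      by - (rule epi_zeroD[OF split_epi[of q b "Dom C f"], THEN trans], simp_all)
  qed simp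
  ultimately show thesis by (rule that)
qed

text \<open>Replaces choosing a preimage of an element under an epimorphism.\<close>

lemma lift_up_to_epi:
  assumes "is_epi C c" "w \<in> Ar C" "Cod C w = Cod C c"
  obtains e b where "is_epi C e" "b \<in> Ar C" "Cod C e = Dom C w" "Dom C b = Dom C e"
    "Cod C b = Dom C c" "c \<cdot> b = w \<cdot> e"
proof -
  obtain b e where "is_pullback C c w b e" "is_epi C e"
    using pullback_of_epi[OF assms] by auto
  with pullback_typing[OF this(1)] that show thesis by auto
qed

end

section \<open>The monomorphism category is additive\<close>

context abelian_category
begin

lemma Mon_simps [simp]:
  "Dom (Mon C) = sq_dom" "Cod (Mon C) = sq_cod"
  "Idn (Mon C) \<alpha> = Square \<alpha> \<alpha> (Idn C (Dom C \<alpha>)) (Idn C (Cod C \<alpha>))"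
  "\<psi> \<cdot>\<^bsub>Mon C\<^esub> \<phi> = Square (sq_dom \<phi>) (sq_cod \<psi>) (src \<psi> \<cdot> src \<phi>) (tgt \<psi> \<cdot> tgt \<phi>)"
  "Add (Mon C) \<phi> \<psi> = Square (sq_dom \<phi>) (sq_cod \<phi>) (Add C (src \<phi>) (src \<psi>)) (Add C (tgt \<phi>) (tgt \<psi>))"
  "Zero (Mon C) \<alpha> \<beta> = Square \<alpha> \<beta> (Zero C (Dom C \<alpha>) (Dom C \<beta>)) (Zero C (Cod C \<alpha>) (Cod C \<beta>))"
  by (simp_all add: Mon_def Mor_def full_subcategory_def)

lemma Ob_Mon [simp]: "\<alpha> \<in> Ob (Mon C) \<longleftrightarrow> is_mono C \<alpha>"
  by (auto simp: Mon_def Mor_def full_subcategory_def mono_Ar)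

lemma Ar_Mon_iff:
  "\<phi> \<in> Ar (Mon C) \<longleftrightarrow> is_mono C (sq_dom \<phi>) \<and> is_mono C (sq_cod \<phi>) \<and>
    src \<phi> \<in> Ar C \<and> Dom C (src \<phi>) = Dom C (sq_dom \<phi>) \<and> Cod C (src \<phi>) = Dom C (sq_cod \<phi>) \<and>
    tgt \<phi> \<in> Ar C \<and> Dom C (tgt \<phi>) = Cod C (sq_dom \<phi>) \<and> Cod C (tgt \<phi>) = Cod C (sq_cod \<phi>) \<and>
    sq_cod \<phi> \<cdot> src \<phi> = tgt \<phi> \<cdot> sq_dom \<phi>"
  by (cases \<phi>) (auto simp: Mon_def Mor_def full_subcategory_def mono_Ar Hom_def)

text \<open>Commutation of the square comes last, so that the ten typing facts can be handed to the
  simplifier without it.\<close>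

lemma Ar_MonD:
  assumes "\<phi> \<in> Ar (Mon C)"
  shows "is_mono C (sq_dom \<phi>)" "is_mono C (sq_cod \<phi>)" "sq_dom \<phi> \<in> Ar C" "sq_cod \<phi> \<in> Ar C"
    "src \<phi> \<in> Ar C" "Dom C (src \<phi>) = Dom C (sq_dom \<phi>)" "Cod C (src \<phi>) = Dom C (sq_cod \<phi>)"
    "tgt \<phi> \<in> Ar C" "Dom C (tgt \<phi>) = Cod C (sq_dom \<phi>)" "Cod C (tgt \<phi>) = Cod C (sq_cod \<phi>)"
    "sq_cod \<phi> \<cdot> src \<phi> = tgt \<phi> \<cdot> sq_dom \<phi>"
  using assms unfolding Ar_Mon_iff by (auto intro: mono_Ar)

lemma Mon_comm_assoc:
  assumes "\<phi> \<in> Ar (Mon C)" "h \<in> Ar C" "Cod C h = Dom C (sq_dom \<phi>)"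
  shows "sq_cod \<phi> \<cdot> (src \<phi> \<cdot> h) = tgt \<phi> \<cdot> (sq_dom \<phi> \<cdot> h)"
  using Comp_eq_assoc[OF Ar_MonD(11)[OF assms(1)], of h] assms(2,3) Ar_MonD[OF assms(1)] by simp

lemma category_Mon: "category (Mon C)"
proof
  fix f assume "f \<in> Ar (Mon C)"
  then show "Dom (Mon C) f \<in> Ob (Mon C)" "Cod (Mon C) f \<in> Ob (Mon C)" by (simp_all add: Ar_MonD)
next
  fix X assume "X \<in> Ob (Mon C)"
  then show "Idn (Mon C) X \<in> Hom (Mon C) X X" by (simp add: Ar_Mon_iff Hom_def mono_Ar)
next
  fix f X Y g W assume "f \<in> Hom (Mon C) X Y" "g \<in> Hom (Mon C) Y W"
  then have f: "f \<in> Ar (Mon C)" "sq_dom f = X" "sq_cod f = Y"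
    and g: "g \<in> Ar (Mon C)" "sq_dom g = Y" "sq_cod g = W" by (simp_all add: Hom_def)
  show "g \<cdot>\<^bsub>Mon C\<^esub> f \<in> Hom (Mon C) X W"
    using Ar_MonD[OF f(1)] Ar_MonD[OF g(1)] Mon_comm_assoc[OF g(1), of "src f"] f(2,3) g(2,3)
    by (simp add: Ar_Mon_iff Hom_def)
next
  fix f X Y assume f: "f \<in> Hom (Mon C) X Y"
  then have "f \<in> Ar (Mon C)" by (simp add: Hom_def)
  with f Ar_MonD[OF this] show "f \<cdot>\<^bsub>Mon C\<^esub> Idn (Mon C) X = f" "Idn (Mon C) Y \<cdot>\<^bsub>Mon C\<^esub> f = f"
    by (simp_all add: Hom_def square.expand)
next
  fix f X Y g W h V
  assume "f \<in> Hom (Mon C) X Y" "g \<in> Hom (Mon C) Y W" "h \<in> Hom (Mon C) W V"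
  then have f: "f \<in> Ar (Mon C)" "sq_dom f = X" "sq_cod f = Y"
    and g: "g \<in> Ar (Mon C)" "sq_dom g = Y" "sq_cod g = W"
    and h: "h \<in> Ar (Mon C)" "sq_dom h = W" "sq_cod h = V" by (simp_all add: Hom_def)
  show "h \<cdot>\<^bsub>Mon C\<^esub> g \<cdot>\<^bsub>Mon C\<^esub> f = h \<cdot>\<^bsub>Mon C\<^esub> (g \<cdot>\<^bsub>Mon C\<^esub> f)"
    using Ar_MonD[OF f(1)] Ar_MonD[OF g(1)] Ar_MonD[OF h(1)] f(2,3) g(2,3) h(2,3) by simp
qed

lemma preadditive_Mon: "preadditive_category (Mon C)"
proof (intro preadditive_category.intro preadditive_category_axioms.intro category_Mon)
  fix X Y assume "X \<in> Ob (Mon C)" "Y \<in> Ob (Mon C)"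
  then have m: "is_mono C X" "is_mono C Y" by simp_all
  note [simp] = m mono_Ar[OF m(1)] mono_Ar[OF m(2)]
  show "comm_group (Hom_group (Mon C) X Y)"
  proof (rule comm_groupI)
    fix x assume "x \<in> carrier (Hom_group (Mon C) X Y)"
    then have x: "x \<in> Ar (Mon C)" and [simp]: "sq_dom x = X" "sq_cod x = Y"
      by (simp_all add: Hom_def Hom_group_def)
    note [simp] = Ar_MonD[OF x, simplified]
    show "\<exists>y\<in>carrier (Hom_group (Mon C) X Y).
        y \<otimes>\<^bsub>Hom_group (Mon C) X Y\<^esub> x = \<one>\<^bsub>Hom_group (Mon C) X Y\<^esub>"
    proof (rule bexI)
      let ?y = "Square X Y (neg (src x)) (neg (tgt x))"
      show "?y \<in> carrier (Hom_group (Mon C) X Y)"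
        by (simp add: Hom_def Hom_group_def Ar_Mon_iff)
      show "?y \<otimes>\<^bsub>Hom_group (Mon C) X Y\<^esub> x = \<one>\<^bsub>Hom_group (Mon C) X Y\<^esub>"
        using Add_commute[of "src x" "neg (src x)"] Add_commute[of "tgt x" "neg (tgt x)"]
          Add_neg[of "src x"] Add_neg[of "tgt x"]
        by (simp add: Hom_group_def)
    qed
    show "\<one>\<^bsub>Hom_group (Mon C) X Y\<^esub> \<otimes>\<^bsub>Hom_group (Mon C) X Y\<^esub> x = x"
      by (simp add: Hom_group_def square.expand)
    fix y assume "y \<in> carrier (Hom_group (Mon C) X Y)"
    then have y: "y \<in> Ar (Mon C)" and [simp]: "sq_dom y = X" "sq_cod y = Y"
      by (simp_all add: Hom_def Hom_group_def)
    note [simp] = Ar_MonD[OF y, simplified]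
    show "x \<otimes>\<^bsub>Hom_group (Mon C) X Y\<^esub> y \<in> carrier (Hom_group (Mon C) X Y)"
      by (simp add: Hom_def Hom_group_def Ar_Mon_iff)
    show "x \<otimes>\<^bsub>Hom_group (Mon C) X Y\<^esub> y = y \<otimes>\<^bsub>Hom_group (Mon C) X Y\<^esub> x"
      using Add_commute[of "src x" "src y"] Add_commute[of "tgt x" "tgt y"]
      by (simp add: Hom_group_def)
    fix z assume "z \<in> carrier (Hom_group (Mon C) X Y)"
    then have z: "z \<in> Ar (Mon C)" and [simp]: "sq_dom z = X" "sq_cod z = Y"
      by (simp_all add: Hom_def Hom_group_def)
    note [simp] = Ar_MonD[OF z, simplified]
    show "x \<otimes>\<^bsub>Hom_group (Mon C) X Y\<^esub> y \<otimes>\<^bsub>Hom_group (Mon C) X Y\<^esub> z =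
        x \<otimes>\<^bsub>Hom_group (Mon C) X Y\<^esub> (y \<otimes>\<^bsub>Hom_group (Mon C) X Y\<^esub> z)"
      using Add_assoc[of "src x" "src y" "src z"] Add_assoc[of "tgt x" "tgt y" "tgt z"]
      by (simp add: Hom_group_def)
  next
    show "\<one>\<^bsub>Hom_group (Mon C) X Y\<^esub> \<in> carrier (Hom_group (Mon C) X Y)"
      by (simp add: Hom_def Hom_group_def Ar_Mon_iff)
  qed
next
  fix f X Y f' g W
  assume "f \<in> Hom (Mon C) X Y" "f' \<in> Hom (Mon C) X Y" "g \<in> Hom (Mon C) Y W"
  then have f: "f \<in> Ar (Mon C)" "sq_dom f = X" "sq_cod f = Y"
    and f': "f' \<in> Ar (Mon C)" "sq_dom f' = X" "sq_cod f' = Y"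
    and g: "g \<in> Ar (Mon C)" "sq_dom g = Y" "sq_cod g = W" by (simp_all add: Hom_def)
  show "g \<cdot>\<^bsub>Mon C\<^esub> Add (Mon C) f f' = Add (Mon C) (g \<cdot>\<^bsub>Mon C\<^esub> f) (g \<cdot>\<^bsub>Mon C\<^esub> f')"
    using Ar_MonD[OF f(1)] Ar_MonD[OF f'(1)] Ar_MonD[OF g(1)] f(2,3) f'(2,3) g(2,3) by simp
next
  fix f X Y g g' W
  assume "f \<in> Hom (Mon C) X Y" "g \<in> Hom (Mon C) Y W" "g' \<in> Hom (Mon C) Y W"
  then have f: "f \<in> Ar (Mon C)" "sq_dom f = X" "sq_cod f = Y"
    and g: "g \<in> Ar (Mon C)" "sq_dom g = Y" "sq_cod g = W"
    and g': "g' \<in> Ar (Mon C)" "sq_dom g' = Y" "sq_cod g' = W" by (simp_all add: Hom_def)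
  show "Add (Mon C) g g' \<cdot>\<^bsub>Mon C\<^esub> f = Add (Mon C) (g \<cdot>\<^bsub>Mon C\<^esub> f) (g' \<cdot>\<^bsub>Mon C\<^esub> f)"
    using Ar_MonD[OF f(1)] Ar_MonD[OF g(1)] Ar_MonD[OF g'(1)] f(2,3) g(2,3) g'(2,3) by simp
qed

lemma mono_from_zero_object:
  assumes "is_zero_object C Z" "f \<in> Ar C" "Dom C f = Z"
  shows "is_mono C f"
  unfolding is_mono_def Hom_def using assms zero_object_eq[OF assms(1)] by auto

lemma additive_Mon: "additive_category (Mon C)"
proof (intro additive_category.intro additive_category_axioms.intro preadditive_Mon)
  obtain Z where Z: "is_zero_object C Z" using ex_zero_object by blast
  then have [simp]: "Z \<in> Ob C" by (simp add: is_zero_object_def)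
  have [simp]: "is_mono C (Idn C Z)" by (rule mono_from_zero_object[OF Z]) simp_all
  note uq = zero_object_eq[OF Z]
  show "\<exists>Z. is_zero_object (Mon C) Z"
    unfolding is_zero_object_def
  proof (intro exI conjI ballI)
    show "Idn C Z \<in> Ob (Mon C)" by simp
    fix X assume "X \<in> Ob (Mon C)"
    then have X: "is_mono C X" by simp
    note [simp] = X mono_Ar[OF X]
    show "\<exists>!f. f \<in> Hom (Mon C) (Idn C Z) X"
    proof (rule ex1I)
      show "Zero (Mon C) (Idn C Z) X \<in> Hom (Mon C) (Idn C Z) X" by (simp add: Hom_def Ar_Mon_iff)
      fix f assume "f \<in> Hom (Mon C) (Idn C Z) X"
      then have f: "f \<in> Ar (Mon C)" and [simp]: "sq_dom f = Idn C Z" "sq_cod f = X"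
        by (simp_all add: Hom_def)
      note [simp] = Ar_MonD(5-10)[OF f]
      have "src f = src (Zero (Mon C) (Idn C Z) X)" "tgt f = tgt (Zero (Mon C) (Idn C Z) X)"
        by (rule uq; simp)+
      then show "f = Zero (Mon C) (Idn C Z) X" by (intro square.expand) simp_all
    qed
    show "\<exists>!f. f \<in> Hom (Mon C) X (Idn C Z)"
    proof (rule ex1I)
      show "Zero (Mon C) X (Idn C Z) \<in> Hom (Mon C) X (Idn C Z)" by (simp add: Hom_def Ar_Mon_iff)
      fix f assume "f \<in> Hom (Mon C) X (Idn C Z)"
      then have f: "f \<in> Ar (Mon C)" and [simp]: "sq_dom f = X" "sq_cod f = Idn C Z"
        by (simp_all add: Hom_def)
      note [simp] = Ar_MonD(5-10)[OF f]
      have "src f = src (Zero (Mon C) X (Idn C Z))" "tgt f = tgt (Zero (Mon C) X (Idn C Z))"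
        by (rule uq; simp)+
      then show "f = Zero (Mon C) X (Idn C Z)" by (intro square.expand) simp_all
    qed
  qed
next
  fix a b assume "a \<in> Ob (Mon C)" "b \<in> Ob (Mon C)"
  then have m: "is_mono C a" "is_mono C b" by simp_all
  note [simp] = m mono_Ar[OF m(1)] mono_Ar[OF m(2)]
  obtain S i j p q where S: "is_biproduct C (Dom C a) (Dom C b) S i j p q"
    using ex_direct_sum[of "Dom C a" "Dom C b"] unfolding is_direct_sum_def by auto
  obtain S' i' j' p' q' where S': "is_biproduct C (Cod C a) (Cod C b) S' i' j' p' q'"
    using ex_direct_sum[of "Cod C a" "Cod C b"] unfolding is_direct_sum_def by auto
  note [simp] = biproduct_typing[OF S] biproduct_typing[OF S']
  note S'_assoc = Comp_eq_assoc[OF biproduct_typing(16)[OF S']] Comp_eq_assoc[OF biproduct_typing(17)[OF S']]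
    Comp_eq_assoc[OF biproduct_typing(18)[OF S']] Comp_eq_assoc[OF biproduct_typing(19)[OF S']]
  \<comment> \<open>\<open>s\<close> is the direct sum of \<open>a\<close> and \<open>b\<close>,
    fixed by its values on the injections. The equations \<open>ps\<close> show that it respects the
    projections too; they make the projections squares and let \<open>s\<close> be tested for
    monicity coordinate by coordinate.\<close>
  obtain s where s [simp]: "s \<in> Ar C" "Cod C s = S'" "Dom C s = S" "s \<cdot> i = i' \<cdot> a" "s \<cdot> j = j' \<cdot> b"
    using biproduct_copair[OF S, of "i' \<cdot> a" "j' \<cdot> b"] by auto
  have ps: "p' \<cdot> s = a \<cdot> p" "q' \<cdot> s = b \<cdot> q"
    by (rule biproduct_joint_epi[OF S]; simp add: S'_assoc)+
  have sm [simp]: "is_mono C s"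
  proof (rule monoI)
    fix u assume [simp]: "u \<in> Ar C" "Cod C u = Dom C s" and z: "s \<cdot> u = Zero C (Dom C u) (Cod C s)"
    have "a \<cdot> (p \<cdot> u) = Zero C (Dom C u) (Cod C a)"
      using Comp_eq_assoc[OF ps(1), of u] z by simp
    then have 1: "p \<cdot> u = Zero C (Dom C u) (Dom C a)" by (rule mono_zeroD[OF m(1)]) simp_all
    have "b \<cdot> (q \<cdot> u) = Zero C (Dom C u) (Cod C b)"
      using Comp_eq_assoc[OF ps(2), of u] z by simp
    then have 2: "q \<cdot> u = Zero C (Dom C u) (Dom C b)" by (rule mono_zeroD[OF m(2)]) simp_all
    show "u = Zero C (Dom C u) (Dom C s)"
      by (rule biproduct_joint_mono[OF S]) (simp_all add: 1 2)
  qed simp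
  have "is_biproduct (Mon C) a b s (Square a s i i') (Square b s j j') (Square s a p p') (Square s b q q')"
    by (simp add: is_biproduct_def Hom_def Ar_Mon_iff ps)
  then show "\<exists>s. is_direct_sum (Mon C) a b s" unfolding is_direct_sum_def by blast
qed

lemma Mon_biproduct_components:
  assumes "is_biproduct (Mon C) a b s i j p q"
  shows "is_biproduct C (Dom C a) (Dom C b) (Dom C s) (src i) (src j) (src p) (src q)"
    and "is_biproduct C (Cod C a) (Cod C b) (Cod C s) (tgt i) (tgt j) (tgt p) (tgt q)"
  using assms by (simp_all add: is_biproduct_def Hom_def Ar_Mon_iff mono_Ar)

section \<open>Kernels, cokernels and deflations of squares\<close>

lemma Mon_monoI:
  assumes \<phi>: "\<phi> \<in> Ar (Mon C)" and m: "is_mono C (src \<phi>)" "is_mono C (tgt \<phi>)"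
  shows "is_mono (Mon C) \<phi>"
  unfolding is_mono_def Hom_def
proof safe
  fix u v assume uv: "u \<in> Ar (Mon C)" "v \<in> Ar (Mon C)"
    and dc: "Cod (Mon C) u = Dom (Mon C) \<phi>" "Cod (Mon C) v = Dom (Mon C) \<phi>"
      "Dom (Mon C) v = Dom (Mon C) u"
    and eq: "\<phi> \<cdot>\<^bsub>Mon C\<^esub> u = \<phi> \<cdot>\<^bsub>Mon C\<^esub> v"
  note [simp] = dc[simplified] Ar_MonD(1-10)[OF \<phi>] Ar_MonD(1-10)[OF uv(1)] Ar_MonD(1-10)[OF uv(2)]
  have "src u = src v" by (rule monoD[OF m(1)]) (use eq in simp_all)
  moreover have "tgt u = tgt v" by (rule monoD[OF m(2)]) (use eq in simp_all)
  ultimately show "u = v" by (intro square.expand) simp_all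
qed (rule \<phi>)

lemma Mon_epiI:
  assumes \<phi>: "\<phi> \<in> Ar (Mon C)" and m: "is_epi C (src \<phi>)" "is_epi C (tgt \<phi>)"
  shows "is_epi (Mon C) \<phi>"
  unfolding is_epi_def Hom_def
proof safe
  fix u v assume uv: "u \<in> Ar (Mon C)" "v \<in> Ar (Mon C)"
    and dc: "Dom (Mon C) u = Cod (Mon C) \<phi>" "Dom (Mon C) v = Cod (Mon C) \<phi>"
      "Cod (Mon C) v = Cod (Mon C) u"
    and eq: "u \<cdot>\<^bsub>Mon C\<^esub> \<phi> = v \<cdot>\<^bsub>Mon C\<^esub> \<phi>"
  note [simp] = dc[simplified] Ar_MonD(1-10)[OF \<phi>] Ar_MonD(1-10)[OF uv(1)] Ar_MonD(1-10)[OF uv(2)]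
  have "src u = src v" by (rule epiD[OF m(1)]) (use eq in simp_all)
  moreover have "tgt u = tgt v" by (rule epiD[OF m(2)]) (use eq in simp_all)
  ultimately show "u = v" by (intro square.expand) simp_all
qed (rule \<phi>)

text \<open>Factoring both components gives candidates \<open>u\<close> and \<open>v\<close>. They
  form a square because its commutation can be tested after the monomorphism
  \<open>tgt \<phi>\<close>; for cokernels it is tested before the epimorphism
  \<open>src \<psi>\<close>.\<close>

lemma Mon_kernelI:
  assumes \<phi>: "\<phi> \<in> Ar (Mon C)" and \<psi>: "\<psi> \<in> Ar (Mon C)" and [simp]: "sq_cod \<phi> = sq_dom \<psi>"
    and k: "is_kernel C (src \<psi>) (src \<phi>)" "is_kernel C (tgt \<psi>) (tgt \<phi>)"
  shows "is_kernel (Mon C) \<psi> \<phi>"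
proof -
  interpret M: additive_category "Mon C" by (rule additive_Mon)
  note [simp] = Ar_MonD(1-10)[OF \<phi>] Ar_MonD(1-10)[OF \<psi>]
  note m = kernel_mono[OF k(1)] kernel_mono[OF k(2)]
  show ?thesis
  proof (rule M.is_kernelI[OF \<psi> Mon_monoI[OF \<phi> m]])
    show "\<psi> \<cdot>\<^bsub>Mon C\<^esub> \<phi> = Zero (Mon C) (Dom (Mon C) \<phi>) (Cod (Mon C) \<psi>)"
      using kernel_typing(4)[OF k(1)] kernel_typing(4)[OF k(2)] by simp
    fix h assume h: "h \<in> Ar (Mon C)" and hd: "Cod (Mon C) h = Dom (Mon C) \<psi>"
      and z: "\<psi> \<cdot>\<^bsub>Mon C\<^esub> h = Zero (Mon C) (Dom (Mon C) h) (Cod (Mon C) \<psi>)"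
    have [simp]: "sq_cod h = sq_dom \<psi>" using hd by simp
    note [simp] = Ar_MonD(1-10)[OF h]
    from z have z': "src \<psi> \<cdot> src h = Zero C (Dom C (src h)) (Cod C (src \<psi>))"
      "tgt \<psi> \<cdot> tgt h = Zero C (Dom C (tgt h)) (Cod C (tgt \<psi>))" by simp_all
    obtain u where u [simp]: "u \<in> Ar C" "Dom C u = Dom C (sq_dom h)" "Cod C u = Dom C (sq_dom \<phi>)" "src \<phi> \<cdot> u = src h"
      using kernel_factor[OF k(1) _ _ z'(1)] by auto
    obtain v where v [simp]: "v \<in> Ar C" "Dom C v = Cod C (sq_dom h)" "Cod C v = Cod C (sq_dom \<phi>)" "tgt \<phi> \<cdot> v = tgt h"
      using kernel_factor[OF k(2) _ _ z'(2)] by auto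
    have "tgt \<phi> \<cdot> (sq_dom \<phi> \<cdot> u) = tgt \<phi> \<cdot> (v \<cdot> sq_dom h)"
      using Mon_comm_assoc[OF \<phi>, of u] Comp_eq_assoc[OF v(4), of "sq_dom h"] Ar_MonD(11)[OF h] by simp
    then have "sq_dom \<phi> \<cdot> u = v \<cdot> sq_dom h" by (rule monoD[OF m(2)]) simp_all
    then show "\<exists>u\<in>Hom (Mon C) (Dom (Mon C) h) (Dom (Mon C) \<phi>). \<phi> \<cdot>\<^bsub>Mon C\<^esub> u = h"
      by (intro bexI[of _ "Square (sq_dom h) (sq_dom \<phi>) u v"])
        (simp_all add: Hom_def Ar_Mon_iff square.expand)
  qed simp
qed

lemma Mon_cokernelI:
  assumes \<phi>: "\<phi> \<in> Ar (Mon C)" and \<psi>: "\<psi> \<in> Ar (Mon C)" and dc: "sq_dom \<psi> = sq_cod \<phi>"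
    and k: "is_cokernel C (src \<phi>) (src \<psi>)" "is_cokernel C (tgt \<phi>) (tgt \<psi>)"
  shows "is_cokernel (Mon C) \<phi> \<psi>"
proof -
  interpret M: additive_category "Mon C" by (rule additive_Mon)
  note [simp] = dc Ar_MonD(1-10)[OF \<phi>] Ar_MonD(1-10)[OF \<psi>]
  note m = cokernel_epi[OF k(1)] cokernel_epi[OF k(2)]
  show ?thesis
  proof (rule M.is_cokernelI[OF \<phi> Mon_epiI[OF \<psi> m]])
    show "\<psi> \<cdot>\<^bsub>Mon C\<^esub> \<phi> = Zero (Mon C) (Dom (Mon C) \<phi>) (Cod (Mon C) \<psi>)"
      using cokernel_typing(4)[OF k(1)] cokernel_typing(4)[OF k(2)] by simp
    fix h assume h: "h \<in> Ar (Mon C)" and hd: "Dom (Mon C) h = Cod (Mon C) \<phi>"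
      and z: "h \<cdot>\<^bsub>Mon C\<^esub> \<phi> = Zero (Mon C) (Dom (Mon C) \<phi>) (Cod (Mon C) h)"
    have [simp]: "sq_dom h = sq_cod \<phi>" using hd by simp
    note [simp] = Ar_MonD(1-10)[OF h]
    from z have z': "src h \<cdot> src \<phi> = Zero C (Dom C (src \<phi>)) (Cod C (src h))"
      "tgt h \<cdot> tgt \<phi> = Zero C (Dom C (tgt \<phi>)) (Cod C (tgt h))" by simp_all
    obtain u where u [simp]: "u \<in> Ar C" "Dom C u = Dom C (sq_cod \<psi>)" "Cod C u = Dom C (sq_cod h)" "u \<cdot> src \<psi> = src h"
      using cokernel_factor[OF k(1) _ _ z'(1)] by auto
    obtain v where v [simp]: "v \<in> Ar C" "Dom C v = Cod C (sq_cod \<psi>)" "Cod C v = Cod C (sq_cod h)" "v \<cdot> tgt \<psi> = tgt h"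
      using cokernel_factor[OF k(2) _ _ z'(2)] by auto
    have "(sq_cod h \<cdot> u) \<cdot> src \<psi> = (v \<cdot> sq_cod \<psi>) \<cdot> src \<psi>"
      using Comp_eq_assoc[OF v(4), of "sq_dom \<psi>"] Ar_MonD(11)[OF h] Ar_MonD(11)[OF \<psi>] by simp
    then have "sq_cod h \<cdot> u = v \<cdot> sq_cod \<psi>" by (rule epiD[OF m(1)]) simp_all
    then show "\<exists>u\<in>Hom (Mon C) (Cod (Mon C) \<psi>) (Cod (Mon C) h). u \<cdot>\<^bsub>Mon C\<^esub> \<psi> = h"
      by (intro bexI[of _ "Square (sq_cod \<psi>) (sq_cod h) u v"])
        (simp_all add: Hom_def Ar_Mon_iff square.expand)
  qed simp
qed

lemma Mon_conflation_iff:
  "(\<phi>, \<psi>) \<in> Mon_conflations C \<longleftrightarrow> \<phi> \<in> Ar (Mon C) \<and> \<psi> \<in> Ar (Mon C) \<and> sq_cod \<phi> = sq_dom \<psi> \<and>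
    (src \<phi>, src \<psi>) \<in> kernel_cokernel_pairs C \<and> (tgt \<phi>, tgt \<psi>) \<in> kernel_cokernel_pairs C"
  by (simp add: Mon_conflations_def)

text \<open>The arrow \<open>u\<close> between the kernels of the components is a restriction of
  \<open>sq_dom \<psi>\<close> and therefore a monomorphism, so the kernel of a componentwise
  epimorphism always lies in \<open>Mon C\<close>.\<close>

lemma Mon_deflation_iff:
  "is_deflation (Mon_conflations C) \<psi> \<longleftrightarrow>
    \<psi> \<in> Ar (Mon C) \<and> is_epi C (src \<psi>) \<and> is_epi C (tgt \<psi>)"
proof
  assume "is_deflation (Mon_conflations C) \<psi>"
  then show "\<psi> \<in> Ar (Mon C) \<and> is_epi C (src \<psi>) \<and> is_epi C (tgt \<psi>)"
    by (auto simp: is_deflation_def Mon_conflation_iff ses_iff(1))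
next
  assume r: "\<psi> \<in> Ar (Mon C) \<and> is_epi C (src \<psi>) \<and> is_epi C (tgt \<psi>)"
  then have \<psi>: "\<psi> \<in> Ar (Mon C)" by blast
  note [simp] = Ar_MonD[OF \<psi>]
  obtain k l where k: "is_kernel C (src \<psi>) k" and l: "is_kernel C (tgt \<psi>) l"
    using ex_kernel[of "src \<psi>"] ex_kernel[of "tgt \<psi>"] by auto
  note [simp] = kernel_typing[OF k] kernel_typing[OF l]
  have "tgt \<psi> \<cdot> (sq_dom \<psi> \<cdot> k) = Zero C (Dom C k) (Cod C (tgt \<psi>))"
    using Mon_comm_assoc[OF \<psi>, of k] by simp
  then obtain u where u [simp]: "u \<in> Ar C" "Dom C u = Dom C k" "Cod C u = Dom C l" "l \<cdot> u = sq_dom \<psi> \<cdot> k"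
    using kernel_factor[OF l, of "sq_dom \<psi> \<cdot> k"] by auto
  have "is_mono C (l \<cdot> u)" using mono_comp[OF kernel_mono[OF k], of "sq_dom \<psi>"] by simp
  then have "is_mono C u" by (rule mono_cancel) simp_all
  then have "(Square u (sq_dom \<psi>) k l, \<psi>) \<in> Mon_conflations C"
    using r k l by (simp add: Mon_conflation_iff Ar_Mon_iff ses_iff(1))
  then show "is_deflation (Mon_conflations C) \<psi>" unfolding is_deflation_def by blast
qed

end

section \<open>The exact structure\<close>

context abelian_category
begin

text \<open>The existence half of the pullback property; uniqueness is automatic since the arrows involved
  are monomorphisms whenever this is used.\<close>

definition cartesian :: "'m square \<Rightarrow> bool" where
  "cartesian \<phi> \<longleftrightarrow> (\<forall>a\<in>Ar C. \<forall>b\<in>Ar C. Dom C a = Dom C b \<longrightarrow>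
    Cod C a = Dom C (tgt \<phi>) \<longrightarrow> Cod C b = Dom C (sq_cod \<phi>) \<longrightarrow> sq_cod \<phi> \<cdot> b = tgt \<phi> \<cdot> a \<longrightarrow>
    (\<exists>x\<in>Hom C (Dom C b) (Dom C (src \<phi>)). src \<phi> \<cdot> x = b))"

lemma cartesianD:
  assumes "cartesian \<phi>" "sq_cod \<phi> \<cdot> b = tgt \<phi> \<cdot> a" "a \<in> Ar C" "b \<in> Ar C" "Dom C a = Dom C b"
    "Cod C a = Dom C (tgt \<phi>)" "Cod C b = Dom C (sq_cod \<phi>)"
  obtains x where "x \<in> Ar C" "Dom C x = Dom C b" "Cod C x = Dom C (src \<phi>)" "src \<phi> \<cdot> x = b"
  using assms unfolding cartesian_def Hom_def by blast

lemma cartesianI: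
  assumes "\<And>a b. \<lbrakk>a \<in> Ar C; b \<in> Ar C; Dom C a = Dom C b; Cod C a = Dom C (tgt \<phi>);
      Cod C b = Dom C (sq_cod \<phi>); sq_cod \<phi> \<cdot> b = tgt \<phi> \<cdot> a\<rbrakk>
    \<Longrightarrow> \<exists>x\<in>Ar C. Dom C x = Dom C b \<and> Cod C x = Dom C (src \<phi>) \<and> src \<phi> \<cdot> x = b"
  shows "cartesian \<phi>"
  unfolding cartesian_def Hom_def
proof (intro ballI impI)
  fix a b assume "a \<in> Ar C" "b \<in> Ar C" "Dom C a = Dom C b" "Cod C a = Dom C (tgt \<phi>)"
      "Cod C b = Dom C (sq_cod \<phi>)" "sq_cod \<phi> \<cdot> b = tgt \<phi> \<cdot> a"
  from assms[OF this]
  show "\<exists>x\<in>{f \<in> Ar C. Dom C f = Dom C b \<and> Cod C f = Dom C (src \<phi>)}. src \<phi> \<cdot> x = b" by blast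
qed

text \<open>A diagram chase with \<open>lift_up_to_epi\<close> in place of elements: an arrow
  \<open>w\<close> killed by \<open>k\<close> lifts along \<open>c\<close> to some \<open>b\<close>;
  then \<open>g \<cdot> b\<close> factors through \<open>m'\<close>, so \<open>b\<close> factors
  through \<open>m\<close> by \<open>cart\<close>, and \<open>c \<cdot> b = w \<cdot> e\<close> is
  zero. The hypothesis \<open>cart\<close> is stated on bare arrows because a square is later read
  in both directions, with cokernels taken along either pair of opposite sides.\<close>

lemma cokernel_map_mono:
  assumes c: "is_cokernel C m c" and c': "is_cokernel C m' c'" and m': "is_mono C m'"
    and g [simp]: "g \<in> Ar C" "Dom C g = Cod C m" "Cod C g = Cod C m'"
    and k [simp]: "k \<in> Ar C" "Dom C k = Cod C c" "Cod C k = Cod C c'" and kc: "k \<cdot> c = c' \<cdot> g"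
    and cart: "\<And>a b. \<lbrakk>a \<in> Ar C; b \<in> Ar C; Dom C a = Dom C b; Cod C a = Dom C m'; Cod C b = Cod C m; g \<cdot> b = m' \<cdot> a\<rbrakk>
      \<Longrightarrow> \<exists>x\<in>Ar C. Dom C x = Dom C b \<and> Cod C x = Dom C m \<and> m \<cdot> x = b"
  shows "is_mono C k"
proof (rule monoI[OF k(1)])
  note [simp] = cokernel_typing[OF c] cokernel_typing[OF c']
  fix w assume [simp]: "w \<in> Ar C" "Cod C w = Dom C k" and z: "k \<cdot> w = Zero C (Dom C w) (Cod C k)"
  obtain e b where e: "is_epi C e" and [simp]: "b \<in> Ar C" "Cod C e = Dom C w" "Dom C b = Dom C e"
    "Cod C b = Dom C c" and cb: "c \<cdot> b = w \<cdot> e"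
    using lift_up_to_epi[OF cokernel_epi[OF c], of w] by auto
  note [simp] = epi_Ar[OF e]
  have "c' \<cdot> (g \<cdot> b) = k \<cdot> (w \<cdot> e)"
    using Comp_eq_assoc[OF kc, of b] cb by simp
  also have "\<dots> = Zero C (Dom C e) (Cod C c')"
    using Comp_eq_assoc[OF z, of e] by simp
  finally have "c' \<cdot> (g \<cdot> b) = Zero C (Dom C (g \<cdot> b)) (Cod C c')" by simp
  then obtain a where a: "a \<in> Ar C" "Dom C a = Dom C (g \<cdot> b)" "Cod C a = Dom C m'" "m' \<cdot> a = g \<cdot> b"
    by (rule kernel_factor[OF kernel_of_cokernel[OF m' c'], rotated 2]) simp_all
  then obtain x where [simp]: "x \<in> Ar C" "Dom C x = Dom C b" "Cod C x = Dom C m" and x: "m \<cdot> x = b"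
    using cart[of a b] by auto
  have "w \<cdot> e = Zero C (Dom C e) (Cod C w)"
    using Comp_eq_assoc[OF cokernel_typing(4)[OF c], of x] cb x by simp
  then show "w = Zero C (Dom C w) (Dom C k)" by - (rule epi_zeroD[OF e, THEN trans], simp_all)
qed

text \<open>In a conflation the arrow \<open>sq_cod \<psi>\<close> between the cokernels is a
  monomorphism. So if \<open>sq_cod \<phi> \<cdot> b\<close> factors through
  \<open>tgt \<phi>\<close>, then \<open>src \<psi>\<close> already kills \<open>b\<close>, and
  \<open>b\<close> factors through \<open>src \<phi>\<close>. The converse is
  \<open>cokernel_map_mono\<close>, applied to the cokernels of the two components.\<close>

lemma Mon_inflation_iff:
  "is_inflation (Mon_conflations C) \<phi> \<longleftrightarrow>
    \<phi> \<in> Ar (Mon C) \<and> is_mono C (tgt \<phi>) \<and> cartesian \<phi>"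
proof
  assume "is_inflation (Mon_conflations C) \<phi>"
  then obtain \<psi> where \<phi>: "\<phi> \<in> Ar (Mon C)" and \<psi>: "\<psi> \<in> Ar (Mon C)" and dc [simp]: "sq_cod \<phi> = sq_dom \<psi>"
    and s: "is_kernel C (src \<psi>) (src \<phi>)" and t: "is_kernel C (tgt \<psi>) (tgt \<phi>)"
    unfolding is_inflation_def Mon_conflation_iff ses_iff(1) by blast
  note [simp] = Ar_MonD(1-10)[OF \<phi>] Ar_MonD(1-10)[OF \<psi>]
  have "cartesian \<phi>"
  proof (rule cartesianI)
    fix a b assume [simp]: "a \<in> Ar C" "b \<in> Ar C" "Dom C a = Dom C b" "Cod C a = Dom C (tgt \<phi>)"
      "Cod C b = Dom C (sq_cod \<phi>)" and eq: "sq_cod \<phi> \<cdot> b = tgt \<phi> \<cdot> a"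
    have "sq_cod \<psi> \<cdot> (src \<psi> \<cdot> b) = (tgt \<psi> \<cdot> tgt \<phi>) \<cdot> a"
      using Mon_comm_assoc[OF \<psi>, of b] eq by simp
    then have "sq_cod \<psi> \<cdot> (src \<psi> \<cdot> b) = Zero C (Dom C b) (Cod C (sq_cod \<psi>))"
      using kernel_typing(4)[OF t] by simp
    then have "src \<psi> \<cdot> b = Zero C (Dom C b) (Dom C (sq_cod \<psi>))"
      by (rule mono_zeroD[OF Ar_MonD(2)[OF \<psi>]]) simp_all
    then obtain x where "x \<in> Ar C" "Dom C x = Dom C b" "Cod C x = Dom C (src \<phi>)" "src \<phi> \<cdot> x = b"
      by - (rule kernel_factor[OF s, of b], simp_all)
    then show "\<exists>x\<in>Ar C. Dom C x = Dom C b \<and> Cod C x = Dom C (src \<phi>) \<and> src \<phi> \<cdot> x = b" by blast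
  qed
  with \<phi> kernel_mono[OF t] show "\<phi> \<in> Ar (Mon C) \<and> is_mono C (tgt \<phi>) \<and> cartesian \<phi>" by blast
next
  assume "\<phi> \<in> Ar (Mon C) \<and> is_mono C (tgt \<phi>) \<and> cartesian \<phi>"
  then have \<phi>: "\<phi> \<in> Ar (Mon C)" and t: "is_mono C (tgt \<phi>)" and cart: "cartesian \<phi>" by blast+
  note [simp] = Ar_MonD(1-10)[OF \<phi>]
  have "is_mono C (tgt \<phi> \<cdot> sq_dom \<phi>)" by (rule mono_comp[OF Ar_MonD(1)[OF \<phi>] t]) simp
  then have "is_mono C (sq_cod \<phi> \<cdot> src \<phi>)" using Ar_MonD(11)[OF \<phi>] by simp
  then have s: "is_mono C (src \<phi>)" by (rule mono_cancel) simp_all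
  obtain c d where c: "is_cokernel C (src \<phi>) c" and d: "is_cokernel C (tgt \<phi>) d"
    using ex_cokernel[of "src \<phi>"] ex_cokernel[of "tgt \<phi>"] by auto
  note [simp] = cokernel_typing[OF c] cokernel_typing[OF d]
  have "(d \<cdot> sq_cod \<phi>) \<cdot> src \<phi> = Zero C (Dom C (src \<phi>)) (Cod C (d \<cdot> sq_cod \<phi>))"
    using Ar_MonD(11)[OF \<phi>] Comp_eq_assoc[OF cokernel_typing(4)[OF d], of "sq_dom \<phi>"] by simp
  then obtain k where k: "k \<in> Ar C" "Cod C k = Cod C (d \<cdot> sq_cod \<phi>)" "Dom C k = Cod C c" "k \<cdot> c = d \<cdot> sq_cod \<phi>"
    by - (rule cokernel_factor[OF c, of "d \<cdot> sq_cod \<phi>"], simp, simp, assumption, rule that)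
  note [simp] = k(1-3)
  have "is_mono C k"
  proof (rule cokernel_map_mono[OF c d t _ _ _ _ _ _ k(4)])
    fix a b assume "a \<in> Ar C" "b \<in> Ar C" "Dom C a = Dom C b" "Cod C a = Dom C (tgt \<phi>)"
      "Cod C b = Cod C (src \<phi>)" and eq: "sq_cod \<phi> \<cdot> b = tgt \<phi> \<cdot> a"
    then obtain x where "x \<in> Ar C" "Dom C x = Dom C b" "Cod C x = Dom C (src \<phi>)" "src \<phi> \<cdot> x = b"
      by - (rule cartesianD[OF cart eq], simp_all)
    then show "\<exists>x\<in>Ar C. Dom C x = Dom C b \<and> Cod C x = Dom C (src \<phi>) \<and> src \<phi> \<cdot> x = b" by blast
  qed simp_all
  with k have "(\<phi>, Square (sq_cod \<phi>) k c d) \<in> Mon_conflations C"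
    by (simp add: Mon_conflation_iff \<phi> ses_iff(2) s t c d, simp add: Ar_Mon_iff)
  then show "is_inflation (Mon_conflations C) \<phi>" unfolding is_inflation_def by blast
qed

text \<open>\<open>q\<close> is induced by \<open>c\<close> on one leg and zero on the other. If
  \<open>h\<close> kills \<open>i'\<close>, then \<open>h \<cdot> f'\<close> kills \<open>i\<close>
  and factors through \<open>c\<close>. Thus cobase change keeps the cokernel, which allows a
  pushout of a conflation to be compared with the original one.\<close>

lemma pushout_cokernel:
  assumes P: "is_pushout C i f f' i'" and i': "is_mono C i'" and c: "is_cokernel C i c"
  obtains q where "q \<in> Ar C" "Dom C q = Cod C i'" "Cod C q = Cod C c" "q \<cdot> f' = c" "is_kernel C q i'"
proof -
  note [simp] = pushout_typing(1-4)[OF P] pushout_typing(5)[OF P, symmetric] pushout_typing(6-8)[OF P]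
    cokernel_typing[OF c]
  note sq = pushout_typing(9)[OF P]
  obtain q where q [simp]: "q \<in> Ar C" "Cod C q = Cod C c" "Dom C q = Cod C i'" "q \<cdot> f' = c"
    "q \<cdot> i' = Zero C (Cod C f) (Cod C c)"
    using pushout_factor[OF P, of c "Zero C (Cod C f) (Cod C c)"] by auto
  have "is_epi C (q \<cdot> f')" using cokernel_epi[OF c] by simp
  then have e: "is_epi C q" by (rule epi_cancel) simp_all
  have "is_cokernel C i' q"
  proof (rule is_cokernelI[OF _ e])
    fix h assume [simp]: "h \<in> Ar C" "Dom C h = Cod C i'" and z: "h \<cdot> i' = Zero C (Dom C i') (Cod C h)"
    have "(h \<cdot> f') \<cdot> i = (h \<cdot> i') \<cdot> f" using sq by simp
    then have "(h \<cdot> f') \<cdot> i = Zero C (Dom C i) (Cod C h)" using z by simp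
    then obtain u where u [simp]: "u \<in> Ar C" "Cod C u = Cod C h" "Dom C u = Cod C c" "u \<cdot> c = h \<cdot> f'"
      using cokernel_factor[OF c, of "h \<cdot> f'"] by auto
    have "u \<cdot> q = h"
      by (rule pushout_joint_epi[OF P]) (simp_all add: z)
    then show "\<exists>u\<in>Hom C (Cod C q) (Cod C h). u \<cdot> q = h"
      by (intro bexI[of _ u]) (simp_all add: Hom_def)
  qed simp_all
  then have "is_kernel C q i'" by (rule kernel_of_cokernel[OF i'])
  then show thesis by (intro that[of q]) simp_all
qed

text \<open>Commutation of the factorization is tested on the two legs of the source pushout. That
  the arrow \<open>sq_cod \<phi>'\<close> between the pushouts is a monomorphism enters as part of
  \<open>\<phi>' \<in> Ar (Mon C)\<close>; it is the real content of cobase change.\<close>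

lemma Mon_pushoutI:
  assumes Ar: "\<phi> \<in> Ar (Mon C)" "\<chi> \<in> Ar (Mon C)" "\<phi>' \<in> Ar (Mon C)" "\<chi>' \<in> Ar (Mon C)"
    and dc: "sq_dom \<chi> = sq_dom \<phi>" "sq_dom \<phi>' = sq_cod \<phi>" "sq_dom \<chi>' = sq_cod \<chi>" "sq_cod \<chi>' = sq_cod \<phi>'"
    and P: "is_pushout C (src \<phi>) (src \<chi>) (src \<phi>') (src \<chi>')" and Q: "is_pushout C (tgt \<phi>) (tgt \<chi>) (tgt \<phi>') (tgt \<chi>')"
  shows "is_pushout (Mon C) \<phi> \<chi> \<phi>' \<chi>'"
proof -
  interpret M: additive_category "Mon C" by (rule additive_Mon)
  note [simp] = dc Ar_MonD(1-10)[OF Ar(1)] Ar_MonD(1-10)[OF Ar(2), simplified dc]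
    Ar_MonD(1-10)[OF Ar(3), simplified dc] Ar_MonD(1-10)[OF Ar(4), simplified dc]
  show ?thesis
  proof (rule M.is_pushoutI[OF Ar])
    show "\<phi>' \<cdot>\<^bsub>Mon C\<^esub> \<phi> = \<chi>' \<cdot>\<^bsub>Mon C\<^esub> \<chi>"
      using pushout_typing(9)[OF P] pushout_typing(9)[OF Q] by simp
  next
    fix u v assume u: "u \<in> Ar (Mon C)" and v: "v \<in> Ar (Mon C)"
      and uv: "Cod (Mon C) v = Cod (Mon C) u" "Dom (Mon C) u = Cod (Mon C) \<phi>" "Dom (Mon C) v = Cod (Mon C) \<chi>"
      and eq: "u \<cdot>\<^bsub>Mon C\<^esub> \<phi> = v \<cdot>\<^bsub>Mon C\<^esub> \<chi>"
    note [simp] = uv[simplified]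
    note [simp] = Ar_MonD(1-10)[OF u, simplified] Ar_MonD(1-10)[OF v, simplified]
    obtain x where x [simp]: "x \<in> Ar C" "Dom C x = Dom C (sq_cod \<phi>')" "Cod C x = Dom C (sq_cod u)"
      "x \<cdot> src \<phi>' = src u" "x \<cdot> src \<chi>' = src v"
      using pushout_factor[OF P, of "src u" "src v"] eq by auto
    obtain y where y [simp]: "y \<in> Ar C" "Dom C y = Cod C (sq_cod \<phi>')" "Cod C y = Cod C (sq_cod u)"
      "y \<cdot> tgt \<phi>' = tgt u" "y \<cdot> tgt \<chi>' = tgt v"
      using pushout_factor[OF Q, of "tgt u" "tgt v"] eq by auto
    have "sq_cod u \<cdot> x = y \<cdot> sq_cod \<phi>'"
    proof (rule pushout_joint_epi[OF P])
      show "(sq_cod u \<cdot> x) \<cdot> src \<phi>' = (y \<cdot> sq_cod \<phi>') \<cdot> src \<phi>'"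
        using Ar_MonD(11)[OF u] Ar_MonD(11)[OF Ar(3)] Comp_eq_assoc[OF y(4), of "sq_cod \<phi>"] by simp
      show "(sq_cod u \<cdot> x) \<cdot> src \<chi>' = (y \<cdot> sq_cod \<phi>') \<cdot> src \<chi>'"
        using Ar_MonD(11)[OF v] Ar_MonD(11)[OF Ar(4)] Comp_eq_assoc[OF y(5), of "sq_cod \<chi>"] by simp
    qed simp_all
    then show "\<exists>w\<in>Hom (Mon C) (Cod (Mon C) \<phi>') (Cod (Mon C) u). w \<cdot>\<^bsub>Mon C\<^esub> \<phi>' = u \<and> w \<cdot>\<^bsub>Mon C\<^esub> \<chi>' = v"
      by (intro bexI[of _ "Square (sq_cod \<phi>') (sq_cod u) x y"]) (simp_all add: Hom_def Ar_Mon_iff square.expand)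
  next
    fix u v assume u: "u \<in> Ar (Mon C)" and v: "v \<in> Ar (Mon C)"
      and uv: "Cod (Mon C) v = Cod (Mon C) u" "Dom (Mon C) u = Cod (Mon C) \<phi>'" "Dom (Mon C) v = Cod (Mon C) \<phi>'"
      and eq: "u \<cdot>\<^bsub>Mon C\<^esub> \<phi>' = v \<cdot>\<^bsub>Mon C\<^esub> \<phi>'" "u \<cdot>\<^bsub>Mon C\<^esub> \<chi>' = v \<cdot>\<^bsub>Mon C\<^esub> \<chi>'"
    note [simp] = uv[simplified]
    note [simp] = Ar_MonD(1-10)[OF u, simplified] Ar_MonD(1-10)[OF v, simplified]
    have "src u = src v" by (rule pushout_joint_epi[OF P]) (use eq in simp_all)
    moreover have "tgt u = tgt v" by (rule pushout_joint_epi[OF Q]) (use eq in simp_all)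
    ultimately show "u = v" by (intro square.expand) simp_all
  qed simp_all
qed

lemma Mon_pullbackI:
  assumes Ar: "\<phi> \<in> Ar (Mon C)" "\<chi> \<in> Ar (Mon C)" "\<phi>' \<in> Ar (Mon C)" "\<chi>' \<in> Ar (Mon C)"
    and dc: "sq_cod \<chi> = sq_cod \<phi>" "sq_cod \<phi>' = sq_dom \<phi>" "sq_cod \<chi>' = sq_dom \<chi>" "sq_dom \<chi>' = sq_dom \<phi>'"
    and P: "is_pullback C (src \<phi>) (src \<chi>) (src \<phi>') (src \<chi>')" and Q: "is_pullback C (tgt \<phi>) (tgt \<chi>) (tgt \<phi>') (tgt \<chi>')"
  shows "is_pullback (Mon C) \<phi> \<chi> \<phi>' \<chi>'"
proof -
  interpret M: additive_category "Mon C" by (rule additive_Mon)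
  note [simp] = dc Ar_MonD(1-10)[OF Ar(1)] Ar_MonD(1-10)[OF Ar(2), simplified dc]
    Ar_MonD(1-10)[OF Ar(3), simplified dc] Ar_MonD(1-10)[OF Ar(4), simplified dc]
  show ?thesis
  proof (rule M.is_pullbackI[OF Ar])
    show "\<phi> \<cdot>\<^bsub>Mon C\<^esub> \<phi>' = \<chi> \<cdot>\<^bsub>Mon C\<^esub> \<chi>'"
      using pullback_typing(9)[OF P] pullback_typing(9)[OF Q] by simp
  next
    fix u v assume u: "u \<in> Ar (Mon C)" and v: "v \<in> Ar (Mon C)"
      and uv: "Dom (Mon C) v = Dom (Mon C) u" "Cod (Mon C) u = Dom (Mon C) \<phi>" "Cod (Mon C) v = Dom (Mon C) \<chi>"
      and eq: "\<phi> \<cdot>\<^bsub>Mon C\<^esub> u = \<chi> \<cdot>\<^bsub>Mon C\<^esub> v"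
    note [simp] = uv[simplified]
    note [simp] = Ar_MonD(1-10)[OF u, simplified] Ar_MonD(1-10)[OF v, simplified]
    obtain x where x [simp]: "x \<in> Ar C" "Cod C x = Dom C (sq_dom \<phi>')" "Dom C x = Dom C (sq_dom u)"
      "src \<phi>' \<cdot> x = src u" "src \<chi>' \<cdot> x = src v"
      using pullback_factor[OF P, of "src u" "src v"] eq by auto
    obtain y where y [simp]: "y \<in> Ar C" "Cod C y = Cod C (sq_dom \<phi>')" "Dom C y = Cod C (sq_dom u)"
      "tgt \<phi>' \<cdot> y = tgt u" "tgt \<chi>' \<cdot> y = tgt v"
      using pullback_factor[OF Q, of "tgt u" "tgt v"] eq by auto
    have "sq_dom \<phi>' \<cdot> x = y \<cdot> sq_dom u"
    proof (rule pullback_joint_mono[OF Q])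
      show "tgt \<phi>' \<cdot> (sq_dom \<phi>' \<cdot> x) = tgt \<phi>' \<cdot> (y \<cdot> sq_dom u)"
        using Ar_MonD(11)[OF u] Mon_comm_assoc[OF Ar(3), of x] Comp_eq_assoc[OF y(4), of "sq_dom u"] by simp
      show "tgt \<chi>' \<cdot> (sq_dom \<phi>' \<cdot> x) = tgt \<chi>' \<cdot> (y \<cdot> sq_dom u)"
        using Ar_MonD(11)[OF v] Mon_comm_assoc[OF Ar(4), of x] Comp_eq_assoc[OF y(5), of "sq_dom u"] by simp
    qed simp_all
    then show "\<exists>w\<in>Hom (Mon C) (Dom (Mon C) u) (Dom (Mon C) \<phi>'). \<phi>' \<cdot>\<^bsub>Mon C\<^esub> w = u \<and> \<chi>' \<cdot>\<^bsub>Mon C\<^esub> w = v"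
      by (intro bexI[of _ "Square (sq_dom u) (sq_dom \<phi>') x y"]) (simp_all add: Hom_def Ar_Mon_iff square.expand)
  next
    fix u v assume u: "u \<in> Ar (Mon C)" and v: "v \<in> Ar (Mon C)"
      and uv: "Dom (Mon C) v = Dom (Mon C) u" "Cod (Mon C) u = Dom (Mon C) \<phi>'" "Cod (Mon C) v = Dom (Mon C) \<phi>'"
      and eq: "\<phi>' \<cdot>\<^bsub>Mon C\<^esub> u = \<phi>' \<cdot>\<^bsub>Mon C\<^esub> v" "\<chi>' \<cdot>\<^bsub>Mon C\<^esub> u = \<chi>' \<cdot>\<^bsub>Mon C\<^esub> v"
    note [simp] = uv[simplified]
    note [simp] = Ar_MonD(1-10)[OF u, simplified] Ar_MonD(1-10)[OF v, simplified]
    have "src u = src v" by (rule pullback_joint_mono[OF P]) (use eq in simp_all)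
    moreover have "tgt u = tgt v" by (rule pullback_joint_mono[OF Q]) (use eq in simp_all)
    ultimately show "u = v" by (intro square.expand) simp_all
  qed simp_all
qed

text \<open>The arrow \<open>s\<close> between the two pullbacks is a monomorphism: if it kills
  \<open>u\<close>, then the monomorphisms \<open>sq_dom \<phi>\<close> and
  \<open>sq_dom \<chi>\<close> kill the two projections of \<open>u\<close>.\<close>

lemma Mon_deflation_base_change:
  assumes "is_deflation (Mon_conflations C) \<phi>" and \<chi>: "\<chi> \<in> Ar (Mon C)" and dc: "sq_cod \<chi> = sq_cod \<phi>"
  shows "\<exists>\<chi>' \<phi>'. is_pullback (Mon C) \<phi> \<chi> \<chi>' \<phi>' \<and> is_deflation (Mon_conflations C) \<phi>'"
proof -
  have \<phi>: "\<phi> \<in> Ar (Mon C)" and e: "is_epi C (src \<phi>)" "is_epi C (tgt \<phi>)"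
    using assms(1) by (simp_all add: Mon_deflation_iff)
  note [simp] = dc Ar_MonD(1-10)[OF \<phi>] Ar_MonD(1-10)[OF \<chi>, simplified dc]
  obtain f' e' where P: "is_pullback C (src \<phi>) (src \<chi>) f' e'" and e': "is_epi C e'"
    using pullback_of_epi[OF e(1), of "src \<chi>"] by auto
  obtain f2 e2 where Q: "is_pullback C (tgt \<phi>) (tgt \<chi>) f2 e2" and e2: "is_epi C e2"
    using pullback_of_epi[OF e(2), of "tgt \<chi>"] by auto
  note [simp] = pullback_typing(3,4,6-8)[OF P, simplified] pullback_typing(3,4,6-8)[OF Q, simplified]
  have "tgt \<phi> \<cdot> (sq_dom \<phi> \<cdot> f') = tgt \<chi> \<cdot> (sq_dom \<chi> \<cdot> e')"
    using Mon_comm_assoc[OF \<phi>, of f'] Mon_comm_assoc[OF \<chi>, of e'] pullback_typing(9)[OF P] by simp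
  then obtain s where s [simp]: "s \<in> Ar C" "Dom C s = Dom C e'" "Cod C s = Dom C e2"
    "f2 \<cdot> s = sq_dom \<phi> \<cdot> f'" "e2 \<cdot> s = sq_dom \<chi> \<cdot> e'"
    using pullback_factor[OF Q, of "sq_dom \<phi> \<cdot> f'" "sq_dom \<chi> \<cdot> e'"] by auto
  have "is_mono C s"
  proof (rule monoI)
    fix u assume [simp]: "u \<in> Ar C" "Cod C u = Dom C s" and z: "s \<cdot> u = Zero C (Dom C u) (Cod C s)"
    have "sq_dom \<phi> \<cdot> (f' \<cdot> u) = Zero C (Dom C u) (Cod C (sq_dom \<phi>))"
      using Comp_eq_assoc[OF s(4), of u] z by simp
    then have 1: "f' \<cdot> u = Zero C (Dom C u) (Dom C (sq_dom \<phi>))"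
      by (rule mono_zeroD[OF Ar_MonD(1)[OF \<phi>]]) simp_all
    have "sq_dom \<chi> \<cdot> (e' \<cdot> u) = Zero C (Dom C u) (Cod C (sq_dom \<chi>))"
      using Comp_eq_assoc[OF s(5), of u] z by simp
    then have 2: "e' \<cdot> u = Zero C (Dom C u) (Dom C (sq_dom \<chi>))"
      by (rule mono_zeroD[OF Ar_MonD(1)[OF \<chi>]]) simp_all
    show "u = Zero C (Dom C u) (Dom C s)"
      by (rule pullback_joint_mono[OF P]) (simp_all add: 1 2)
  qed simp
  then have Ar: "Square s (sq_dom \<phi>) f' f2 \<in> Ar (Mon C)" "Square s (sq_dom \<chi>) e' e2 \<in> Ar (Mon C)"
    by (simp_all add: Ar_Mon_iff)
  show ?thesis
  proof (intro exI conjI)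
    show "is_pullback (Mon C) \<phi> \<chi> (Square s (sq_dom \<phi>) f' f2) (Square s (sq_dom \<chi>) e' e2)"
      by (rule Mon_pullbackI[OF \<phi> \<chi> Ar]) (simp_all add: P Q)
    show "is_deflation (Mon_conflations C) (Square s (sq_dom \<chi>) e' e2)"
      by (simp add: Mon_deflation_iff Ar e' e2)
  qed
qed

text \<open>The arrow \<open>\<pi>\<close> between the componentwise pushouts must be shown to be a
  monomorphism. By \<open>pushout_cokernel\<close> it sits between \<open>sq_cod \<chi>\<close> on
  the subobjects and \<open>sq_cod \<psi>\<close> on the unchanged cokernels, both monomorphisms, so
  the chase of the five lemma applies.\<close>

lemma Mon_inflation_cobase_change:
  assumes infl: "is_inflation (Mon_conflations C) \<phi>" and \<chi>: "\<chi> \<in> Ar (Mon C)" and dc: "sq_dom \<chi> = sq_dom \<phi>"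
  shows "\<exists>\<chi>' \<phi>'. is_pushout (Mon C) \<phi> \<chi> \<chi>' \<phi>' \<and> is_inflation (Mon_conflations C) \<phi>'"
proof -
  obtain \<psi> where \<phi>: "\<phi> \<in> Ar (Mon C)" and \<psi>: "\<psi> \<in> Ar (Mon C)" and dc' [simp]: "sq_dom \<psi> = sq_cod \<phi>"
    and s: "is_mono C (src \<phi>)" "is_cokernel C (src \<phi>) (src \<psi>)"
    and t: "is_mono C (tgt \<phi>)" "is_cokernel C (tgt \<phi>) (tgt \<psi>)"
    using infl unfolding is_inflation_def Mon_conflation_iff ses_iff(2) by auto
  note [simp] = dc Ar_MonD(1-10)[OF \<phi>] Ar_MonD(1-10)[OF \<chi>, simplified dc] Ar_MonD(1-10)[OF \<psi>, simplified dc']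
  obtain g1 j1 where P: "is_pushout C (src \<phi>) (src \<chi>) g1 j1" and j1: "is_mono C j1"
    using pushout_of_mono[OF s(1), of "src \<chi>"] by auto
  obtain g2 j2 where Q: "is_pushout C (tgt \<phi>) (tgt \<chi>) g2 j2" and j2: "is_mono C j2"
    using pushout_of_mono[OF t(1), of "tgt \<chi>"] by auto
  obtain q1 where q1 [simp]: "q1 \<in> Ar C" "Dom C q1 = Cod C j1" "Cod C q1 = Dom C (sq_cod \<psi>)"
    "q1 \<cdot> g1 = src \<psi>" and k1: "is_kernel C q1 j1"
    using pushout_cokernel[OF P j1 s(2)] by auto
  obtain q2 where q2 [simp]: "q2 \<in> Ar C" "Dom C q2 = Cod C j2" "Cod C q2 = Cod C (sq_cod \<psi>)"
    "q2 \<cdot> g2 = tgt \<psi>" and k2: "is_kernel C q2 j2"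
    using pushout_cokernel[OF Q j2 t(2)] by auto
  note [simp] = pushout_typing(3,4,6-8)[OF P, simplified] pushout_typing(3,4,6-8)[OF Q, simplified]
  note [simp] = kernel_typing(4)[OF k1, simplified] kernel_typing(4)[OF k2, simplified]
  have "(g2 \<cdot> sq_cod \<phi>) \<cdot> src \<phi> = (j2 \<cdot> sq_cod \<chi>) \<cdot> src \<chi>"
    using Ar_MonD(11)[OF \<phi>] Ar_MonD(11)[OF \<chi>] Comp_eq_assoc[OF pushout_typing(9)[OF Q], of "sq_dom \<phi>"] by simp
  then obtain \<pi> where \<pi> [simp]: "\<pi> \<in> Ar C" "Dom C \<pi> = Cod C j1" "Cod C \<pi> = Cod C j2"
    "\<pi> \<cdot> g1 = g2 \<cdot> sq_cod \<phi>" "\<pi> \<cdot> j1 = j2 \<cdot> sq_cod \<chi>"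
    using pushout_factor[OF P, of "g2 \<cdot> sq_cod \<phi>" "j2 \<cdot> sq_cod \<chi>"] by auto
  have \<delta>q: "sq_cod \<psi> \<cdot> q1 = q2 \<cdot> \<pi>"
    by (rule pushout_joint_epi[OF P])
      (simp_all add: Ar_MonD(11)[OF \<psi>] Comp_eq_assoc[OF q2(4)] Comp_eq_assoc[OF kernel_typing(4)[OF k2]])
  \<comment> \<open>First half of the chase: if \<open>\<pi> \<cdot> b\<close> factors through
    \<open>j2\<close>, then \<open>q2\<close> kills it, so the monomorphism
    \<open>sq_cod \<psi>\<close> kills \<open>q1 \<cdot> b\<close>, and \<open>b\<close> factors
    through the kernel \<open>j1\<close> of \<open>q1\<close>. This also says that the new square is
    cartesian.\<close>
  have lift: "\<exists>x\<in>Ar C. Dom C x = Dom C b \<and> Cod C x = Dom C j1 \<and> j1 \<cdot> x = b"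
    if [simp]: "a \<in> Ar C" "b \<in> Ar C" "Dom C a = Dom C b" "Cod C a = Dom C j2" "Cod C b = Dom C \<pi>"
      and eq: "\<pi> \<cdot> b = j2 \<cdot> a" for a b
  proof -
    have "sq_cod \<psi> \<cdot> (q1 \<cdot> b) = Zero C (Dom C b) (Cod C (sq_cod \<psi>))"
      using Comp_eq_assoc[OF \<delta>q, of b] eq Comp_eq_assoc[OF kernel_typing(4)[OF k2], of a] by simp
    then have "q1 \<cdot> b = Zero C (Dom C b) (Dom C (sq_cod \<psi>))"
      by (rule mono_zeroD[OF Ar_MonD(2)[OF \<psi>]]) simp_all
    then show ?thesis
      by - (rule kernel_factor[OF k1, of b], auto)
  qed
  have "is_mono C \<pi>"
  proof (rule monoI)
    fix u assume [simp]: "u \<in> Ar C" "Cod C u = Dom C \<pi>" and z: "\<pi> \<cdot> u = Zero C (Dom C u) (Cod C \<pi>)"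
    \<comment> \<open>The zero arrow factors through \<open>j2\<close>, so \<open>lift\<close> moves
      \<open>u\<close> into \<open>j1\<close>, where \<open>\<pi>\<close> acts as
      \<open>sq_cod \<chi>\<close> followed by \<open>j2\<close>.\<close>
    have "\<pi> \<cdot> u = j2 \<cdot> Zero C (Dom C u) (Dom C j2)" using z by simp
    then obtain x where [simp]: "x \<in> Ar C" "Dom C x = Dom C u" "Cod C x = Dom C j1" and x: "j1 \<cdot> x = u"
      using lift[of "Zero C (Dom C u) (Dom C j2)" u] by auto
    have "j2 \<cdot> (sq_cod \<chi> \<cdot> x) = Zero C (Dom C u) (Cod C j2)"
      using Comp_eq_assoc[OF \<pi>(5), of x] z x by simp
    then have "sq_cod \<chi> \<cdot> x = Zero C (Dom C u) (Dom C j2)" by (rule mono_zeroD[OF j2]) simp_all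
    then have "x = Zero C (Dom C u) (Dom C (sq_cod \<chi>))"
      by - (rule mono_zeroD[OF Ar_MonD(2)[OF \<chi>]], simp_all)
    then show "u = Zero C (Dom C u) (Dom C \<pi>)" using x by simp
  qed simp
  then have Ar: "Square (sq_cod \<phi>) \<pi> g1 g2 \<in> Ar (Mon C)" "Square (sq_cod \<chi>) \<pi> j1 j2 \<in> Ar (Mon C)"
    by (simp_all add: Ar_Mon_iff)
  show ?thesis
  proof (intro exI conjI)
    show "is_pushout (Mon C) \<phi> \<chi> (Square (sq_cod \<phi>) \<pi> g1 g2) (Square (sq_cod \<chi>) \<pi> j1 j2)"
      by (rule Mon_pushoutI[OF \<phi> \<chi> Ar]) (simp_all add: P Q)
    have "cartesian (Square (sq_cod \<chi>) \<pi> j1 j2)"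
      by (rule cartesianI, unfold square.sel, rule lift)
    with Ar j2 show "is_inflation (Mon_conflations C) (Square (sq_cod \<chi>) \<pi> j1 j2)"
      by (simp add: Mon_inflation_iff)
  qed
qed

text \<open>Pasting of pullback squares: lift first along \<open>src \<chi>\<close>, then along
  \<open>src \<phi>\<close>. Cancelling the monomorphism \<open>tgt \<chi>\<close> shows that the
  first lift qualifies for the second.\<close>

lemma Mon_inflation_comp:
  assumes "is_inflation (Mon_conflations C) \<phi>" "is_inflation (Mon_conflations C) \<chi>" and dc: "sq_dom \<chi> = sq_cod \<phi>"
  shows "is_inflation (Mon_conflations C) (\<chi> \<cdot>\<^bsub>Mon C\<^esub> \<phi>)"
proof -
  interpret M: additive_category "Mon C" by (rule additive_Mon)
  from assms have \<phi>: "\<phi> \<in> Ar (Mon C)" "is_mono C (tgt \<phi>)" "cartesian \<phi>"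
    and \<chi>: "\<chi> \<in> Ar (Mon C)" "is_mono C (tgt \<chi>)" "cartesian \<chi>" by (simp_all add: Mon_inflation_iff)
  note [simp] = dc Ar_MonD(1-10)[OF \<phi>(1)] Ar_MonD(1-10)[OF \<chi>(1), simplified dc]
  have "cartesian (\<chi> \<cdot>\<^bsub>Mon C\<^esub> \<phi>)"
  proof (rule cartesianI)
    fix a b assume [simp]: "a \<in> Ar C" "b \<in> Ar C" "Dom C a = Dom C b" and ab: "Cod C a = Dom C (tgt (\<chi> \<cdot>\<^bsub>Mon C\<^esub> \<phi>))"
      "Cod C b = Dom C (sq_cod (\<chi> \<cdot>\<^bsub>Mon C\<^esub> \<phi>))" and eq: "sq_cod (\<chi> \<cdot>\<^bsub>Mon C\<^esub> \<phi>) \<cdot> b = tgt (\<chi> \<cdot>\<^bsub>Mon C\<^esub> \<phi>) \<cdot> a"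
    note [simp] = ab[simplified]
    have "sq_cod \<chi> \<cdot> b = tgt \<chi> \<cdot> (tgt \<phi> \<cdot> a)" using eq by simp
    then obtain x where [simp]: "x \<in> Ar C" "Dom C x = Dom C b" "Cod C x = Dom C (src \<chi>)" and x: "src \<chi> \<cdot> x = b"
      by (rule cartesianD[OF \<chi>(3)]) simp_all
    have "tgt \<chi> \<cdot> (sq_cod \<phi> \<cdot> x) = tgt \<chi> \<cdot> (tgt \<phi> \<cdot> a)"
      using Mon_comm_assoc[OF \<chi>(1), of x] eq x by simp
    then have "sq_cod \<phi> \<cdot> x = tgt \<phi> \<cdot> a" by (rule monoD[OF \<chi>(2)]) simp_all
    then obtain y where [simp]: "y \<in> Ar C" "Dom C y = Dom C x" "Cod C y = Dom C (src \<phi>)" and y: "src \<phi> \<cdot> y = x"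
      by (rule cartesianD[OF \<phi>(3)]) simp_all
    show "\<exists>y\<in>Ar C. Dom C y = Dom C b \<and> Cod C y = Dom C (src (\<chi> \<cdot>\<^bsub>Mon C\<^esub> \<phi>)) \<and> src (\<chi> \<cdot>\<^bsub>Mon C\<^esub> \<phi>) \<cdot> y = b"
      by (rule bexI[of _ y]) (simp_all add: x y)
  qed
  moreover have "is_mono C (tgt \<chi> \<cdot> tgt \<phi>)" by (rule mono_comp[OF \<phi>(2) \<chi>(2)]) simp
  moreover have "\<chi> \<cdot>\<^bsub>Mon C\<^esub> \<phi> \<in> Ar (Mon C)" by (rule M.Comp_typing(1)[OF \<phi>(1) \<chi>(1)]) simp
  ultimately show ?thesis by (simp add: Mon_inflation_iff)
qed

text \<open>The lift \<open>x\<close> for the composite only satisfies \<open>src \<chi> \<cdot>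
  (src \<phi> \<cdot> x) = src \<chi> \<cdot> b\<close>, and \<open>src \<chi>\<close> is not known
  to be a monomorphism. The equation \<open>src \<phi> \<cdot> x = b\<close> is therefore recovered
  from the targets.\<close>

lemma Mon_inflation_cancel:
  assumes \<phi>: "\<phi> \<in> Ar (Mon C)" and \<chi>: "\<chi> \<in> Ar (Mon C)" and dc: "sq_dom \<chi> = sq_cod \<phi>"
    and infl: "is_inflation (Mon_conflations C) (\<chi> \<cdot>\<^bsub>Mon C\<^esub> \<phi>)"
  shows "is_inflation (Mon_conflations C) \<phi>"
proof -
  note [simp] = dc Ar_MonD(1-10)[OF \<phi>(1)] Ar_MonD(1-10)[OF \<chi>(1), simplified dc]
  from infl have m: "is_mono C (tgt \<chi> \<cdot> tgt \<phi>)" and cart: "cartesian (\<chi> \<cdot>\<^bsub>Mon C\<^esub> \<phi>)"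
    by (simp_all add: Mon_inflation_iff)
  have t: "is_mono C (tgt \<phi>)" by (rule mono_cancel[OF m]) simp_all
  have "cartesian \<phi>"
  proof (rule cartesianI)
    fix a b assume [simp]: "a \<in> Ar C" "b \<in> Ar C" "Dom C a = Dom C b" "Cod C a = Dom C (tgt \<phi>)"
      "Cod C b = Dom C (sq_cod \<phi>)" and eq: "sq_cod \<phi> \<cdot> b = tgt \<phi> \<cdot> a"
    have eq': "sq_cod \<chi> \<cdot> (src \<chi> \<cdot> b) = (tgt \<chi> \<cdot> tgt \<phi>) \<cdot> a"
      using Mon_comm_assoc[OF \<chi>, of b] eq by simp
    obtain x where [simp]: "x \<in> Ar C" "Dom C x = Dom C b" "Cod C x = Dom C (src \<phi>)"
      and x: "src \<chi> \<cdot> (src \<phi> \<cdot> x) = src \<chi> \<cdot> b"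
      by (rule cartesianD[OF cart, of "src \<chi> \<cdot> b" a]) (use eq' in simp_all)
    \<comment> \<open>Detour through the targets: cancelling the monomorphism
      \<open>tgt \<chi> \<cdot> tgt \<phi>\<close> identifies \<open>sq_dom \<phi> \<cdot> x\<close>
      with \<open>a\<close>, after which the monomorphism \<open>sq_cod \<phi>\<close> can be
      cancelled.\<close>
    have "(tgt \<chi> \<cdot> tgt \<phi>) \<cdot> (sq_dom \<phi> \<cdot> x) = (tgt \<chi> \<cdot> tgt \<phi>) \<cdot> a"
      using Mon_comm_assoc[OF \<chi>, of "src \<phi> \<cdot> x"] Mon_comm_assoc[OF \<phi>, of x] x eq' by simp
    then have "sq_dom \<phi> \<cdot> x = a" by (rule monoD[OF m]) simp_all
    then have "sq_cod \<phi> \<cdot> (src \<phi> \<cdot> x) = sq_cod \<phi> \<cdot> b"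
      using Mon_comm_assoc[OF \<phi>, of x] eq by simp
    then have "src \<phi> \<cdot> x = b" by (rule monoD[OF Ar_MonD(2)[OF \<phi>]]) simp_all
    then show "\<exists>x\<in>Ar C. Dom C x = Dom C b \<and> Cod C x = Dom C (src \<phi>) \<and> src \<phi> \<cdot> x = b"
      by (intro bexI[of _ x]) simp_all
  qed
  with \<phi> t show ?thesis by (simp add: Mon_inflation_iff)
qed

section \<open>Closure under isomorphism and the axioms of an exact category\<close>

lemma ses_iso_closed:
  assumes "(i, p) \<in> kernel_cokernel_pairs C" and i': "i' \<in> Ar C" "p' \<in> Ar C" "Cod C i' = Dom C p'"
    and iso: "is_iso C a" "is_iso C b" "is_iso C c"
    and a: "Dom C a = Dom C i" "Cod C a = Dom C i'"
    and b: "Dom C b = Cod C i" "Cod C b = Cod C i'"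
    and c: "Dom C c = Cod C p" "Cod C c = Cod C p'"
    and sq: "b \<cdot> i = i' \<cdot> a" "c \<cdot> p = p' \<cdot> b"
  shows "(i', p') \<in> kernel_cokernel_pairs C"
proof -
  from assms(1) have k: "is_kernel C p i" and e: "is_epi C p" by (simp_all add: ses_iff(1))
  note [simp] = i' a b c kernel_typing[OF k]
  obtain a' where a' [simp]: "a' \<in> Ar C" "Dom C a' = Dom C i'" "Cod C a' = Dom C i" "a \<in> Ar C"
    "a' \<cdot> a = Idn C (Dom C i)" "a \<cdot> a' = Idn C (Dom C i')"
    using iso(1) by (auto simp: is_iso_def Hom_def)
  obtain b' where b' [simp]: "b' \<in> Ar C" "Dom C b' = Dom C p'" "Cod C b' = Dom C p" "b \<in> Ar C"
    "b' \<cdot> b = Idn C (Dom C p)" "b \<cdot> b' = Idn C (Dom C p')"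
    using iso(2) by (auto simp: is_iso_def Hom_def)
  obtain c' where c' [simp]: "c' \<in> Ar C" "Dom C c' = Cod C p'" "Cod C c' = Cod C p" "c \<in> Ar C"
    "c' \<cdot> c = Idn C (Cod C p)" "c \<cdot> c' = Idn C (Cod C p')"
    using iso(3) by (auto simp: is_iso_def Hom_def)
  have "is_epi C c" by (rule split_epi[OF c'(6)]) simp_all
  then have "is_epi C (p' \<cdot> b)" using epi_comp[OF e, of c] sq(2) by simp
  then have e': "is_epi C p'" by (rule epi_cancel) simp_all
  \<comment> \<open>The inverse \<open>a'\<close> expresses \<open>i'\<close> through
    \<open>i\<close>, as a composite of three monomorphisms.\<close>
  have i'_eq: "i' = b \<cdot> (i \<cdot> a')"
    using Comp_eq_assoc[OF sq(1), of a'] by simp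
  have "is_mono C a'" by (rule split_mono[OF a'(6)]) simp_all
  moreover have "is_mono C b" by (rule split_mono[OF b'(5)]) simp_all
  ultimately have m: "is_mono C i'"
    unfolding i'_eq using mono_comp[OF mono_comp[OF _ kernel_mono[OF k], of a'], of b] by simp
  have cm: "is_mono C c" by (rule split_mono[OF c'(5)]) simp_all
  have "is_kernel C p' i'"
  proof (rule is_kernelI[OF _ m])
    have "p' \<cdot> i' = c \<cdot> (p \<cdot> (i \<cdot> a'))"
      unfolding i'_eq using Comp_eq_assoc[OF sq(2), of "i \<cdot> a'"] by simp
    then show "p' \<cdot> i' = Zero C (Dom C i') (Cod C p')"
      using Comp_eq_assoc[OF kernel_typing(4)[OF k], of a'] by simp
    fix h assume [simp]: "h \<in> Ar C" "Cod C h = Dom C p'" and z: "p' \<cdot> h = Zero C (Dom C h) (Cod C p')"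
    have bb: "b \<cdot> (b' \<cdot> h) = h" using Comp_eq_assoc[OF b'(6), of h] by simp
    have "c \<cdot> (p \<cdot> (b' \<cdot> h)) = Zero C (Dom C h) (Cod C c)"
      using Comp_eq_assoc[OF sq(2), of "b' \<cdot> h"] bb z by simp
    then have "p \<cdot> (b' \<cdot> h) = Zero C (Dom C h) (Dom C c)" by (rule mono_zeroD[OF cm]) simp_all
    then obtain u where u [simp]: "u \<in> Ar C" "Dom C u = Dom C h" "Cod C u = Dom C i" "i \<cdot> u = b' \<cdot> h"
      using kernel_factor[OF k, of "b' \<cdot> h"] by auto
    have "i' \<cdot> (a \<cdot> u) = h" using Comp_eq_assoc[OF sq(1), of u] bb by simp
    then show "\<exists>u\<in>Hom C (Dom C h) (Dom C i'). i' \<cdot> u = h"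
      by (intro bexI[of _ "a \<cdot> u"]) (simp_all add: Hom_def)
  qed simp_all
  with e' show ?thesis by (simp add: ses_iff(1))
qed

lemma Mon_iso_components:
  assumes "is_iso (Mon C) \<phi>"
  shows "is_iso C (src \<phi>)" "is_iso C (tgt \<phi>)"
proof -
  obtain \<psi> where \<phi>: "\<phi> \<in> Ar (Mon C)" and \<psi>: "\<psi> \<in> Ar (Mon C)"
    and dc: "sq_dom \<psi> = sq_cod \<phi>" "sq_cod \<psi> = sq_dom \<phi>"
    and eq: "src \<psi> \<cdot> src \<phi> = Idn C (Dom C (sq_dom \<phi>))" "tgt \<psi> \<cdot> tgt \<phi> = Idn C (Cod C (sq_dom \<phi>))"
      "src \<phi> \<cdot> src \<psi> = Idn C (Dom C (sq_cod \<phi>))" "tgt \<phi> \<cdot> tgt \<psi> = Idn C (Cod C (sq_cod \<phi>))"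
    using assms unfolding is_iso_def Hom_def by auto
  then show "is_iso C (src \<phi>)" "is_iso C (tgt \<phi>)"
    unfolding is_iso_def Hom_def
    using Ar_MonD[OF \<phi>] Ar_MonD[OF \<psi>] by (auto intro!: bexI[of _ "src \<psi>"] bexI[of _ "tgt \<psi>"])
qed

lemma exact_Mon: "exact_category (Mon C) (Mon_conflations C)"
proof (intro exact_category.intro exact_category_axioms.intro additive_Mon)
  interpret M: additive_category "Mon C" by (rule additive_Mon)
  show "Mon_conflations C \<subseteq> kernel_cokernel_pairs (Mon C)"
    by (auto simp: Mon_conflation_iff kernel_cokernel_pairs_def intro: Mon_kernelI Mon_cokernelI)
  show "(i', p') \<in> Mon_conflations C"
    if "(i, p) \<in> Mon_conflations C" "i' \<in> Ar (Mon C)" "p' \<in> Ar (Mon C)" "Cod (Mon C) i' = Dom (Mon C) p'"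
      "is_iso (Mon C) a" "a \<in> Hom (Mon C) (Dom (Mon C) i) (Dom (Mon C) i')"
      "is_iso (Mon C) b" "b \<in> Hom (Mon C) (Cod (Mon C) i) (Cod (Mon C) i')"
      "is_iso (Mon C) c" "c \<in> Hom (Mon C) (Cod (Mon C) p) (Cod (Mon C) p')"
      "b \<cdot>\<^bsub>Mon C\<^esub> i = i' \<cdot>\<^bsub>Mon C\<^esub> a" "c \<cdot>\<^bsub>Mon C\<^esub> p = p' \<cdot>\<^bsub>Mon C\<^esub> b" for i p i' p' a b c
  proof -
    have ip: "i \<in> Ar (Mon C)" "p \<in> Ar (Mon C)" "sq_cod i = sq_dom p"
      "(src i, src p) \<in> kernel_cokernel_pairs C" "(tgt i, tgt p) \<in> kernel_cokernel_pairs C"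
      using that(1) by (simp_all add: Mon_conflation_iff)
    have abc: "a \<in> Ar (Mon C)" "b \<in> Ar (Mon C)" "c \<in> Ar (Mon C)" "sq_dom a = sq_dom i" "sq_cod a = sq_dom i'"
      "sq_dom b = sq_dom p" "sq_cod b = sq_dom p'" "sq_dom c = sq_cod p" "sq_cod c = sq_cod p'" "sq_cod i' = sq_dom p'"
      using that(4,6,8,10) ip(3) by (simp_all add: Hom_def)
    note [simp] = abc ip(3) Ar_MonD(5-10)[OF ip(1)] Ar_MonD(5-10)[OF ip(2)] Ar_MonD(5-10)[OF that(2)]
      Ar_MonD(5-10)[OF that(3)] Ar_MonD(5-10)[OF abc(1)] Ar_MonD(5-10)[OF abc(2)] Ar_MonD(5-10)[OF abc(3)]
    have "(src i', src p') \<in> kernel_cokernel_pairs C"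
      by (rule ses_iso_closed[OF ip(4), of _ _ "src a" "src b" "src c"])
        (use that(11,12) in \<open>simp_all add: Mon_iso_components that\<close>)
    moreover have "(tgt i', tgt p') \<in> kernel_cokernel_pairs C"
      by (rule ses_iso_closed[OF ip(5), of _ _ "tgt a" "tgt b" "tgt c"])
        (use that(11,12) in \<open>simp_all add: Mon_iso_components that\<close>)
    ultimately show ?thesis using that(2,3) by (simp add: Mon_conflation_iff)
  qed
  show "(i, q) \<in> Mon_conflations C" if "is_biproduct (Mon C) X Y S i j p q" for X Y S i j p q
    using M.biproduct_typing[OF that] Mon_biproduct_components[OF that]
    by (simp add: Mon_conflation_iff kernel_cokernel_pairs_def biproduct_ses)
  show "is_deflation (Mon_conflations C) (q \<cdot>\<^bsub>Mon C\<^esub> p)"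
    if "is_deflation (Mon_conflations C) p" "is_deflation (Mon_conflations C) q" and dc: "Cod (Mon C) p = Dom (Mon C) q"
    for p q
  proof -
    from that have p: "p \<in> Ar (Mon C)" "is_epi C (src p)" "is_epi C (tgt p)"
      and q: "q \<in> Ar (Mon C)" "is_epi C (src q)" "is_epi C (tgt q)" by (simp_all add: Mon_deflation_iff)
    have "q \<cdot>\<^bsub>Mon C\<^esub> p \<in> Ar (Mon C)" by (rule M.Comp_typing(1)[OF p(1) q(1) dc])
    moreover have "is_epi C (src q \<cdot> src p)" "is_epi C (tgt q \<cdot> tgt p)"
      using epi_comp[OF p(2) q(2)] epi_comp[OF p(3) q(3)] Ar_MonD[OF p(1)] Ar_MonD[OF q(1)] dc by simp_all
    ultimately show ?thesis by (simp add: Mon_deflation_iff)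
  qed
  show "is_inflation (Mon_conflations C) (j \<cdot>\<^bsub>Mon C\<^esub> i)"
    if "is_inflation (Mon_conflations C) i" "is_inflation (Mon_conflations C) j" "Cod (Mon C) i = Dom (Mon C) j" for i j
    using that by (intro Mon_inflation_comp) simp_all
  show "\<exists>f' p'. is_pullback (Mon C) p f f' p' \<and> is_deflation (Mon_conflations C) p'"
    if "is_deflation (Mon_conflations C) p" "f \<in> Ar (Mon C)" "Cod (Mon C) f = Cod (Mon C) p" for p f
    using that by (intro Mon_deflation_base_change) simp_all
  show "\<exists>f' i'. is_pushout (Mon C) i f f' i' \<and> is_inflation (Mon_conflations C) i'"
    if "is_inflation (Mon_conflations C) i" "f \<in> Ar (Mon C)" "Dom (Mon C) f = Dom (Mon C) i" for i f
    using that by (intro Mon_inflation_cobase_change) simp_all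
  show "is_deflation (Mon_conflations C) f"
    if f: "f \<in> Ar (Mon C)" and g: "g \<in> Ar (Mon C)" "Cod (Mon C) g = Dom (Mon C) f"
      and d: "is_deflation (Mon_conflations C) (f \<cdot>\<^bsub>Mon C\<^esub> g)" for f g
  proof -
    from d have "is_epi C (src f \<cdot> src g)" "is_epi C (tgt f \<cdot> tgt g)" by (simp_all add: Mon_deflation_iff)
    then have "is_epi C (src f)" "is_epi C (tgt f)"
      using epi_cancel[of "src f" "src g"] epi_cancel[of "tgt f" "tgt g"] Ar_MonD[OF f] Ar_MonD[OF g(1)] g(2) by simp_all
    with f show ?thesis by (simp add: Mon_deflation_iff)
  qed
  show "is_inflation (Mon_conflations C) f"
    if "f \<in> Ar (Mon C)" "g \<in> Ar (Mon C)" "Dom (Mon C) g = Cod (Mon C) f"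
      "is_inflation (Mon_conflations C) (g \<cdot>\<^bsub>Mon C\<^esub> f)" for f g
    using that by (intro Mon_inflation_cancel[of f g]) simp_all
qed

end

section \<open>Projective and injective objects\<close>

context preadditive_category
begin

lemma projective_lift:
  assumes "is_projective C E P" "is_deflation E p" "f \<in> Ar C" "Dom C f = P" "Cod C f = Cod C p"
  obtains g where "g \<in> Ar C" "Dom C g = P" "Cod C g = Dom C p" "p \<cdot> g = f"
  using assms unfolding is_projective_def Hom_def by blast

lemma injective_extend:
  assumes "is_injective C E I" "is_inflation E i" "f \<in> Ar C" "Cod C f = I" "Dom C f = Dom C i"
  obtains g where "g \<in> Ar C" "Cod C g = I" "Dom C g = Cod C i" "g \<cdot> i = f"
  using assms unfolding is_injective_def Hom_def by blast

lemma projectiveI: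
  assumes "P \<in> Ob C" "\<And>p f. \<lbrakk>is_deflation E p; f \<in> Ar C; Dom C f = P; Cod C f = Cod C p\<rbrakk>
    \<Longrightarrow> \<exists>g\<in>Ar C. Dom C g = P \<and> Cod C g = Dom C p \<and> p \<cdot> g = f"
  shows "is_projective C E P"
  unfolding is_projective_def
proof (intro conjI allI impI ballI)
  fix p f assume "is_deflation E p" "f \<in> Hom C P (Cod C p)"
  with assms(2)[of p f] show "\<exists>g\<in>Hom C P (Dom C p). p \<cdot> g = f" unfolding Hom_def by blast
qed (rule assms(1))

lemma injectiveI:
  assumes "I \<in> Ob C" "\<And>i f. \<lbrakk>is_inflation E i; f \<in> Ar C; Cod C f = I; Dom C f = Dom C i\<rbrakk>
    \<Longrightarrow> \<exists>g\<in>Ar C. Cod C g = I \<and> Dom C g = Cod C i \<and> g \<cdot> i = f"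
  shows "is_injective C E I"
  unfolding is_injective_def
proof (intro conjI allI impI ballI)
  fix i f assume "is_inflation E i" "f \<in> Hom C (Dom C i) I"
  with assms(2)[of i f] show "\<exists>g\<in>Hom C (Cod C i) I. g \<cdot> i = f" unfolding Hom_def by blast
qed (rule assms(1))

text \<open>Stated for retracts and not only for direct summands, because the passage from injective
  to projective objects in \<open>frobenius_Mon\<close> has a retraction at hand but no
  complement.\<close>

lemma retract_projective:
  assumes P: "is_projective C E P" and E: "\<And>p. is_deflation E p \<Longrightarrow> p \<in> Ar C"
    and [simp]: "r \<in> Ar C" "s \<in> Ar C" "Dom C r = P" "Cod C s = P" "Cod C r = Q" "Dom C s = Q"
    and rs: "r \<cdot> s = Idn C Q"
  shows "is_projective C E Q"
proof (rule projectiveI)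
  show "Q \<in> Ob C" using Dom_Ob[of s] by simp
  fix p f assume p: "is_deflation E p" and [simp]: "f \<in> Ar C" "Dom C f = Q" "Cod C f = Cod C p"
  note [simp] = E[OF p] rs
  obtain g where g [simp]: "g \<in> Ar C" "Dom C g = P" "Cod C g = Dom C p" "p \<cdot> g = f \<cdot> r"
    by (rule projective_lift[OF P p, of "f \<cdot> r"]) simp_all
  show "\<exists>g\<in>Ar C. Dom C g = Q \<and> Cod C g = Dom C p \<and> p \<cdot> g = f"
    by (rule bexI[of _ "g \<cdot> s"]) (simp_all add: Comp_eq_assoc[OF g(4)])
qed

lemma retract_injective:
  assumes I: "is_injective C E I" and E: "\<And>i. is_inflation E i \<Longrightarrow> i \<in> Ar C"
    and [simp]: "r \<in> Ar C" "s \<in> Ar C" "Dom C r = I" "Cod C s = I" "Cod C r = J" "Dom C s = J"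
    and rs: "r \<cdot> s = Idn C J"
  shows "is_injective C E J"
proof (rule injectiveI)
  show "J \<in> Ob C" using Dom_Ob[of s] by simp
  fix i f assume i: "is_inflation E i" and [simp]: "f \<in> Ar C" "Cod C f = J" "Dom C f = Dom C i"
  note [simp] = E[OF i]
  obtain g where g [simp]: "g \<in> Ar C" "Cod C g = I" "Dom C g = Cod C i" "g \<cdot> i = s \<cdot> f"
    by (rule injective_extend[OF I i, of "s \<cdot> f"]) simp_all
  show "\<exists>g\<in>Ar C. Cod C g = J \<and> Dom C g = Cod C i \<and> g \<cdot> i = f"
    by (rule bexI[of _ "r \<cdot> g"]) (simp_all add: Comp_eq_assoc[OF rs])
qed

lemma biproduct_projective:
  assumes S: "is_biproduct C X Y S i j p q" and X: "is_projective C E X" and Y: "is_projective C E Y"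
    and E: "\<And>p. is_deflation E p \<Longrightarrow> p \<in> Ar C"
  shows "is_projective C E S"
proof (rule projectiveI)
  note [simp] = biproduct_typing(1-19)[OF S]
  show "S \<in> Ob C" by simp
  fix e f assume e: "is_deflation E e" and [simp]: "f \<in> Ar C" "Dom C f = S" "Cod C f = Cod C e"
  note [simp] = E[OF e]
  obtain g where g [simp]: "g \<in> Ar C" "Dom C g = X" "Cod C g = Dom C e" "e \<cdot> g = f \<cdot> i"
    by (rule projective_lift[OF X e, of "f \<cdot> i"]) simp_all
  obtain h where h [simp]: "h \<in> Ar C" "Dom C h = Y" "Cod C h = Dom C e" "e \<cdot> h = f \<cdot> j"
    by (rule projective_lift[OF Y e, of "f \<cdot> j"]) simp_all
  obtain k where k [simp]: "k \<in> Ar C" "Dom C k = S" "Cod C k = Dom C e" "k \<cdot> i = g" "k \<cdot> j = h"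
    using biproduct_copair[OF S, of g h] by auto
  have "e \<cdot> k = f" by (rule biproduct_joint_epi[OF S]) simp_all
  then show "\<exists>g\<in>Ar C. Dom C g = S \<and> Cod C g = Dom C e \<and> e \<cdot> g = f"
    by (intro bexI[of _ k]) simp_all
qed

lemma biproduct_injective:
  assumes S: "is_biproduct C X Y S i j p q" and X: "is_injective C E X" and Y: "is_injective C E Y"
    and E: "\<And>i. is_inflation E i \<Longrightarrow> i \<in> Ar C"
  shows "is_injective C E S"
proof (rule injectiveI)
  note [simp] = biproduct_typing(1-19)[OF S]
  show "S \<in> Ob C" by simp
  fix m f assume m: "is_inflation E m" and [simp]: "f \<in> Ar C" "Cod C f = S" "Dom C f = Dom C m"
  note [simp] = E[OF m]
  obtain g where g [simp]: "g \<in> Ar C" "Cod C g = X" "Dom C g = Cod C m" "g \<cdot> m = p \<cdot> f"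
    by (rule injective_extend[OF X m, of "p \<cdot> f"]) simp_all
  obtain h where h [simp]: "h \<in> Ar C" "Cod C h = Y" "Dom C h = Cod C m" "h \<cdot> m = q \<cdot> f"
    by (rule injective_extend[OF Y m, of "q \<cdot> f"]) simp_all
  obtain k where k [simp]: "k \<in> Ar C" "Cod C k = S" "Dom C k = Cod C m" "p \<cdot> k = g" "q \<cdot> k = h"
    using biproduct_pair[OF S, of g h] by auto
  have "k \<cdot> m = f"
    by (rule biproduct_joint_mono[OF S]) (simp_all add: Comp_eq_assoc[OF k(4)] Comp_eq_assoc[OF k(5)])
  then show "\<exists>g\<in>Ar C. Cod C g = S \<and> Dom C g = Cod C m \<and> g \<cdot> m = f"
    by (intro bexI[of _ k]) simp_all
qed

end

context exact_category
begin

lemma deflation_Ar: "is_deflation E p \<Longrightarrow> p \<in> Ar C"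
  and inflation_Ar: "is_inflation E i \<Longrightarrow> i \<in> Ar C"
  using conflation_kernel_cokernel
  by (auto simp: is_deflation_def is_inflation_def kernel_cokernel_pairs_def is_kernel_def)

text \<open>Lifting the identity yields a section of \<open>p\<close>; the inflation paired with
  \<open>p\<close> is its kernel and becomes the complement.\<close>

lemma deflation_onto_projective_splits:
  assumes p: "is_deflation E p" and P: "is_projective C E (Cod C p)"
  shows "is_direct_summand C (Cod C p) (Dom C p)"
proof -
  note [simp] = deflation_Ar[OF p]
  obtain i where "(i, p) \<in> E" using p by (auto simp: is_deflation_def)
  then have i: "is_kernel C p i"
    using conflation_kernel_cokernel by (auto simp: kernel_cokernel_pairs_def)
  obtain s where "s \<in> Ar C" "Dom C s = Cod C p" "Cod C s = Dom C p" "p \<cdot> s = Idn C (Cod C p)"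
    by (rule projective_lift[OF P p, of "Idn C (Cod C p)"]) simp_all
  from kernel_of_split_epi_biproduct[OF i this] show ?thesis
    unfolding is_direct_summand_def by blast
qed

lemma direct_summand_projective:
  assumes "is_direct_summand C X S" "is_projective C E S"
  shows "is_projective C E X"
proof -
  from assms(1) obtain Y i j p q where S: "is_biproduct C X Y S i j p q"
    unfolding is_direct_summand_def is_direct_sum_def by blast
  show ?thesis
    by (rule retract_projective[OF assms(2) deflation_Ar, of p i]) (simp_all add: biproduct_typing[OF S])
qed

lemma direct_summand_injective:
  assumes "is_direct_summand C X S" "is_injective C E S"
  shows "is_injective C E X"
proof -
  from assms(1) obtain Y i j p q where S: "is_biproduct C X Y S i j p q"
    unfolding is_direct_summand_def is_direct_sum_def by blast
  show ?thesis
    by (rule retract_injective[OF assms(2) inflation_Ar, of p i]) (simp_all add: biproduct_typing[OF S])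
qed

end

section \<open>Projectives and injectives of the monomorphism category\<close>

context abelian_category
begin

lemma i1_mono:
  assumes "is_zero_object C Z" "P \<in> Ob C"
  shows "is_mono C (i1 C Z P)"
  unfolding i1_def using assms by (intro mono_from_zero_object[OF assms(1)]) (simp_all add: is_zero_object_def)

lemma i2_mono: "P \<in> Ob C \<Longrightarrow> is_mono C (i2 C P)"
  unfolding i2_def by (rule split_mono[of "Idn C P" _ P]) simp_all

lemma i1_projective:
  assumes Z: "is_zero_object C Z" and P: "is_projective C (kernel_cokernel_pairs C) P"
  shows "is_projective (Mon C) (Mon_conflations C) (i1 C Z P)"
proof -
  interpret M: exact_category "Mon C" "Mon_conflations C" by (rule exact_Mon)
  have [simp]: "P \<in> Ob C" "Z \<in> Ob C" using P Z by (simp_all add: is_projective_def is_zero_object_def)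
  note [simp] = i1_mono[OF Z]
  have a: "Dom C (i1 C Z P) = Z" "Cod C (i1 C Z P) = P" "i1 C Z P \<in> Ar C" by (simp_all add: i1_def)
  note [simp] = a(3)
  show ?thesis
  proof (rule M.projectiveI)
    fix \<psi> f assume \<psi>: "is_deflation (Mon_conflations C) \<psi>" and f: "f \<in> Ar (Mon C)"
      and dc: "Dom (Mon C) f = i1 C Z P" "Cod (Mon C) f = Cod (Mon C) \<psi>"
    then have \<psi>A: "\<psi> \<in> Ar (Mon C)" and t: "is_epi C (tgt \<psi>)" by (simp_all add: Mon_deflation_iff)
    note [simp] = dc[simplified]
    note [simp] = Ar_MonD(1-10)[OF \<psi>A] Ar_MonD(5-10)[OF f, simplified a dc Mon_simps]
    obtain g where g [simp]: "g \<in> Ar C" "Dom C g = P" "Cod C g = Cod C (sq_dom \<psi>)" "tgt \<psi> \<cdot> g = tgt f"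
      by (rule projective_lift[OF P, of "tgt \<psi>" "tgt f"]) (simp_all add: deflation_iff_epi t a)
    show "\<exists>g\<in>Ar (Mon C). Dom (Mon C) g = i1 C Z P \<and> Cod (Mon C) g = Dom (Mon C) \<psi> \<and> \<psi> \<cdot>\<^bsub>Mon C\<^esub> g = f"
    proof (rule bexI)
      let ?g = "Square (i1 C Z P) (sq_dom \<psi>) (Zero C Z (Dom C (sq_dom \<psi>))) g"
      show "?g \<in> Ar (Mon C)"
        by (simp add: Ar_Mon_iff a) (simp add: i1_def)
      have "src f = Zero C Z (Dom C (sq_cod \<psi>))"
        by (rule zero_object_eq[OF Z]) (simp_all add: a)
      then show "Dom (Mon C) ?g = i1 C Z P \<and> Cod (Mon C) ?g = Dom (Mon C) \<psi> \<and> \<psi> \<cdot>\<^bsub>Mon C\<^esub> ?g = f"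
        by (simp add: square.expand)
    qed
  qed simp
qed

lemma i2_projective:
  assumes P: "is_projective C (kernel_cokernel_pairs C) P"
  shows "is_projective (Mon C) (Mon_conflations C) (i2 C P)"
proof -
  interpret M: exact_category "Mon C" "Mon_conflations C" by (rule exact_Mon)
  have [simp]: "P \<in> Ob C" using P by (simp add: is_projective_def)
  note [simp] = i2_mono[unfolded i2_def]
  show ?thesis
    unfolding i2_def
  proof (rule M.projectiveI)
    fix \<psi> f assume \<psi>: "is_deflation (Mon_conflations C) \<psi>" and f: "f \<in> Ar (Mon C)"
      and dc: "Dom (Mon C) f = Idn C P" "Cod (Mon C) f = Cod (Mon C) \<psi>"
    then have \<psi>A: "\<psi> \<in> Ar (Mon C)" and s: "is_epi C (src \<psi>)" by (simp_all add: Mon_deflation_iff)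
    note [simp] = dc[simplified]
    note [simp] = Ar_MonD(1-10)[OF \<psi>A] Ar_MonD(5-10)[OF f, simplified]
    obtain g where g [simp]: "g \<in> Ar C" "Dom C g = P" "Cod C g = Dom C (sq_dom \<psi>)" "src \<psi> \<cdot> g = src f"
      by (rule projective_lift[OF P, of "src \<psi>" "src f"]) (simp_all add: deflation_iff_epi s)
    have t: "tgt \<psi> \<cdot> (sq_dom \<psi> \<cdot> g) = tgt f"
      using Mon_comm_assoc[OF \<psi>A, of g] Ar_MonD(11)[OF f] by simp
    show "\<exists>g\<in>Ar (Mon C). Dom (Mon C) g = Idn C P \<and> Cod (Mon C) g = Dom (Mon C) \<psi> \<and> \<psi> \<cdot>\<^bsub>Mon C\<^esub> g = f"
      by (rule bexI[of _ "Square (Idn C P) (sq_dom \<psi>) g (sq_dom \<psi> \<cdot> g)"])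
        (simp_all add: Ar_Mon_iff square.expand t)
  qed simp
qed

text \<open>The source of \<open>i1 C Z I\<close> is zero, so \<open>tgt f\<close> kills
  \<open>sq_dom \<phi>\<close> and descends to an arrow \<open>h\<close> on its cokernel.
  Injectivity of \<open>I\<close> extends \<open>h\<close> along the arrow \<open>k\<close> between
  the cokernels of the objects \<open>sq_dom \<phi>\<close> and \<open>sq_cod \<phi>\<close>,
  provided that \<open>k\<close> is a monomorphism; this uses that inflations are cartesian.\<close>

lemma i1_injective:
  assumes Z: "is_zero_object C Z" and I: "is_injective C (kernel_cokernel_pairs C) I"
  shows "is_injective (Mon C) (Mon_conflations C) (i1 C Z I)"
proof -
  interpret M: exact_category "Mon C" "Mon_conflations C" by (rule exact_Mon)
  have [simp]: "I \<in> Ob C" "Z \<in> Ob C" using I Z by (simp_all add: is_injective_def is_zero_object_def)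
  note [simp] = i1_mono[OF Z]
  have a: "Dom C (i1 C Z I) = Z" "Cod C (i1 C Z I) = I" "i1 C Z I \<in> Ar C" by (simp_all add: i1_def)
  note [simp] = a(3)
  show ?thesis
  proof (rule M.injectiveI)
    fix \<phi> f assume \<phi>: "is_inflation (Mon_conflations C) \<phi>" and f: "f \<in> Ar (Mon C)"
      and dc: "Cod (Mon C) f = i1 C Z I" "Dom (Mon C) f = Dom (Mon C) \<phi>"
    then have \<phi>A: "\<phi> \<in> Ar (Mon C)" and t: "is_mono C (tgt \<phi>)" and cart: "cartesian \<phi>"
      by (simp_all add: Mon_inflation_iff)
    note [simp] = dc[simplified]
    note [simp] = Ar_MonD(1-10)[OF \<phi>A] Ar_MonD(5-10)[OF f, simplified a dc Mon_simps]
    have fz: "tgt f \<cdot> sq_dom \<phi> = Zero C (Dom C (sq_dom \<phi>)) I"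
      using Ar_MonD(11)[OF f] by (simp add: i1_def)
    obtain c d where c: "is_cokernel C (sq_dom \<phi>) c" and d: "is_cokernel C (sq_cod \<phi>) d"
      using ex_cokernel[of "sq_dom \<phi>"] ex_cokernel[of "sq_cod \<phi>"] by auto
    note [simp] = cokernel_typing[OF c] cokernel_typing[OF d]
    have "(d \<cdot> tgt \<phi>) \<cdot> sq_dom \<phi> = Zero C (Dom C (sq_dom \<phi>)) (Cod C d)"
      using Ar_MonD(11)[OF \<phi>A, symmetric] Comp_eq_assoc[OF cokernel_typing(4)[OF d], of "src \<phi>"] by simp
    then obtain k where k [simp]: "k \<in> Ar C" "Cod C k = Cod C d" "Dom C k = Cod C c" "k \<cdot> c = d \<cdot> tgt \<phi>"
      using cokernel_factor[OF c, of "d \<cdot> tgt \<phi>"] by auto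
    have km: "is_mono C k"
    \<comment> \<open>The square is read transposed to its use in \<open>Mon_inflation_iff\<close>.
      Cartesianness factors \<open>a\<close> through \<open>src \<phi>\<close>, and cancelling the
      monomorphism \<open>tgt \<phi>\<close> turns this into a factorization of \<open>b\<close>
      through \<open>sq_dom \<phi>\<close>.\<close>
    proof (rule cokernel_map_mono[OF c d Ar_MonD(2)[OF \<phi>A] _ _ _ _ _ _ k(4)])
      fix a b assume [simp]: "a \<in> Ar C" "b \<in> Ar C" "Dom C a = Dom C b" "Cod C a = Dom C (sq_cod \<phi>)"
        "Cod C b = Cod C (sq_dom \<phi>)" and eq: "tgt \<phi> \<cdot> b = sq_cod \<phi> \<cdot> a"
      obtain x where x [simp]: "x \<in> Ar C" "Dom C x = Dom C b" "Cod C x = Dom C (src \<phi>)" "src \<phi> \<cdot> x = a"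
        by (rule cartesianD[OF cart eq[symmetric]]) simp_all
      have "tgt \<phi> \<cdot> (sq_dom \<phi> \<cdot> x) = tgt \<phi> \<cdot> b"
        using Mon_comm_assoc[OF \<phi>A, of x] eq by simp
      then have "sq_dom \<phi> \<cdot> x = b" by (rule monoD[OF t]) simp_all
      then show "\<exists>x\<in>Ar C. Dom C x = Dom C b \<and> Cod C x = Dom C (sq_dom \<phi>) \<and> sq_dom \<phi> \<cdot> x = b"
        by (intro bexI[of _ x]) simp_all
    qed simp_all
    obtain h where h [simp]: "h \<in> Ar C" "Cod C h = I" "Dom C h = Cod C c" "h \<cdot> c = tgt f"
      using cokernel_factor[OF c, of "tgt f"] fz by (auto simp: a)
    obtain g where g [simp]: "g \<in> Ar C" "Cod C g = I" "Dom C g = Cod C d" "g \<cdot> k = h"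
      by (rule injective_extend[OF I, of k h]) (simp_all add: inflation_iff_mono km)
    have gd: "g \<cdot> (d \<cdot> tgt \<phi>) = tgt f"
      using Comp_eq_assoc[OF g(4), of c] by simp
    show "\<exists>g\<in>Ar (Mon C). Cod (Mon C) g = i1 C Z I \<and> Dom (Mon C) g = Cod (Mon C) \<phi> \<and> g \<cdot>\<^bsub>Mon C\<^esub> \<phi> = f"
    proof (rule bexI)
      let ?g = "Square (sq_cod \<phi>) (i1 C Z I) (Zero C (Dom C (sq_cod \<phi>)) Z) (g \<cdot> d)"
      show "?g \<in> Ar (Mon C)"
        by (simp add: Ar_Mon_iff a)
      have "src f = Zero C (Dom C (sq_dom \<phi>)) Z"
        by (rule zero_object_eq[OF Z]) (simp_all add: a)
      then show "Cod (Mon C) ?g = i1 C Z I \<and> Dom (Mon C) ?g = Cod (Mon C) \<phi> \<and> ?g \<cdot>\<^bsub>Mon C\<^esub> \<phi> = f"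
        by (simp add: square.expand gd)
    qed
  qed simp
qed

lemma i2_injective:
  assumes I: "is_injective C (kernel_cokernel_pairs C) I"
  shows "is_injective (Mon C) (Mon_conflations C) (i2 C I)"
proof -
  interpret M: exact_category "Mon C" "Mon_conflations C" by (rule exact_Mon)
  have [simp]: "I \<in> Ob C" using I by (simp add: is_injective_def)
  note [simp] = i2_mono[unfolded i2_def]
  show ?thesis
    unfolding i2_def
  proof (rule M.injectiveI)
    fix \<phi> f assume \<phi>: "is_inflation (Mon_conflations C) \<phi>" and f: "f \<in> Ar (Mon C)"
      and dc: "Cod (Mon C) f = Idn C I" "Dom (Mon C) f = Dom (Mon C) \<phi>"
    then have \<phi>A: "\<phi> \<in> Ar (Mon C)" and t: "is_mono C (tgt \<phi>)" by (simp_all add: Mon_inflation_iff)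
    note [simp] = dc[simplified]
    note [simp] = Ar_MonD(1-10)[OF \<phi>A] Ar_MonD(5-10)[OF f, simplified]
    obtain g where g [simp]: "g \<in> Ar C" "Cod C g = I" "Dom C g = Cod C (sq_cod \<phi>)" "g \<cdot> tgt \<phi> = tgt f"
      by (rule injective_extend[OF I, of "tgt \<phi>" "tgt f"]) (simp_all add: inflation_iff_mono t)
    have s: "g \<cdot> (sq_cod \<phi> \<cdot> src \<phi>) = src f"
      using Ar_MonD(11)[OF \<phi>A] Ar_MonD(11)[OF f] Comp_eq_assoc[OF g(4), of "sq_dom \<phi>"] by simp
    show "\<exists>g\<in>Ar (Mon C). Cod (Mon C) g = Idn C I \<and> Dom (Mon C) g = Cod (Mon C) \<phi> \<and> g \<cdot>\<^bsub>Mon C\<^esub> \<phi> = f"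
      by (rule bexI[of _ "Square (sq_cod \<phi>) (Idn C I) (g \<cdot> sq_cod \<phi>) g"])
        (simp_all add: Ar_Mon_iff square.expand s)
  qed simp
qed

text \<open>A single projective cover \<open>e\<close> of the direct sum of source and target
  provides the common \<open>P\<close>: its composites with the two projections are epimorphisms
  onto the source and the target of \<open>\<alpha>\<close>.\<close>

lemma Mon_deflation_from_i1_i2:
  assumes F: "frobenius_category C (kernel_cokernel_pairs C)"
    and Z: "is_zero_object C Z" and \<alpha>: "is_mono C \<alpha>"
  obtains P S \<psi> where "is_projective C (kernel_cokernel_pairs C) P"
    "is_direct_sum (Mon C) (i1 C Z P) (i2 C P) S"
    "is_deflation (Mon_conflations C) \<psi>" "sq_dom \<psi> = S" "sq_cod \<psi> = \<alpha>"
proof -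
  interpret F: frobenius_category C "kernel_cokernel_pairs C" by (rule F)
  interpret M: exact_category "Mon C" "Mon_conflations C" by (rule exact_Mon)
  note [simp] = \<alpha> mono_Ar[OF \<alpha>]
  have [simp]: "Z \<in> Ob C" using Z by (simp add: is_zero_object_def)
  obtain T i j p q where T: "is_biproduct C (Dom C \<alpha>) (Cod C \<alpha>) T i j p q"
    using ex_direct_sum[of "Dom C \<alpha>" "Cod C \<alpha>"] unfolding is_direct_sum_def by auto
  note [simp] = biproduct_typing(1-19)[OF T]
  obtain e where e: "is_epi C e" "Cod C e = T" and P: "is_projective C (kernel_cokernel_pairs C) (Dom C e)"
    using F.enough_projectives[of T] by (auto simp: deflation_iff_epi)
  define P where "P = Dom C e"
  note [simp] = epi_Ar[OF e(1)] e(2) P_def[symmetric]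
  have [simp]: "P \<in> Ob C" using Dom_Ob[of e] by simp
  have "is_epi C p" "is_epi C q"
    by (rule split_epi[of p i "Dom C \<alpha>"] split_epi[of q j "Cod C \<alpha>"]; simp)+
  then have ep: "is_epi C (p \<cdot> e)" "is_epi C (q \<cdot> e)"
    using epi_comp[OF e(1), of p] epi_comp[OF e(1), of q] by simp_all
  have [simp]: "is_mono C (i1 C Z P)" "is_mono C (i2 C P)" by (simp_all add: i1_mono[OF Z] i2_mono)
  obtain S where S: "is_direct_sum (Mon C) (i1 C Z P) (i2 C P) S"
    using M.ex_direct_sum[of "i1 C Z P" "i2 C P"] by auto
  then obtain i' j' p' q' where S': "is_biproduct (Mon C) (i1 C Z P) (i2 C P) S i' j' p' q'"
    unfolding is_direct_sum_def by blast
  let ?f = "Square (i1 C Z P) \<alpha> (Zero C Z (Dom C \<alpha>)) (q \<cdot> e)"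
  let ?g = "Square (i2 C P) \<alpha> (p \<cdot> e) (\<alpha> \<cdot> (p \<cdot> e))"
  have fg: "?f \<in> Ar (Mon C)" "?g \<in> Ar (Mon C)"
    by (simp_all add: Ar_Mon_iff, simp_all add: i1_def i2_def)
  obtain h where h: "h \<in> Ar (Mon C)" and hS [simp]: "sq_cod h = \<alpha>" "sq_dom h = S"
    and hi: "h \<cdot>\<^bsub>Mon C\<^esub> i' = ?f" and hj: "h \<cdot>\<^bsub>Mon C\<^esub> j' = ?g"
    using M.biproduct_copair[OF S' fg] by auto
  note ij = M.biproduct_typing(4-9)[OF S', simplified Mon_simps]
  note [simp] = ij(2,3,5,6) Ar_MonD(5-10)[OF ij(1)] Ar_MonD(5-10)[OF ij(4)] Ar_MonD(5-10)[OF h]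
  \<comment> \<open>The source of \<open>\<alpha>\<close> is covered by the summand
    \<open>i2 C P\<close> and its target by the summand \<open>i1 C Z P\<close>; an arrow is an
    epimorphism as soon as its restriction to one summand is.\<close>
  have "is_epi C (src h \<cdot> src j')" "is_epi C (tgt h \<cdot> tgt i')"
    using ep hi hj by simp_all
  then have "is_epi C (src h)" "is_epi C (tgt h)"
    using epi_cancel[of "src h" "src j'"] epi_cancel[of "tgt h" "tgt i'"] by simp_all
  then have "is_deflation (Mon_conflations C) h" using h by (simp add: Mon_deflation_iff)
  with P S show thesis by (intro that[of P S h]) simp_all
qed

text \<open>The cokernel of \<open>\<alpha>\<close> takes the place that the target has for covers,
  since arrows into \<open>i1 C Z I\<close> are arrows out of the cokernel. The embedding
  \<open>m\<close> gives monomorphisms into \<open>I\<close> from the source and from the cokernel;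
  together they detect every arrow into the target.\<close>

lemma Mon_inflation_to_i1_i2:
  assumes F: "frobenius_category C (kernel_cokernel_pairs C)"
    and Z: "is_zero_object C Z" and \<alpha>: "is_mono C \<alpha>"
  obtains I S \<phi> where "is_injective C (kernel_cokernel_pairs C) I"
    "is_direct_sum (Mon C) (i1 C Z I) (i2 C I) S"
    "is_inflation (Mon_conflations C) \<phi>" "sq_dom \<phi> = \<alpha>" "sq_cod \<phi> = S"
proof -
  interpret F: frobenius_category C "kernel_cokernel_pairs C" by (rule F)
  interpret M: exact_category "Mon C" "Mon_conflations C" by (rule exact_Mon)
  note [simp] = \<alpha> mono_Ar[OF \<alpha>]
  have [simp]: "Z \<in> Ob C" using Z by (simp add: is_zero_object_def)
  obtain c where c: "is_cokernel C \<alpha> c" using ex_cokernel[of \<alpha>] by auto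
  note [simp] = cokernel_typing[OF c]
  obtain T i j p q where T: "is_biproduct C (Dom C \<alpha>) (Cod C c) T i j p q"
    using ex_direct_sum[of "Dom C \<alpha>" "Cod C c"] unfolding is_direct_sum_def by auto
  note [simp] = biproduct_typing(1-19)[OF T]
  obtain m where m: "is_mono C m" "Dom C m = T" and I: "is_injective C (kernel_cokernel_pairs C) (Cod C m)"
    using F.enough_injectives[of T] by (auto simp: inflation_iff_mono)
  define I where "I = Cod C m"
  note [simp] = mono_Ar[OF m(1)] m(2) I_def[symmetric]
  have [simp]: "I \<in> Ob C" using Cod_Ob[of m] by simp
  have "is_mono C i" "is_mono C j"
    by (rule split_mono[of p i "Dom C \<alpha>"] split_mono[of q j "Cod C c"]; simp)+
  then have mi: "is_mono C (m \<cdot> i)" and mj: "is_mono C (m \<cdot> j)"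
    using mono_comp[OF _ m(1), of i] mono_comp[OF _ m(1), of j] by simp_all
  have [simp]: "is_mono C (i1 C Z I)" "is_mono C (i2 C I)" by (simp_all add: i1_mono[OF Z] i2_mono)
  \<comment> \<open>\<open>e\<close> extends the embedding of the source along
    \<open>\<alpha>\<close>. It may fail to be a monomorphism, but what it loses is seen by the
    coordinate \<open>m \<cdot> (j \<cdot> c)\<close>.\<close>
  obtain e where e [simp]: "e \<in> Ar C" "Cod C e = I" "Dom C e = Cod C \<alpha>" "e \<cdot> \<alpha> = m \<cdot> i"
    by (rule injective_extend[OF I, of \<alpha> "m \<cdot> i"]) (simp_all add: inflation_iff_mono)
  obtain S where S: "is_direct_sum (Mon C) (i1 C Z I) (i2 C I) S"
    using M.ex_direct_sum[of "i1 C Z I" "i2 C I"] by auto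
  then obtain i' j' p' q' where S': "is_biproduct (Mon C) (i1 C Z I) (i2 C I) S i' j' p' q'"
    unfolding is_direct_sum_def by blast
  let ?f = "Square \<alpha> (i1 C Z I) (Zero C (Dom C \<alpha>) Z) (m \<cdot> (j \<cdot> c))"
  let ?g = "Square \<alpha> (i2 C I) (m \<cdot> i) e"
  have fg: "?f \<in> Ar (Mon C)" "?g \<in> Ar (Mon C)"
    by (simp_all add: Ar_Mon_iff, simp_all add: i1_def i2_def)
  obtain h where h: "h \<in> Ar (Mon C)" and hS [simp]: "sq_dom h = \<alpha>" "sq_cod h = S"
    and hp: "p' \<cdot>\<^bsub>Mon C\<^esub> h = ?f" and hq: "q' \<cdot>\<^bsub>Mon C\<^esub> h = ?g"
    using M.biproduct_pair[OF S' fg] by auto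
  note pq = M.biproduct_typing(10-15)[OF S', simplified Mon_simps]
  note [simp] = pq(2,3,5,6) Ar_MonD(5-10)[OF pq(1)] Ar_MonD(5-10)[OF pq(4)] Ar_MonD(3-10)[OF h, simplified hS]
  have tp: "tgt p' \<cdot> tgt h = m \<cdot> (j \<cdot> c)" and tq: "tgt q' \<cdot> tgt h = e"
    using hp hq by simp_all
  \<comment> \<open>The \<open>i1\<close> coordinate of \<open>tgt h\<close> is \<open>c\<close>
    followed by a monomorphism, so exactly the arrows that factor through \<open>\<alpha>\<close>
    are killed by it. This serves for the monicity of \<open>tgt h\<close> and for
    cartesianness.\<close>
  have lift: "\<exists>a\<in>Ar C. Dom C a = Dom C b \<and> Cod C a = Dom C \<alpha> \<and> \<alpha> \<cdot> a = b"
    if [simp]: "b \<in> Ar C" "Cod C b = Cod C \<alpha>" and z: "tgt p' \<cdot> (tgt h \<cdot> b) = Zero C (Dom C b) (Cod C (tgt p'))" for b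
  proof -
    have "(m \<cdot> j) \<cdot> (c \<cdot> b) = Zero C (Dom C b) (Cod C (m \<cdot> j))"
      using Comp_eq_assoc[OF tp, of b] z by (simp add: i1_def)
    then have "c \<cdot> b = Zero C (Dom C b) (Cod C c)"
      by - (rule mono_zeroD[OF mj, THEN trans], simp_all)
    then show ?thesis
      by - (rule kernel_factor[OF kernel_of_cokernel[OF \<alpha> c], of b], auto)
  qed
  have "is_mono C (tgt h)"
  proof (rule monoI)
    fix b assume [simp]: "b \<in> Ar C" "Cod C b = Dom C (tgt h)" and z: "tgt h \<cdot> b = Zero C (Dom C b) (Cod C (tgt h))"
    have "tgt p' \<cdot> (tgt h \<cdot> b) = Zero C (Dom C b) (Cod C (tgt p'))" using z by simp
    then obtain a where [simp]: "a \<in> Ar C" "Dom C a = Dom C b" "Cod C a = Dom C \<alpha>" and a: "\<alpha> \<cdot> a = b"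
      using lift[of b] by auto
    have "e \<cdot> b = Zero C (Dom C b) I"
      using Comp_eq_assoc[OF tq, of b] z by (simp add: i2_def)
    then have "(m \<cdot> i) \<cdot> a = Zero C (Dom C b) I"
      using Comp_eq_assoc[OF e(4), of a] a by simp
    then have "a = Zero C (Dom C b) (Dom C \<alpha>)"
      by - (rule mono_zeroD[OF mi, THEN trans], simp_all)
    with a show "b = Zero C (Dom C b) (Dom C (tgt h))" by simp
  qed simp
  moreover have "cartesian h"
  proof (rule cartesianI)
    fix a b assume [simp]: "a \<in> Ar C" "b \<in> Ar C" "Dom C a = Dom C b"
      and ab: "Cod C a = Dom C (tgt h)" "Cod C b = Dom C (sq_cod h)" and eq: "sq_cod h \<cdot> b = tgt h \<cdot> a"
    note [simp] = ab[simplified]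
    \<comment> \<open>An arrow that comes from the source of \<open>S\<close> has zero
      \<open>i1\<close> coordinate, since \<open>sq_cod p'\<close> is the zero arrow
      \<open>i1 C Z I\<close>; hence \<open>lift\<close> applies to \<open>a\<close>.\<close>
    have "tgt p' \<cdot> (tgt h \<cdot> a) = sq_cod p' \<cdot> (src p' \<cdot> b)"
      using Mon_comm_assoc[OF pq(1), of b] eq by simp
    also have "\<dots> = Zero C (Dom C b) I" by (simp add: i1_def)
    finally obtain x where [simp]: "x \<in> Ar C" "Dom C x = Dom C b" "Cod C x = Dom C \<alpha>" and x: "\<alpha> \<cdot> x = a"
      using lift[of a] by (auto simp: i1_def)
    have "sq_cod h \<cdot> (src h \<cdot> x) = sq_cod h \<cdot> b"
      using Mon_comm_assoc[OF h, of x] x eq by simp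
    then have "src h \<cdot> x = b" by (rule monoD[OF Ar_MonD(2)[OF h]]) simp_all
    then show "\<exists>x\<in>Ar C. Dom C x = Dom C b \<and> Cod C x = Dom C (src h) \<and> src h \<cdot> x = b"
      by (intro bexI[of _ x]) simp_all
  qed
  ultimately have "is_inflation (Mon_conflations C) h" using h by (simp add: Mon_inflation_iff)
  with I S show thesis by (intro that[of I S h]) simp_all
qed

lemma frobenius_Mon:
  assumes F: "frobenius_category C (kernel_cokernel_pairs C)"
  shows "frobenius_category (Mon C) (Mon_conflations C)"
    and "is_zero_object C Z \<Longrightarrow> is_mono C \<alpha> \<Longrightarrow>
      is_projective (Mon C) (Mon_conflations C) \<alpha> \<longleftrightarrow>
      (\<exists>P S. is_projective C (kernel_cokernel_pairs C) P \<and>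
        is_direct_sum (Mon C) (i1 C Z P) (i2 C P) S \<and> is_direct_summand (Mon C) \<alpha> S)"
proof -
  interpret F: frobenius_category C "kernel_cokernel_pairs C" by (rule F)
  interpret M: exact_category "Mon C" "Mon_conflations C" by (rule exact_Mon)
  let ?proj = "is_projective (Mon C) (Mon_conflations C)"
  let ?inj = "is_injective (Mon C) (Mon_conflations C)"
  have P_I: "is_projective C (kernel_cokernel_pairs C) P \<longleftrightarrow> is_injective C (kernel_cokernel_pairs C) P" for P
    using F.projective_iff_injective[of P] by (auto simp: is_projective_def is_injective_def)
  \<comment> \<open>Where the Frobenius hypothesis on the base category pays off: \<open>P\<close>
    is projective and injective, so the sum built from it has both properties in
    \<open>Mon C\<close>. It is the bridge between the two classes.\<close>
  have S: "?proj S \<and> ?inj S" if Z: "is_zero_object C Z" and P: "is_projective C (kernel_cokernel_pairs C) P"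
    and S: "is_direct_sum (Mon C) (i1 C Z P) (i2 C P) S" for Z P S
  proof -
    from S obtain i j p q where S': "is_biproduct (Mon C) (i1 C Z P) (i2 C P) S i j p q"
      unfolding is_direct_sum_def by blast
    show ?thesis
      using M.biproduct_projective[OF S' i1_projective[OF Z P] i2_projective[OF P] M.deflation_Ar]
        M.biproduct_injective[OF S' i1_injective[OF Z] i2_injective M.inflation_Ar] P
      by (simp add: P_I)
  qed
  show iff: "?proj \<alpha> \<longleftrightarrow>
      (\<exists>P S. is_projective C (kernel_cokernel_pairs C) P \<and>
        is_direct_sum (Mon C) (i1 C Z P) (i2 C P) S \<and> is_direct_summand (Mon C) \<alpha> S)"
    if Z: "is_zero_object C Z" and \<alpha>: "is_mono C \<alpha>" for Z \<alpha>
  proof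
    assume p: "?proj \<alpha>"
    obtain P S \<psi> where "is_projective C (kernel_cokernel_pairs C) P"
      "is_direct_sum (Mon C) (i1 C Z P) (i2 C P) S"
      and \<psi>: "is_deflation (Mon_conflations C) \<psi>" "sq_dom \<psi> = S" "sq_cod \<psi> = \<alpha>"
      by (rule Mon_deflation_from_i1_i2[OF F Z \<alpha>])
    moreover have "is_direct_summand (Mon C) \<alpha> S"
      using M.deflation_onto_projective_splits[OF \<psi>(1)] \<psi>(2,3) p by simp
    ultimately show "\<exists>P S. is_projective C (kernel_cokernel_pairs C) P \<and>
        is_direct_sum (Mon C) (i1 C Z P) (i2 C P) S \<and> is_direct_summand (Mon C) \<alpha> S" by blast
  next
    assume "\<exists>P S. is_projective C (kernel_cokernel_pairs C) P \<and>
        is_direct_sum (Mon C) (i1 C Z P) (i2 C P) S \<and> is_direct_summand (Mon C) \<alpha> S"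
    then show "?proj \<alpha>" using S[OF Z] M.direct_summand_projective by blast
  qed
  \<comment> \<open>The Frobenius property does not mention a zero object, so any one may be chosen;
    the description of the projectives holds for each of them.\<close>
  obtain Z where Z: "is_zero_object C Z" using ex_zero_object by blast
  show "frobenius_category (Mon C) (Mon_conflations C)"
  proof (intro frobenius_category.intro frobenius_category_axioms.intro exact_Mon)
    fix \<alpha> assume "\<alpha> \<in> Ob (Mon C)"
    then have \<alpha>: "is_mono C \<alpha>" by simp
    obtain P S' \<psi> where \<psi>: "is_projective C (kernel_cokernel_pairs C) P"
      "is_direct_sum (Mon C) (i1 C Z P) (i2 C P) S'"
      "is_deflation (Mon_conflations C) \<psi>" "sq_dom \<psi> = S'" "sq_cod \<psi> = \<alpha>"
      by (rule Mon_deflation_from_i1_i2[OF F Z \<alpha>])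
    with S[OF Z \<psi>(1,2)]
    show "\<exists>p. is_deflation (Mon_conflations C) p \<and> Cod (Mon C) p = \<alpha> \<and> ?proj (Dom (Mon C) p)"
      by (intro exI[of _ \<psi>]) simp
    obtain I T \<phi> where I: "is_injective C (kernel_cokernel_pairs C) I"
      and T: "is_direct_sum (Mon C) (i1 C Z I) (i2 C I) T"
      and \<phi>: "is_inflation (Mon_conflations C) \<phi>" "sq_dom \<phi> = \<alpha>" "sq_cod \<phi> = T"
      by (rule Mon_inflation_to_i1_i2[OF F Z \<alpha>])
    from I have I': "is_projective C (kernel_cokernel_pairs C) I" by (simp add: P_I)
    note T' = S[OF Z I' T]
    with \<phi> show "\<exists>i. is_inflation (Mon_conflations C) i \<and> Dom (Mon C) i = \<alpha> \<and> ?inj (Cod (Mon C) i)"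
      by (intro exI[of _ \<phi>]) simp
    show "?proj \<alpha> \<longleftrightarrow> ?inj \<alpha>"
    proof
      assume "?proj \<alpha>"
      \<comment> \<open>A projective object is a summand of a sum \<open>S\<close>, which is
        injective as well.\<close>
      then show "?inj \<alpha>" using iff[OF Z \<alpha>] S[OF Z] M.direct_summand_injective by blast
    next
      assume inj: "?inj \<alpha>"
      have [simp]: "\<phi> \<in> Ar (Mon C)" by (rule M.inflation_Ar[OF \<phi>(1)])
      \<comment> \<open>Extending the identity of the injective object along its inflation into
        \<open>T\<close> gives a retraction; as \<open>T\<close> is also projective, so is its
        retract.\<close>
      obtain r where r: "r \<in> Ar (Mon C)" "Cod (Mon C) r = \<alpha>" "Dom (Mon C) r = Cod (Mon C) \<phi>"
        "r \<cdot>\<^bsub>Mon C\<^esub> \<phi> = Idn (Mon C) \<alpha>"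
      proof (rule M.injective_extend[OF inj \<phi>(1), of "Idn (Mon C) \<alpha>"])
        show "Idn (Mon C) \<alpha> \<in> Ar (Mon C)" by (rule M.Idn_typing) (simp add: \<alpha>)
      qed (use \<phi>(2) in simp_all)
      show "?proj \<alpha>"
        by (rule M.retract_projective[OF T'[THEN conjunct1] M.deflation_Ar r(1) _ _ _ r(2) _ r(4)])
          (use r(3) \<phi> in simp_all)
    qed
  qed
qed

end

theorem lemma2p1:
  fixes A :: "('o, 'm) preadditive_data"
  assumes "abelian_category A"
  shows "exact_category (Mon A) (Mon_conflations A) \<and>
    (frobenius_category A (short_exact_sequences A) \<longrightarrow>
      frobenius_category (Mon A) (Mon_conflations A) \<and>
      (\<forall>Z. is_zero_object A Z \<longrightarrow>
        (\<forall>\<alpha>\<in>Ob (Mon A).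
          is_projective (Mon A) (Mon_conflations A) \<alpha> \<longleftrightarrow>
          (\<exists>P S. is_projective A (short_exact_sequences A) P \<and>
            is_direct_sum (Mon A) (i1 A Z P) (i2 A P) S \<and>
            is_direct_summand (Mon A) \<alpha> S))))"
proof -
  interpret abelian_category A by (rule assms)
  show ?thesis using exact_Mon frobenius_Mon by simp
qed

end
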